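(* Let $m\in\mathbb{N}_0$ and let $\nu\ge 2m$ be fixed. Let $j_{\nu,k}^{(N)}$ denote the $k$-th positive zero of $J_\nu^{(N)}$, and let $\alpha_{s,N}$ be the coefficients (depending on $\nu$) defined in the context. Then the following McMahon-type asymptotic expansions hold as $k\to\infty$. (i) (Even derivatives) With $\alpha=k\pi+\frac12\nu\pi-\frac{\pi}{4}$, $$j_{\nu,k+1}^{(2m)}\sim\alpha+\frac{\alpha_{1,2m}}{\alpha_{0,2m}}\frac1\alpha+\left(\frac{\alpha_{3,2m}}{\alpha_{0,2m}}-\frac{\alpha_{1,2m}\,\alpha_{2,2m}}{(\alpha_{0,2m})^2}-\frac13\frac{(\alpha_{1,2m})^3}{(\alpha_{0,2m})^3}-\left(\frac{\alpha_{1,2m}}{\alpha_{0,2m}}\right)^2\right)\frac1{\alpha^3}-\cdots .$$ (ii) (Odd derivatives) With $\beta=k\pi+\frac12\nu\pi-\frac{3\pi}{4}$, $$j_{\nu,k}^{(2m+1)}\sim\beta-\frac{\alpha_{1,2m+1}}{\alpha_{0,2m+1}}\frac1\beta-\left(\left(\frac{\alpha_{1,2m+1}}{\alpha_{0,2m+1}}\right)^2+\frac{\alpha_{3,2m+1}}{\alpha_{0,2m+1}}-\frac{\alpha_{1,2m+1}\,\alpha_{2,2m+1}}{(\alpha_{0,2m+1})^2}-\frac13\frac{(\alpha_{1,2m+1})^3}{(\alpha_{0,2m+1})^3}\right)\frac1{\beta^3}-\cdots .$$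
   Context: $J_\nu$ is the Bessel function of the first kind of order $\nu$ and $J_\nu^{(N)}$ its $N$-th derivative; $\mathbb{N}_0=\{0,1,2,\dots\}$. Coefficients $\alpha_{s,N}$ (with $\alpha_{-1,N}=0$): for $p\ge0$, $\alpha_{2p,0}=(-1)^pA_{2p}(\nu)$ and $\alpha_{2p+1,0}=(-1)^{p+1}A_{2p+1}(\nu)$, where $A_s(\nu)=\frac{(4\nu^2-1)(4\nu^2-3^2)\cdots(4\nu^2-(2s-1)^2)}{s!\,8^s}$ and $A_0=1$. For $n\ge0$: $\alpha_{2p,2n+1}=-\frac{4p-1}{2}\alpha_{2p-1,2n}-\alpha_{2p,2n}$ and $\alpha_{2p+1,2n+1}=\alpha_{2p+1,2n}-\frac{4p+1}{2}\alpha_{2p,2n}$. For $n\ge1$: $\alpha_{2p,2n}=\alpha_{2p,2n-1}-\frac{4p-1}{2}\alpha_{2p-1,2n-1}$ and $\alpha_{2p+1,2n}=-\alpha_{2p+1,2n-1}-\frac{4p+1}{2}\alpha_{2p,2n-1}$.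
   Formalization: The printed zero indices are wrong in general (for m=0, ν=1/2, j_{ν,k+1}-α=π); the formal statement uses index k+m in (i), and in (ii) k+m for ν>2m and k+m-1 for ν=2m, which agree with the printed k+1 and k wherever those are correct. *)

theory Defs
  imports "HOL-Analysis.Analysis" "HOL-Library.Landau_Symbols"
begin

text \<open>The function below is the Bessel function of the first kind only for \<open>x > 0\<close>;
  \<open>powr\<close> gives it junk values elsewhere.\<close>

definition bessel_J :: "real \<Rightarrow> real \<Rightarrow> real" where
  "bessel_J \<nu> x =
     (x / 2) powr \<nu> * (\<Sum>n. (-1) ^ n * rGamma (\<nu> + real n + 1) / fact n * (x / 2) ^ (2 * n))"

definition bessel_J_deriv :: "real \<Rightarrow> nat \<Rightarrow> real \<Rightarrow> real" where
  "bessel_J_deriv \<nu> N = (deriv ^^ N) (bessel_J \<nu>)"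

text \<open>The zeros are numbered from \<open>k = 1\<close> and counted without multiplicity; \<open>x = 0\<close> is never counted.
  With this numbering the zero of \<open>J\<^sub>\<nu>\<^sup>(\<^sup>2\<^sup>m\<^sup>)\<close> near \<open>k\<pi> + \<nu>\<pi>/2 - \<pi>/4\<close> has index \<open>k + m\<close>, since every
  two differentiations add one zero near the origin. The same holds for \<open>J\<^sub>\<nu>\<^sup>(\<^sup>2\<^sup>m\<^sup>+\<^sup>1\<^sup>)\<close> and
  \<open>k\<pi> + \<nu>\<pi>/2 - 3\<pi>/4\<close> if \<open>\<nu> > 2m\<close>; for \<open>\<nu> = 2m\<close> the first zero of that (then odd) function is
  \<open>x = 0\<close>, and the index is \<open>k + m - 1\<close>, as in \<open>J\<^sub>0' = -J\<^sub>1\<close>.\<close>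

definition kth_positive_zero :: "(real \<Rightarrow> real) \<Rightarrow> nat \<Rightarrow> real" where
  "kth_positive_zero f k =
     (THE x. 0 < x \<and> f x = 0 \<and> finite {y. 0 < y \<and> y \<le> x \<and> f y = 0} \<and>
             card {y. 0 < y \<and> y \<le> x \<and> f y = 0} = k)"

definition bessel_J_deriv_zero :: "real \<Rightarrow> nat \<Rightarrow> nat \<Rightarrow> real" where
  "bessel_J_deriv_zero \<nu> N k = kth_positive_zero (bessel_J_deriv \<nu> N) k"

definition hankel_A :: "real \<Rightarrow> nat \<Rightarrow> real" where
  "hankel_A \<nu> s = (\<Prod>j=1..s. 4 * \<nu>\<^sup>2 - (2 * real j - 1)\<^sup>2) / (fact s * 8 ^ s)"

text \<open>\<open>mcmahon_coeff \<nu> s N\<close> is \<open>\<alpha>\<^sub>s\<^sub>,\<^sub>N\<close>. The index \<open>s\<close> is an integer so that the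
  recurrences may refer to \<open>s = -1\<close>; in all clauses \<open>p\<close> is \<open>s div 2\<close>.\<close>

primrec mcmahon_coeff :: "real \<Rightarrow> int \<Rightarrow> nat \<Rightarrow> real" where
  "mcmahon_coeff \<nu> s 0 =
     (if s < 0 then 0
      else if even s then (-1) ^ nat (s div 2) * hankel_A \<nu> (nat s)
      else (-1) ^ (nat (s div 2) + 1) * hankel_A \<nu> (nat s))"
| "mcmahon_coeff \<nu> s (Suc N) =
     (if s < 0 then 0
      else if even N then
        (if even s
         then - (4 * real_of_int (s div 2) - 1) / 2 * mcmahon_coeff \<nu> (s - 1) N - mcmahon_coeff \<nu> s N
         else mcmahon_coeff \<nu> s N - (4 * real_of_int (s div 2) + 1) / 2 * mcmahon_coeff \<nu> (s - 1) N)
      else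
        (if even s
         then mcmahon_coeff \<nu> s N - (4 * real_of_int (s div 2) - 1) / 2 * mcmahon_coeff \<nu> (s - 1) N
         else - mcmahon_coeff \<nu> s N - (4 * real_of_int (s div 2) + 1) / 2 * mcmahon_coeff \<nu> (s - 1) N))"

lemma mcmahon_coeff_minus_one: "mcmahon_coeff \<nu> (-1) N = 0"
  by (cases N) auto

lemma mcmahon_coeff_recurrences:
  fixes p n :: nat
  shows "mcmahon_coeff \<nu> (2 * int p) 0 = (-1) ^ p * hankel_A \<nu> (2 * p)"
    and "mcmahon_coeff \<nu> (2 * int p + 1) 0 = (-1) ^ (p + 1) * hankel_A \<nu> (2 * p + 1)"
    and "mcmahon_coeff \<nu> (2 * int p) (2 * n + 1) =
           - (4 * real p - 1) / 2 * mcmahon_coeff \<nu> (2 * int p - 1) (2 * n)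
           - mcmahon_coeff \<nu> (2 * int p) (2 * n)"
    and "mcmahon_coeff \<nu> (2 * int p + 1) (2 * n + 1) =
           mcmahon_coeff \<nu> (2 * int p + 1) (2 * n)
           - (4 * real p + 1) / 2 * mcmahon_coeff \<nu> (2 * int p) (2 * n)"
    and "n \<ge> 1 \<Longrightarrow> mcmahon_coeff \<nu> (2 * int p) (2 * n) =
           mcmahon_coeff \<nu> (2 * int p) (2 * n - 1)
           - (4 * real p - 1) / 2 * mcmahon_coeff \<nu> (2 * int p - 1) (2 * n - 1)"
    and "n \<ge> 1 \<Longrightarrow> mcmahon_coeff \<nu> (2 * int p + 1) (2 * n) =
           - mcmahon_coeff \<nu> (2 * int p + 1) (2 * n - 1)
           - (4 * real p + 1) / 2 * mcmahon_coeff \<nu> (2 * int p) (2 * n - 1)"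
proof -
  have nat_odd: "nat (2 * int p + 1) = 2 * p + 1" "nat (2 * int p) = 2 * p" by auto
  show "mcmahon_coeff \<nu> (2 * int p) 0 = (-1) ^ p * hankel_A \<nu> (2 * p)"
    and "mcmahon_coeff \<nu> (2 * int p + 1) 0 = (-1) ^ (p + 1) * hankel_A \<nu> (2 * p + 1)"
    using nat_odd by (auto simp del: nat_mult_distrib)
  show "mcmahon_coeff \<nu> (2 * int p) (2 * n + 1) =
           - (4 * real p - 1) / 2 * mcmahon_coeff \<nu> (2 * int p - 1) (2 * n)
           - mcmahon_coeff \<nu> (2 * int p) (2 * n)"
    and "mcmahon_coeff \<nu> (2 * int p + 1) (2 * n + 1) =
           mcmahon_coeff \<nu> (2 * int p + 1) (2 * n)
           - (4 * real p + 1) / 2 * mcmahon_coeff \<nu> (2 * int p) (2 * n)"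
    by simp_all
  assume "n \<ge> 1"
  then obtain j where j: "n = Suc j" by (cases n) auto
  show "mcmahon_coeff \<nu> (2 * int p) (2 * n) =
           mcmahon_coeff \<nu> (2 * int p) (2 * n - 1)
           - (4 * real p - 1) / 2 * mcmahon_coeff \<nu> (2 * int p - 1) (2 * n - 1)"
    and "mcmahon_coeff \<nu> (2 * int p + 1) (2 * n) =
           - mcmahon_coeff \<nu> (2 * int p + 1) (2 * n - 1)
           - (4 * real p + 1) / 2 * mcmahon_coeff \<nu> (2 * int p) (2 * n - 1)"
    by (simp_all add: j del: mcmahon_coeff.simps, simp_all add: mcmahon_coeff.simps(2)[of _ _ "Suc (2 * j)"] del: mcmahon_coeff.simps)
qed

text \<open>\<open>mcmahon_expansion z \<phi> a b\<close> says that \<open>z \<sim> \<phi> + a / \<phi> + b / \<phi>\<^sup>3 + \<dots>\<close> as \<open>k \<rightarrow> \<infinity>\<close>: a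
  Poincare expansion to all orders in odd powers of \<open>1 / \<phi>\<close>, in which only the first two
  coefficients are prescribed.\<close>

definition mcmahon_expansion ::
    "(nat \<Rightarrow> real) \<Rightarrow> (nat \<Rightarrow> real) \<Rightarrow> real \<Rightarrow> real \<Rightarrow> bool" where
  "mcmahon_expansion z \<phi> a b \<longleftrightarrow>
     (\<exists>c :: nat \<Rightarrow> real. c 0 = a \<and> c 1 = b \<and>
       (\<forall>M. (\<lambda>k. z k - (\<phi> k + (\<Sum>s<M. c s / \<phi> k ^ (2 * s + 1))))
              \<in> O(\<lambda>k. 1 / \<phi> k ^ (2 * M + 1))))"

end

theory Submission
  imports Defs "HOL-Real_Asymp.Real_Asymp"
begin

text \<open>Bessel's equation is also solved by \<open>e\<^sup>i\<^sup>x x\<^sup>\<nu> \<integral> e\<^sup>-\<^sup>x\<^sup>s s\<^sup>\<nu>\<^sup>-\<^sup>1\<^sup>/\<^sup>2 (1 + i s / 2)\<^sup>\<nu>\<^sup>-\<^sup>1\<^sup>/\<^sup>2 ds\<close>, and the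
  behaviour at \<open>0\<close> shows that \<open>J\<^sub>\<nu>\<close> is a constant times the real part of this function rotated by
  \<open>e\<^sup>-\<^sup>i\<^sup>(\<^sup>\<nu>\<^sup>\<pi>\<^sup>/\<^sup>2\<^sup>+\<^sup>\<pi>\<^sup>/\<^sup>4\<^sup>)\<close>. Watson's lemma then gives \<open>J\<^sup>(\<^sup>N\<^sup>)(x) = \<kappa> x\<^sup>-\<^sup>1\<^sup>/\<^sup>2 Im (e\<^sup>i\<^sup>(\<^sup>x\<^sup>-\<^sup>\<beta>\<^sup>) B(x))\<close> with a
  Poincare expansion of \<open>B\<close>. Hence far out there is exactly one zero \<open>z\<close> near each \<open>\<phi> = k\<pi> + \<beta>\<close>, it satisfies
  \<open>z - \<phi> = - arctan (Im B(z) / Re B(z))\<close>, and solving this for \<open>z\<close> in powers of \<open>1 / \<phi>\<close> gives the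
  expansion.

  The index of that zero follows by comparison. For \<open>J\<^sub>\<nu>\<close> the number of zeros up to a given point
  decreases in \<open>\<nu>\<close> (Sturm), the zeros of \<open>J\<^sub>\<nu>\<close> and \<open>J\<^sub>\<nu>\<^sub>+\<^sub>1\<close> interlace, and \<open>J\<^sub>1\<^sub>/\<^sub>2\<close> is elementary. For the
  derivatives, the power series of \<open>J\<^sup>(\<^sup>N\<^sup>)\<close> is a limit of polynomials with only positive zeros if
  \<open>N \<le> \<nu>\<close>; the resulting Laguerre inequality makes the zeros of \<open>J\<^sup>(\<^sup>N\<^sup>)\<close> and \<open>J\<^sup>(\<^sup>N\<^sup>+\<^sup>1\<^sup>)\<close> interlace.\<close>

section \<open>Power series of the derivatives\<close>

text \<open>Three obstacles shape the proof. An asymptotic expansion may not be differentiated term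
  by term. The Laplace transforms with kernels multiplied by powers of -s form a family closed under
  differentiation, and each member is expanded on its own; the expansions of all derivatives of J
  rest on this. Next, asymptotics fix the number of a zero only up to an additive constant. That
  constant is an integer, so it is pinned by comparing zero counts of two functions whose grids of
  zeros are pi/2 apart, at two points between neighbouring grid points; count inequalities with an
  error of one are then sharp enough. A zero at x = 0, which is not counted, is what makes the case
  \<open>\<nu> = N\<close> exceptional. Finally, the zero equation expresses z - \<phi> through z,
  whereas powers of 1/\<phi> are wanted. Existence of an expansion to every order is proved with
  polynomials of unspecified coefficients, and the first two coefficients are computed separately,
  in place of a reversion formula for series.\<close>

definition bessel_coeff :: "real \<Rightarrow> nat \<Rightarrow> nat \<Rightarrow> real" where
  "bessel_coeff \<nu> N k =
     (-1) ^ k * rGamma (\<nu> + real k + 1) / (fact k * 4 ^ k) * (\<Prod>j<N. \<nu> - real j + 2 * real k) / 2 powr \<nu>"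

text \<open>The variable y stands for x^2. Splitting off \<open>x powr (\<nu> - real N)\<close>
  leaves an entire function, so the positive zeros are those of a power series, and y may also be
  negative. Each differentiation multiplies the k-th coefficient by the exponent then present,
  whence the product in \<open>bessel_coeff\<close>.\<close>

definition bessel_series :: "real \<Rightarrow> nat \<Rightarrow> real \<Rightarrow> real" where
  "bessel_series \<nu> N y = (\<Sum>k. bessel_coeff \<nu> N k * y ^ k)"

lemma bessel_coeff_Suc: "bessel_coeff \<nu> (Suc N) k = (\<nu> - real N + 2 * real k) * bessel_coeff \<nu> N k"
  by (simp add: bessel_coeff_def)

lemma rGamma_nat_shift_bounds:
  fixes \<nu> :: real
  assumes "\<nu> \<ge> 0"
  shows "0 < rGamma (\<nu> + real k + 1)" "rGamma (\<nu> + real k + 1) \<le> rGamma (\<nu> + 1)"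
proof -
  show pos: "0 < rGamma (\<nu> + real k + 1)" for k
    using assms by (simp add: rGamma_inverse_Gamma Gamma_real_pos)
  show "rGamma (\<nu> + real k + 1) \<le> rGamma (\<nu> + 1)"
  proof (induction k)
    case (Suc k)
    have "rGamma (\<nu> + real k + 1) = (\<nu> + real k + 1) * rGamma (\<nu> + real (Suc k) + 1)"
      using rGamma_plus1[of "\<nu> + real k + 1"] by (simp add: algebra_simps)
    also have "\<dots> \<ge> 1 * rGamma (\<nu> + real (Suc k) + 1)"
      using assms pos[of "Suc k"] by (intro mult_right_mono) auto
    finally show ?case using Suc by simp
  qed simp
qed

text \<open>For N = 0 the exponential series dominates, since \<open>rGamma\<close> only decreases
  along the shifts. A step in N inserts a factor linear in k, and the series of k a_k y^k is y times
  the termwise derivative of a series that converges everywhere.\<close>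

lemma summable_bessel_coeff:
  assumes "\<nu> \<ge> 0"
  shows "summable (\<lambda>k. bessel_coeff \<nu> N k * y ^ k)"
proof (induction N arbitrary: y)
  case 0
  show ?case
  proof (rule summable_comparison_test)
    show "\<exists>N. \<forall>k\<ge>N. norm (bessel_coeff \<nu> 0 k * y ^ k) \<le> rGamma (\<nu> + 1) / 2 powr \<nu> * (inverse (fact k) * (\<bar>y\<bar> / 4) ^ k)"
    proof (intro exI allI impI)
      fix k
      have "norm (bessel_coeff \<nu> 0 k * y ^ k) = rGamma (\<nu> + real k + 1) * (inverse (fact k) * (\<bar>y\<bar> / 4) ^ k / 2 powr \<nu>)"
        using rGamma_nat_shift_bounds(1)[OF assms, of k]
        by (simp add: bessel_coeff_def abs_mult power_abs field_simps)
      also have "\<dots> \<le> rGamma (\<nu> + 1) * (inverse (fact k) * (\<bar>y\<bar> / 4) ^ k / 2 powr \<nu>)"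
        by (intro mult_right_mono rGamma_nat_shift_bounds assms) auto
      finally show "norm (bessel_coeff \<nu> 0 k * y ^ k) \<le> rGamma (\<nu> + 1) / 2 powr \<nu> * (inverse (fact k) * (\<bar>y\<bar> / 4) ^ k)"
        by (simp add: field_simps)
    qed
    show "summable (\<lambda>k. rGamma (\<nu> + 1) / 2 powr \<nu> * (inverse (fact k) * (\<bar>y\<bar> / 4) ^ k))"
      by (intro summable_mult summable_exp)
  qed
next
  case (Suc N)
  have "summable (\<lambda>k. diffs (bessel_coeff \<nu> N) k * y ^ k)"
    by (rule termdiff_converges_all) (rule Suc)
  then have "summable (\<lambda>k. y * (diffs (bessel_coeff \<nu> N) k * y ^ k))"
    by (rule summable_mult)
  then have "summable (\<lambda>k. real (Suc k) * bessel_coeff \<nu> N (Suc k) * y ^ Suc k)"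
    by (simp add: diffs_def algebra_simps)
  then have "summable (\<lambda>k. real k * bessel_coeff \<nu> N k * y ^ k)"
    by (subst (asm) summable_Suc_iff[of "\<lambda>k. real k * bessel_coeff \<nu> N k * y ^ k"])
  then have "summable (\<lambda>k. (\<nu> - real N) * (bessel_coeff \<nu> N k * y ^ k) + 2 * (real k * bessel_coeff \<nu> N k * y ^ k))"
    by (intro summable_add summable_mult Suc)
  then show ?case by (simp add: bessel_coeff_Suc algebra_simps)
qed

lemma bessel_series_sums:
  assumes "\<nu> \<ge> 0"
  shows "(\<lambda>k. bessel_coeff \<nu> N k * y ^ k) sums bessel_series \<nu> N y"
  using summable_bessel_coeff[OF assms] by (simp add: bessel_series_def summable_sums)

lemma bessel_series_0: "bessel_series \<nu> N 0 = bessel_coeff \<nu> N 0"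
  by (simp add: bessel_series_def powser_zero)

definition bessel_series' :: "real \<Rightarrow> nat \<Rightarrow> real \<Rightarrow> real" where
  "bessel_series' \<nu> N y = (\<Sum>k. diffs (bessel_coeff \<nu> N) k * y ^ k)"

lemma DERIV_bessel_series:
  assumes "\<nu> \<ge> 0"
  shows "(bessel_series \<nu> N has_real_derivative bessel_series' \<nu> N y) (at y)"
  unfolding bessel_series'_def bessel_series_def
  by (rule termdiffs_strong_converges_everywhere) (rule summable_bessel_coeff[OF assms])

text \<open>Differentiation in x, written in y = x^2 with the power of x removed, is the Euler
  operator (\<nu> - N) + 2 y d/dy. The same operator later acts on polynomials.\<close>

lemma bessel_series_Suc:
  assumes "\<nu> \<ge> 0"
  shows "bessel_series \<nu> (Suc N) y = (\<nu> - real N) * bessel_series \<nu> N y + 2 * y * bessel_series' \<nu> N y"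
proof -
  have "(\<lambda>k. diffs (bessel_coeff \<nu> N) k * y ^ k) sums bessel_series' \<nu> N y"
    unfolding bessel_series'_def
    by (intro summable_sums termdiff_converges_all summable_bessel_coeff assms)
  then have "(\<lambda>k. y * (diffs (bessel_coeff \<nu> N) k * y ^ k)) sums (y * bessel_series' \<nu> N y)"
    by (rule sums_mult)
  then have "(\<lambda>k. real (Suc k) * bessel_coeff \<nu> N (Suc k) * y ^ Suc k) sums (y * bessel_series' \<nu> N y)"
    by (simp add: diffs_def algebra_simps)
  then have "(\<lambda>k. real k * bessel_coeff \<nu> N k * y ^ k) sums (y * bessel_series' \<nu> N y)"
    by (subst (asm) sums_Suc_iff) simp
  then have "(\<lambda>k. (\<nu> - real N) * (bessel_coeff \<nu> N k * y ^ k) + 2 * (real k * bessel_coeff \<nu> N k * y ^ k))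
     sums ((\<nu> - real N) * bessel_series \<nu> N y + 2 * (y * bessel_series' \<nu> N y))"
    by (intro sums_add sums_mult bessel_series_sums assms)
  then have "(\<lambda>k. bessel_coeff \<nu> (Suc N) k * y ^ k) sums ((\<nu> - real N) * bessel_series \<nu> N y + 2 * (y * bessel_series' \<nu> N y))"
    by (simp add: bessel_coeff_Suc algebra_simps)
  then show ?thesis
    using bessel_series_sums[OF assms] sums_unique2 by fastforce
qed

lemma DERIV_powr_bessel_series:
  assumes "\<nu> \<ge> 0" "x > 0"
  shows "((\<lambda>x. x powr (\<nu> - real N) * bessel_series \<nu> N (x\<^sup>2)) has_real_derivative
           x powr (\<nu> - real (Suc N)) * bessel_series \<nu> (Suc N) (x\<^sup>2)) (at x)"
proof -
  have 1: "((\<lambda>x. bessel_series \<nu> N (x\<^sup>2)) has_real_derivative bessel_series' \<nu> N (x\<^sup>2) * (2 * x)) (at x)"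
    by (rule DERIV_chain2[OF DERIV_bessel_series[OF assms(1)]]) (auto intro!: derivative_eq_intros)
  have 2: "x powr (\<nu> - real N) = x powr (\<nu> - real (Suc N)) * x"
    using assms by (simp add: powr_diff field_simps powr_add)
  have 3: "x powr (\<nu> - real N - 1) = x powr (\<nu> - real (Suc N))"
    by (simp add: algebra_simps)
  show ?thesis
    by (rule DERIV_cong[OF DERIV_mult[OF has_real_derivative_powr 1]])
       (use assms in \<open>simp_all add: bessel_series_Suc 2 3 algebra_simps power2_eq_square\<close>)
qed

lemma bessel_J_eq:
  assumes "\<nu> \<ge> 0" "x > 0"
  shows "bessel_J \<nu> x = x powr \<nu> * bessel_series \<nu> 0 (x\<^sup>2)"
proof -
  have "(\<lambda>k. 2 powr \<nu> * (bessel_coeff \<nu> 0 k * (x\<^sup>2) ^ k)) sums (2 powr \<nu> * bessel_series \<nu> 0 (x\<^sup>2))"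
    by (intro sums_mult bessel_series_sums assms)
  also have "(\<lambda>k. 2 powr \<nu> * (bessel_coeff \<nu> 0 k * (x\<^sup>2) ^ k)) =
      (\<lambda>n. (-1) ^ n * rGamma (\<nu> + real n + 1) / fact n * (x / 2) ^ (2 * n))"
    by (auto simp: bessel_coeff_def power_divide power_mult[of _ 2] divide_simps)
  finally show ?thesis
    using assms by (simp add: bessel_J_def sums_iff powr_divide)
qed

lemma bessel_J_deriv_eq:
  assumes "\<nu> \<ge> 0" "x > 0"
  shows "bessel_J_deriv \<nu> N x = x powr (\<nu> - real N) * bessel_series \<nu> N (x\<^sup>2)"
  using assms(2)
proof (induction N arbitrary: x)
  case 0
  then show ?case using assms by (simp add: bessel_J_deriv_def bessel_J_eq)
next
  case (Suc N)
  have "deriv (bessel_J_deriv \<nu> N) x = deriv (\<lambda>x. x powr (\<nu> - real N) * bessel_series \<nu> N (x\<^sup>2)) x"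
    using Suc by (intro deriv_cong_ev) (auto intro!: eventually_nhds_in_open[of "{0<..}", THEN eventually_mono])
  also have "\<dots> = x powr (\<nu> - real (Suc N)) * bessel_series \<nu> (Suc N) (x\<^sup>2)"
    by (intro DERIV_imp_deriv DERIV_powr_bessel_series assms Suc)
  finally show ?case by (simp add: bessel_J_deriv_def)
qed

lemma DERIV_bessel_J_deriv:
  assumes "\<nu> \<ge> 0" "x > 0"
  shows "(bessel_J_deriv \<nu> N has_real_derivative bessel_J_deriv \<nu> (Suc N) x) (at x)"
proof -
  have "((\<lambda>x. x powr (\<nu> - real N) * bessel_series \<nu> N (x\<^sup>2)) has_real_derivative bessel_J_deriv \<nu> (Suc N) x) (at x)"
    using DERIV_powr_bessel_series[OF assms] bessel_J_deriv_eq[OF assms] by simp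
  then show ?thesis
  proof (rule has_field_derivative_transform_within_open[of _ _ _ "{0<..}"])
    show "\<And>y. y \<in> {0<..} \<Longrightarrow> y powr (\<nu> - real N) * bessel_series \<nu> N (y\<^sup>2) = bessel_J_deriv \<nu> N y"
      using bessel_J_deriv_eq[OF assms(1)] by simp
  qed (use assms in auto)
qed

lemma bessel_J_deriv_0: "bessel_J_deriv \<nu> 0 = bessel_J \<nu>"
  by (simp add: bessel_J_deriv_def)

text \<open>Series form of (x^(-\<nu>) J_\<nu>)' = - x^(-\<nu>) J_(\<nu>+1).\<close>

lemma bessel_series'_0_eq:
  assumes "\<nu> \<ge> 0"
  shows "2 * bessel_series' \<nu> 0 y = - bessel_series (\<nu> + 1) 0 y"
proof -
  have "2 * diffs (bessel_coeff \<nu> 0) k = - bessel_coeff (\<nu> + 1) 0 k" for k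
    by (simp add: diffs_def bessel_coeff_def powr_add divide_simps)
  then have "2 * (diffs (bessel_coeff \<nu> 0) k * y ^ k) = - (bessel_coeff (\<nu> + 1) 0 k * y ^ k)" for k
    by (metis mult.assoc mult_minus_left)
  moreover have "(\<lambda>k. 2 * (diffs (bessel_coeff \<nu> 0) k * y ^ k)) sums (2 * bessel_series' \<nu> 0 y)"
    unfolding bessel_series'_def
    by (intro sums_mult summable_sums termdiff_converges_all summable_bessel_coeff assms)
  moreover have "(\<lambda>k. - (bessel_coeff (\<nu> + 1) 0 k * y ^ k)) sums (- bessel_series (\<nu> + 1) 0 y)"
    using assms by (intro sums_minus bessel_series_sums) auto
  ultimately show ?thesis using sums_unique2 by simp
qed

text \<open>Series form of (x^(\<nu>+1) J_(\<nu>+1))' = x^(\<nu>+1) J_\<nu>; the factor \<nu> + k +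
  1 is absorbed by the Gamma recurrence.\<close>

lemma bessel_series_down:
  assumes "\<nu> \<ge> 0"
  shows "bessel_series (\<nu> + 1) 1 y + (\<nu> + 1) * bessel_series (\<nu> + 1) 0 y = bessel_series \<nu> 0 y"
proof -
  have "bessel_coeff (\<nu> + 1) 1 k + (\<nu> + 1) * bessel_coeff (\<nu> + 1) 0 k = bessel_coeff \<nu> 0 k" for k
  proof -
    have "rGamma (\<nu> + real k + 1) = (\<nu> + real k + 1) * rGamma (\<nu> + 1 + real k + 1)"
      using rGamma_plus1[of "\<nu> + real k + 1"] by (simp add: algebra_simps)
    then show ?thesis
      by (simp add: bessel_coeff_def powr_add field_simps)
  qed
  then have eq: "bessel_coeff (\<nu> + 1) 1 k * y ^ k + (\<nu> + 1) * (bessel_coeff (\<nu> + 1) 0 k * y ^ k) = bessel_coeff \<nu> 0 k * y ^ k" for k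
    by (metis distrib_right mult.assoc)
  have "(\<lambda>k. bessel_coeff (\<nu> + 1) 1 k * y ^ k + (\<nu> + 1) * (bessel_coeff (\<nu> + 1) 0 k * y ^ k))
     sums (bessel_series (\<nu> + 1) 1 y + (\<nu> + 1) * bessel_series (\<nu> + 1) 0 y)"
    using assms by (intro sums_add sums_mult bessel_series_sums) auto
  then show ?thesis
    unfolding eq using bessel_series_sums[OF assms] sums_unique2 by blast
qed

lemma bessel_J_deriv_1:
  assumes "\<nu> \<ge> 0" "x > 0"
  shows "bessel_J_deriv \<nu> 1 x = \<nu> / x * bessel_J \<nu> x - bessel_J (\<nu> + 1) x"
    and "bessel_J_deriv (\<nu> + 1) 1 x = bessel_J \<nu> x - (\<nu> + 1) / x * bessel_J (\<nu> + 1) x"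
proof -
  have p: "x powr \<nu> = x powr (\<nu> - 1) * x" "x powr (\<nu> + 1) = x powr (\<nu> - 1) * x * x"
    "x powr (1 + \<nu>) = x powr (\<nu> - 1) * x * x"
    using assms by (simp_all add: powr_diff field_simps powr_add)
  have "bessel_J_deriv \<nu> 1 x = x powr (\<nu> - 1) * (\<nu> * bessel_series \<nu> 0 (x\<^sup>2) - x\<^sup>2 * bessel_series (\<nu> + 1) 0 (x\<^sup>2))"
  proof -
    have "bessel_series \<nu> 1 (x\<^sup>2) = \<nu> * bessel_series \<nu> 0 (x\<^sup>2) + x\<^sup>2 * (2 * bessel_series' \<nu> 0 (x\<^sup>2))"
      using bessel_series_Suc[OF assms(1), of 0 "x\<^sup>2"] by simp
    then show ?thesis
      using bessel_J_deriv_eq[OF assms, of 1] bessel_series'_0_eq[OF assms(1), of "x\<^sup>2"] by simp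
  qed
  then show "bessel_J_deriv \<nu> 1 x = \<nu> / x * bessel_J \<nu> x - bessel_J (\<nu> + 1) x"
    using assms by (simp add: bessel_J_eq p power2_eq_square algebra_simps)
  have "bessel_J_deriv (\<nu> + 1) 1 x = x powr \<nu> * bessel_series (\<nu> + 1) 1 (x\<^sup>2)"
    using bessel_J_deriv_eq[of "\<nu> + 1" x 1] assms by simp
  also have "bessel_series (\<nu> + 1) 1 (x\<^sup>2) = bessel_series \<nu> 0 (x\<^sup>2) - (\<nu> + 1) * bessel_series (\<nu> + 1) 0 (x\<^sup>2)"
    using bessel_series_down[OF assms(1), of "x\<^sup>2"] by simp
  finally show "bessel_J_deriv (\<nu> + 1) 1 x = bessel_J \<nu> x - (\<nu> + 1) / x * bessel_J (\<nu> + 1) x"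
    using assms by (simp add: bessel_J_eq p power2_eq_square divide_simps) (simp add: algebra_simps)
qed

lemma DERIV_bessel_J:
  assumes "\<nu> \<ge> 0" "x > 0"
  shows "(bessel_J \<nu> has_real_derivative (\<nu> / x * bessel_J \<nu> x - bessel_J (\<nu> + 1) x)) (at x)"
    and "(bessel_J (\<nu> + 1) has_real_derivative (bessel_J \<nu> x - (\<nu> + 1) / x * bessel_J (\<nu> + 1) x)) (at x)"
  using DERIV_bessel_J_deriv[OF assms, of 0] DERIV_bessel_J_deriv[of "\<nu> + 1" x 0] bessel_J_deriv_1[OF assms] assms
  by (auto simp: bessel_J_deriv_0)

text \<open>Bessel's equation results from the two first-order recurrences by eliminating
  J_(\<nu>+1).\<close>

lemma bessel_ODE:
  assumes "\<nu> \<ge> 0" "x > 0"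
  shows "(bessel_J_deriv \<nu> 1 has_real_derivative
           (- bessel_J_deriv \<nu> 1 x / x - (1 - \<nu>\<^sup>2 / x\<^sup>2) * bessel_J \<nu> x)) (at x)"
proof -
  have "((\<lambda>x. \<nu> / x * bessel_J \<nu> x - bessel_J (\<nu> + 1) x) has_real_derivative
      (- bessel_J_deriv \<nu> 1 x / x - (1 - \<nu>\<^sup>2 / x\<^sup>2) * bessel_J \<nu> x)) (at x)"
  proof (rule DERIV_cong[OF DERIV_diff[OF DERIV_mult[OF _ DERIV_bessel_J(1)[OF assms]] DERIV_bessel_J(2)[OF assms]]])
    show "((\<lambda>x. \<nu> / x) has_real_derivative - \<nu> / x\<^sup>2) (at x)"
      using assms by (auto intro!: derivative_eq_intros simp: power2_eq_square)
  qed (use assms in \<open>simp add: bessel_J_deriv_1(1)[OF assms, simplified] power2_eq_square divide_simps, simp add: algebra_simps\<close>)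
  then show ?thesis
  proof (rule has_field_derivative_transform_within_open[of _ _ _ "{0<..}"])
    show "\<And>y. y \<in> {0<..} \<Longrightarrow> \<nu> / y * bessel_J \<nu> y - bessel_J (\<nu> + 1) y = bessel_J_deriv \<nu> 1 y"
      using bessel_J_deriv_1[OF assms(1)] by simp
  qed (use assms in auto)
qed

section \<open>Laguerre inequality for the derivatives\<close>

text \<open>Sending b to the largest point of T not above it is strictly increasing on S, hence
  injective. Separation is asked with \<open>c \<le> b\<close> rather than \<open>c < b\<close>, so
  that Sturm comparison, which may yield b itself, is covered as well.\<close>

lemma card_le_of_separated:
  fixes S T :: "real set"
  assumes "finite T"
    and sep: "\<And>a b. a \<in> S \<Longrightarrow> b \<in> S \<Longrightarrow> a < b \<Longrightarrow> \<exists>c\<in>T. a < c \<and> c \<le> b"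
    and below: "\<And>b. b \<in> S \<Longrightarrow> \<exists>c\<in>T. c \<le> b"
  shows "finite S \<and> card S \<le> card T"
proof -
  define g where "g b = Max {c \<in> T. c \<le> b}" for b
  have "g b \<in> {c \<in> T. c \<le> b}" if "b \<in> S" for b
    unfolding g_def by (rule Max_in) (use below[OF that] assms(1) in auto)
  then have g: "g b \<in> T" "g b \<le> b" if "b \<in> S" for b
    using that by auto
  have lt: "g a < g b" if "a \<in> S" "b \<in> S" "a < b" for a b
  proof -
    from sep[OF that] obtain c where c: "c \<in> T" "a < c" "c \<le> b" by auto
    then have "c \<le> g b" unfolding g_def using assms(1) by (intro Max_ge) auto
    then show ?thesis using g(2)[OF that(1)] c by linarith
  qed
  have inj: "inj_on g S"
    by (rule inj_onI) (metis lt less_irrefl linorder_neqE)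
  have "g ` S \<subseteq> T" using g by auto
  then show ?thesis
    using inj assms(1) by (meson card_inj_on_le inj_on_finite)
qed

text \<open>Without a point of T below the least element of S one point is lost: that element is
  removed. S is not known to be finite, so the bound is shown for its finite subsets, which yields
  finiteness too.\<close>

lemma card_le_Suc_of_separated:
  fixes S T :: "real set"
  assumes "finite T"
    and sep: "\<And>a b. a \<in> S \<Longrightarrow> b \<in> S \<Longrightarrow> a < b \<Longrightarrow> \<exists>c\<in>T. a < c \<and> c \<le> b"
  shows "finite S \<and> card S \<le> card T + 1"
proof (rule finite_if_finite_subsets_card_bdd)
  fix G assume G: "G \<subseteq> S" "finite G"
  show "card G \<le> card T + 1"
  proof (cases "G = {}")
    case False
    let ?G = "G - {Min G}"
    have min: "Min G \<in> G" "\<And>b. b \<in> ?G \<Longrightarrow> Min G < b"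
      using G False by (auto simp: order.not_eq_order_implies_strict)
    have "card ?G \<le> card T"
      using card_le_of_separated[OF assms(1), of ?G] G min sep
      by (metis Diff_subset in_mono subset_trans)
    then show ?thesis using G min by (simp add: card_Diff_singleton_if)
  qed simp
qed

text \<open>The count is of distinct roots, so equality with the degree says that every root is
  real, positive and simple. This is the form in which Rolle arguments deliver the property.\<close>

definition pos_rooted :: "real poly \<Rightarrow> bool" where
  "pos_rooted p \<longleftrightarrow> p \<noteq> 0 \<and> card {y. 0 < y \<and> poly p y = 0} = degree p"

lemma finite_pos_roots: "p \<noteq> 0 \<Longrightarrow> finite {y. 0 < y \<and> poly p y = 0}" for p :: "real poly"
  by (rule finite_subset[OF _ poly_roots_finite[of p]]) auto

lemma card_pos_roots_le: "p \<noteq> 0 \<Longrightarrow> card {y. 0 < y \<and> poly p y = 0} \<le> degree p" for p :: "real poly"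
  by (rule order.trans[OF card_mono card_poly_roots_bound]) (auto simp: poly_roots_finite)

lemma pos_rooted_smult: "pos_rooted p \<Longrightarrow> c \<noteq> 0 \<Longrightarrow> pos_rooted (smult c p)"
  by (simp add: pos_rooted_def)

lemma pos_rooted_scale:
  assumes "pos_rooted p" "c > 0"
  shows "pos_rooted (p \<circ>\<^sub>p [:0, c:])"
proof -
  have "bij_betw (\<lambda>y. y / c) {y. 0 < y \<and> poly p y = 0} {y. 0 < y \<and> poly (p \<circ>\<^sub>p [:0, c:]) y = 0}"
    by (rule bij_betwI[where g = "\<lambda>y. c * y"]) (use assms in \<open>auto simp: poly_pcompose mult.commute\<close>)
  then show ?thesis
    using assms by (auto simp: pos_rooted_def bij_betw_same_card[symmetric] degree_pcompose pcompose_eq_0_iff)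
qed

section \<open>Rolle's theorem on bounded and unbounded intervals\<close>

lemma Rolle_zeros:
  fixes g g' :: "real \<Rightarrow> real"
  assumes "p < q" and cont: "continuous_on {p..q} g" and "g p = 0" "g q = 0"
    and d: "\<And>x. p < x \<Longrightarrow> x < q \<Longrightarrow> (g has_real_derivative g' x) (at x)"
  shows "\<exists>z>p. z < q \<and> g' z = 0"
proof -
  have "\<exists>z>p. z < q \<and> (*) (g' z) = (\<lambda>v. 0)"
    by (rule Rolle_deriv[of _ _ g]) (use assms in \<open>auto simp: has_field_derivative_def\<close>)
  then show ?thesis by (metis mult_cancel_left1 mult_zero_right zero_neq_one)
qed

text \<open>Rolle with the second zero at infinity. Squaring removes the sign of g: far out g^2
  drops below its value at a + 1, so it takes some value twice and 2 g g' vanishes in between. If g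
  is the vanishing factor there, ordinary Rolle applies between a and that point.\<close>

lemma rolle_to_infinity:
  fixes g g' :: "real \<Rightarrow> real"
  assumes cont: "continuous_on {a..} g" and d: "\<And>x. x > a \<Longrightarrow> (g has_real_derivative g' x) (at x)"
    and "g a = 0" and lim: "(g \<longlongrightarrow> 0) at_top"
  shows "\<exists>c>a. g' c = 0"
proof -
  have rolle: "\<exists>c>a. g' c = 0" if "g c = 0" "c > a" for c
  proof -
    have "\<exists>z>a. z < c \<and> g' z = 0"
      by (rule Rolle_zeros[where g = g]) (use that assms in \<open>auto intro: continuous_on_subset[OF cont]\<close>)
    then show ?thesis by auto
  qed
  show ?thesis
  proof (cases "g (a + 1) = 0")
    case False
    have "((\<lambda>x. (g x)\<^sup>2) \<longlongrightarrow> 0\<^sup>2) at_top" by (intro tendsto_intros lim)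
    then have "\<forall>\<^sub>F x in at_top. (g x)\<^sup>2 < (g (a + 1))\<^sup>2"
      by (rule order_tendstoD(2)) (use False in auto)
    then obtain Y where Y: "Y > a + 1" "(g Y)\<^sup>2 < (g (a + 1))\<^sup>2"
      using eventually_happens'[OF _ eventually_conj[OF _ eventually_gt_at_top[of "a + 1"]]] by auto
    have "\<exists>x\<ge>a. x \<le> a + 1 \<and> (g x)\<^sup>2 = (g Y)\<^sup>2"
      using Y assms(3) by (intro IVT') (auto intro!: continuous_intros continuous_on_subset[OF cont])
    then obtain x where x: "x \<ge> a" "x \<le> a + 1" "(g x)\<^sup>2 = (g Y)\<^sup>2" by auto
    have "\<exists>z>x. z < Y \<and> (*) (2 * g z * g' z) = (\<lambda>v. 0)"
    proof (rule Rolle_deriv)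
      show "continuous_on {x..Y} (\<lambda>x. (g x)\<^sup>2)"
        using x by (intro continuous_intros continuous_on_subset[OF cont]) auto
      fix z assume "x < z"
      then have "((\<lambda>x. (g x)\<^sup>2) has_real_derivative 2 * g z * g' z) (at z)"
        using x by (auto intro!: derivative_eq_intros d)
      then show "((\<lambda>x. (g x)\<^sup>2) has_derivative (*) (2 * g z * g' z)) (at z)"
        by (simp add: has_field_derivative_def)
    qed (use x Y in auto)
    then obtain z where z: "z > x" "2 * g z * g' z = 0"
      by (metis mult_cancel_left1 mult_zero_right zero_neq_one)
    moreover have "z > a" using z x by simp
    ultimately show ?thesis using rolle[of z] by auto
  qed (use rolle[of "a + 1"] in auto)
qed

section \<open>Operators that preserve positive simple roots\<close>

lemma coeff_euler_operator:
  "coeff (smult a p + [:0, 2:] * pderiv p) k = (a + 2 * real k) * coeff p k" for p :: "real poly"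
  by (cases k) (auto simp: coeff_pderiv algebra_simps coeff_pCons)

text \<open>Up to a positive factor, q is the derivative of y^(a/2) p. As a > 0 this function also
  vanishes at 0, so Rolle finds a root of q below the first root of p and one between any two: as
  many as the degree allows.\<close>

lemma pos_rooted_euler_operator:
  assumes p: "pos_rooted p" and a: "a > 0"
  defines "q \<equiv> smult a p + [:0, 2:] * pderiv p"
  shows "pos_rooted q"
proof -
  have coeff: "coeff q k = (a + 2 * real k) * coeff p k" for k
    unfolding q_def by (rule coeff_euler_operator)
  have deg: "degree q \<le> degree p"
    by (rule degree_le) (simp add: coeff coeff_eq_0)
  have "coeff q (degree p) = (a + 2 * real (degree p)) * lead_coeff p"
    by (rule coeff)
  moreover have "p \<noteq> 0" using p by (simp add: pos_rooted_def)
  ultimately have q0: "q \<noteq> 0" using a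
    by (metis add_pos_nonneg coeff_0 leading_coeff_0_iff mult_eq_0_iff mult_nonneg_nonneg of_nat_0_le_iff order_less_irrefl zero_le_numeral)
  define g where "g y = y powr (a / 2) * poly p y" for y
  have d: "(g has_real_derivative y powr (a / 2 - 1) * poly q y / 2) (at y)" if "y > 0" for y
  proof -
    have "y powr (a / 2) = y powr (a / 2 - 1) * y" using that by (simp add: powr_diff)
    then show ?thesis unfolding g_def q_def
      using that by (auto intro!: derivative_eq_intros simp: algebra_simps)
  qed
  have cont: "continuous_on {0..} g"
    unfolding g_def using a by (intro continuous_intros continuous_on_powr') auto
  have rolle: "\<exists>c\<in>{y. 0 < y \<and> poly q y = 0}. x < c \<and> c < y" if "0 \<le> x" "x < y" "g x = 0" "g y = 0" for x y
  proof -
    have "\<exists>z>x. z < y \<and> z powr (a / 2 - 1) * poly q z / 2 = 0"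
      by (rule Rolle_zeros[where g = g]) (use that d in \<open>auto intro: continuous_on_subset[OF cont]\<close>)
    then obtain z where "x < z" "z < y" "z powr (a / 2 - 1) * poly q z / 2 = 0" by auto
    then show ?thesis using that by (intro bexI[of _ z]) auto
  qed
  have "degree p = card {y. 0 < y \<and> poly p y = 0}" using p by (simp add: pos_rooted_def)
  also have "\<dots> \<le> card {y. 0 < y \<and> poly q y = 0}"
  proof (rule conjunct2[OF card_le_of_separated])
    fix x y assume "x \<in> {y. 0 < y \<and> poly p y = 0}" "y \<in> {y. 0 < y \<and> poly p y = 0}" "x < y"
    then show "\<exists>c\<in>{y. 0 < y \<and> poly q y = 0}. x < c \<and> c \<le> y"
      using rolle[of x y] by (auto simp: g_def intro: less_imp_le)
  next
    fix y assume "y \<in> {y. 0 < y \<and> poly p y = 0}"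
    then show "\<exists>c\<in>{y. 0 < y \<and> poly q y = 0}. c \<le> y"
      using rolle[of 0 y] a by (auto simp: g_def intro: less_imp_le)
  qed (use finite_pos_roots q0 in auto)
  finally show ?thesis
    using card_pos_roots_le[OF q0] deg q0 by (simp add: pos_rooted_def)
qed

text \<open>The generalised Laguerre polynomial L_n^(\<alpha>) times n! / Gamma (n + \<alpha> + 1).
  In this normalisation the coefficients already contain the \<open>rGamma\<close> factors of the
  Bessel series.\<close>

definition laguerre_poly :: "real \<Rightarrow> nat \<Rightarrow> real poly" where
  "laguerre_poly \<alpha> n = (\<Sum>k\<le>n. monom ((-1) ^ k * real (n choose k) * rGamma (\<alpha> + real k + 1)) k)"

lemma coeff_laguerre_poly:
  "coeff (laguerre_poly \<alpha> n) k = (-1) ^ k * real (n choose k) * rGamma (\<alpha> + real k + 1)"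
  by (simp add: laguerre_poly_def coeff_sum binomial_eq_0)

text \<open>One step of the Rodrigues formula: y^\<alpha> e^(-y) times this polynomial is the
  derivative of y^(\<alpha>+1) e^(-y) times the one with parameters \<alpha> + 1 and n.\<close>

lemma laguerre_poly_Suc:
  "laguerre_poly \<alpha> (Suc n) = smult (\<alpha> + 1) (laguerre_poly (\<alpha> + 1) n)
     + [:0, 1:] * (pderiv (laguerre_poly (\<alpha> + 1) n) - laguerre_poly (\<alpha> + 1) n)"
proof (rule poly_eqI)
  fix k
  have r: "rGamma (\<alpha> + real k + 1) = (\<alpha> + real k + 1) * rGamma (\<alpha> + real k + 2)"
    using rGamma_plus1[of "\<alpha> + real k + 1"] by (simp add: algebra_simps)
  show "coeff (laguerre_poly \<alpha> (Suc n)) k = coeff (smult (\<alpha> + 1) (laguerre_poly (\<alpha> + 1) n)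
     + [:0, 1:] * (pderiv (laguerre_poly (\<alpha> + 1) n) - laguerre_poly (\<alpha> + 1) n)) k"
  proof (cases k)
    case 0
    then show ?thesis using r by (simp add: coeff_laguerre_poly add.commute)
  next
    case (Suc j)
    have "\<alpha> + 1 + real k + 1 = \<alpha> + real k + 2" "\<alpha> + 1 + real j + 1 = \<alpha> + real k + 1" by (simp_all add: Suc)
    then show ?thesis
      using r by (simp add: Suc coeff_laguerre_poly coeff_pderiv coeff_pCons algebra_simps del: of_nat_Suc)
                 (simp add: algebra_simps)
  qed
qed

lemma degree_laguerre_poly:
  assumes "\<alpha> \<ge> 0"
  shows "degree (laguerre_poly \<alpha> n) = n" "laguerre_poly \<alpha> n \<noteq> 0"
proof -
  have ne: "coeff (laguerre_poly \<alpha> n) n \<noteq> 0"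
    using rGamma_nat_shift_bounds(1)[OF assms, of n] by (simp add: coeff_laguerre_poly)
  then show "laguerre_poly \<alpha> n \<noteq> 0" by auto
  show "degree (laguerre_poly \<alpha> n) = n"
    by (intro antisym le_degree ne degree_le) (auto simp: coeff_laguerre_poly binomial_eq_0)
qed

lemma poly_times_exp_minus_tendsto_0: "((\<lambda>x. x powr b * exp (- x) * poly p x) \<longlongrightarrow> 0) at_top" for p :: "real poly"
proof (induction p arbitrary: b)
  case (pCons c p)
  have "((\<lambda>x. c * (x powr b * exp (- x)) + x powr (b + 1) * exp (- x) * poly p x) \<longlongrightarrow> c * 0 + 0) at_top"
  proof (intro tendsto_intros pCons)
    show "((\<lambda>x. x powr b * exp (- x)) \<longlongrightarrow> 0) at_top"
      by real_asymp
  qed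
  moreover have "\<forall>\<^sub>F x in at_top. c * (x powr b * exp (- x)) + x powr (b + 1) * exp (- x) * poly p x
      = x powr b * exp (- x) * poly (pCons c p) x"
    using eventually_gt_at_top[of 0] by eventually_elim (simp add: powr_add algebra_simps)
  ultimately show ?case by (simp add: filterlim_cong)
qed simp

text \<open>Induction on n with \<alpha> varying. The function g vanishes at 0, at the n roots of p
  and in the limit at infinity; these n + 2 zeros enclose n + 1 zeros of its derivative, which are
  roots of q.\<close>

lemma pos_rooted_laguerre_poly:
  assumes "\<alpha> \<ge> 0"
  shows "pos_rooted (laguerre_poly \<alpha> n)"
  using assms
proof (induction n arbitrary: \<alpha>)
  case 0
  have "{y. 0 < y \<and> poly (laguerre_poly \<alpha> 0) y = 0} = {}"
    using rGamma_nat_shift_bounds(1)[OF 0, of 0] by (auto simp: laguerre_poly_def monom_0)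
  then show ?case unfolding pos_rooted_def using degree_laguerre_poly[OF 0, of 0] by (simp only: card.empty) auto
next
  case (Suc n)
  define p where "p = laguerre_poly (\<alpha> + 1) n"
  define q where "q = laguerre_poly \<alpha> (Suc n)"
  have p: "pos_rooted p" "degree p = n" using Suc degree_laguerre_poly[of "\<alpha> + 1" n] by (auto simp: p_def)
  have q: "q \<noteq> 0" "degree q = Suc n" using Suc degree_laguerre_poly[of "\<alpha>" "Suc n"] by (auto simp: q_def)
  define g where "g y = y powr (\<alpha> + 1) * exp (- y) * poly p y" for y
  have d: "(g has_real_derivative y powr \<alpha> * exp (- y) * poly q y) (at y)" if "y > 0" for y
  proof -
    have "y powr (\<alpha> + 1) = y powr \<alpha> * y" using that by (simp add: powr_add)
    then show ?thesis unfolding g_def q_def laguerre_poly_Suc p_def[symmetric]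
      using that by (auto intro!: derivative_eq_intros simp: algebra_simps)
  qed
  have cont: "continuous_on {0..} g"
    unfolding g_def using Suc by (intro continuous_intros continuous_on_powr') auto
  have lim: "(g \<longlongrightarrow> 0) at_top"
    unfolding g_def by (rule poly_times_exp_minus_tendsto_0)
  define T where "T = {y. 0 < y \<and> poly q y = 0}"
  have fin: "finite T" using finite_pos_roots q by (simp add: T_def)
  have rolle: "\<exists>c\<in>T. x < c \<and> c < y" if "0 \<le> x" "x < y" "g x = 0" "g y = 0" for x y
  proof -
    have "\<exists>z>x. z < y \<and> z powr \<alpha> * exp (- z) * poly q z = 0"
      by (rule Rolle_zeros[where g = g]) (use that d in \<open>auto intro: continuous_on_subset[OF cont]\<close>)
    then obtain z where "x < z" "z < y" "z powr \<alpha> * exp (- z) * poly q z = 0" by auto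
    then show ?thesis using that by (intro bexI[of _ z]) (auto simp: T_def)
  qed
  have top: "\<exists>c\<in>T. x < c" if "0 \<le> x" "g x = 0" for x
  proof -
    have "\<exists>c>x. c powr \<alpha> * exp (- c) * poly q c = 0"
      by (rule rolle_to_infinity) (use that d lim in \<open>auto intro: continuous_on_subset[OF cont]\<close>)
    then obtain z where "x < z" "z powr \<alpha> * exp (- z) * poly q z = 0" by auto
    then show ?thesis using that by (intro bexI[of _ z]) (auto simp: T_def)
  qed
  define S where "S = insert 0 {y. 0 < y \<and> poly p y = 0}"
  have S: "0 \<le> x \<and> g x = 0" if "x \<in> S" for x using that Suc by (auto simp: S_def g_def)
  have "card S = Suc n"
    using p finite_pos_roots[of p] by (subst S_def) (auto simp: pos_rooted_def)
  \<comment> \<open>Each point of S has a point of T to its right, the last one owing to infinity;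
    negation turns this into the orientation of \<open>card_le_of_separated\<close>.\<close>
  moreover have "card (uminus ` S) \<le> card (uminus ` T)"
  proof (rule conjunct2[OF card_le_of_separated])
    fix a b assume "a \<in> uminus ` S" "b \<in> uminus ` S" "a < b"
    then obtain c where "c \<in> T" "- b < c" "c < - a" using rolle[of "- b" "- a"] S by force
    then show "\<exists>c\<in>uminus ` T. a < c \<and> c \<le> b" by (intro bexI[of _ "- c"]) auto
  next
    fix b assume "b \<in> uminus ` S"
    then obtain c where "c \<in> T" "- b < c" using top[of "- b"] S by force
    then show "\<exists>c\<in>uminus ` T. c \<le> b" by (intro bexI[of _ "- c"]) auto
  qed (use fin in auto)
  ultimately have "Suc n \<le> card T" by (simp add: card_image)
  then show ?case
    using card_pos_roots_le[OF q(1)] q by (simp add: pos_rooted_def T_def q_def)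
qed

text \<open>Divided by p^2, and with p'/p = sum 1/(y - r) over the roots r, the left side is sum (y
  + r)/(y - r)^2. Each term is at least 1/(y + r), and these add up to - p'(-y)/p(-y). The induction
  splits off one root at a time and keeps the factor p^2, so that y may itself be a root. With y =
  x^2 the left side is -1/2 p^2 times the second derivative of log |p(x^2)| in x.\<close>

lemma pos_rooted_laguerre_inequality:
  assumes "pos_rooted p" "y \<ge> 0"
  shows "poly p (- y) \<noteq> 0 \<and>
    2 * y * ((poly (pderiv p) y)\<^sup>2 - poly p y * poly (pderiv (pderiv p)) y) - poly p y * poly (pderiv p) y
    \<ge> - (poly p y)\<^sup>2 * poly (pderiv p) (- y) / poly p (- y)"
  using assms(1)
proof (induction "degree p" arbitrary: p)
  case 0
  then obtain c where "p = [:c:]" by (metis degree_eq_zeroE)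
  then show ?case using 0 by (auto simp: pos_rooted_def)
next
  case (Suc n)
  then have "card {y. 0 < y \<and> poly p y = 0} \<noteq> 0" by (simp add: pos_rooted_def)
  then have "{y. 0 < y \<and> poly p y = 0} \<noteq> {}" by (metis card.empty)
  then obtain r where r: "r > 0" "poly p r = 0" by auto
  then obtain q where q: "p = [:- r, 1:] * q" by (auto simp: poly_eq_0_iff_dvd)
  have q0: "q \<noteq> 0" using Suc q by (auto simp: pos_rooted_def)
  have deg: "degree p = Suc (degree q)" using q0 unfolding q by (subst degree_mult_eq) auto
  have "{y. 0 < y \<and> poly p y = 0} \<subseteq> insert r {y. 0 < y \<and> poly q y = 0}" unfolding q by auto
  then have "card {y. 0 < y \<and> poly p y = 0} \<le> card (insert r {y. 0 < y \<and> poly q y = 0})"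
    using finite_pos_roots[OF q0] by (intro card_mono) auto
  also have "\<dots> \<le> Suc (card {y. 0 < y \<and> poly q y = 0})" using finite_pos_roots[OF q0] by (simp add: card_insert_if)
  finally have "pos_rooted q"
    using Suc(3) deg card_pos_roots_le[OF q0] q0 by (auto simp: pos_rooted_def)
  then have IH: "poly q (- y) \<noteq> 0"
    "2 * y * ((poly (pderiv q) y)\<^sup>2 - poly q y * poly (pderiv (pderiv q)) y) - poly q y * poly (pderiv q) y
    \<ge> - (poly q y)\<^sup>2 * poly (pderiv q) (- y) / poly q (- y)"
    using Suc(1)[of q] Suc(2) deg by auto
  define Q Q1 Q2 R R1 where "Q = poly q y" and "Q1 = poly (pderiv q) y"
    and "Q2 = poly (pderiv (pderiv q)) y" and "R = poly q (- y)" and "R1 = poly (pderiv q) (- y)"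
  have vals: "poly p y = (y - r) * Q" "poly (pderiv p) y = Q + (y - r) * Q1"
    "poly (pderiv (pderiv p)) y = 2 * Q1 + (y - r) * Q2"
    "poly p (- y) = - (y + r) * R" "poly (pderiv p) (- y) = R - (y + r) * R1"
    unfolding q pderiv_mult pderiv_add by (simp_all add: pderiv_mult pderiv_add pderiv_pCons Q_def Q1_def Q2_def R_def R1_def algebra_simps)
  have yr: "y + r > 0" using r assms by simp
  have R: "R \<noteq> 0" using IH by (simp add: R_def)
  have "- ((y - r) * Q)\<^sup>2 * (R - (y + r) * R1) / (- (y + r) * R)
      = (y - r)\<^sup>2 * Q\<^sup>2 / (y + r) + (y - r)\<^sup>2 * (- Q\<^sup>2 * R1 / R)"
    using R yr by (simp add: divide_simps) (simp add: algebra_simps power2_eq_square)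
  also have "\<dots> \<le> (y + r) * Q\<^sup>2 + (y - r)\<^sup>2 * (2 * y * (Q1\<^sup>2 - Q * Q2) - Q * Q1)"
  proof (intro add_mono mult_left_mono)
    have "(y - r)\<^sup>2 \<le> (y + r)\<^sup>2" using r assms by (simp add: power2_eq_square algebra_simps)
    then have "(y - r)\<^sup>2 * Q\<^sup>2 \<le> (y + r)\<^sup>2 * Q\<^sup>2" by (intro mult_right_mono) auto
    then show "(y - r)\<^sup>2 * Q\<^sup>2 / (y + r) \<le> (y + r) * Q\<^sup>2"
      using yr by (simp add: divide_simps power2_eq_square algebra_simps)
  qed (use IH in \<open>auto simp: Q_def Q1_def Q2_def R_def R1_def\<close>)
  also have "\<dots> = 2 * y * ((Q + (y - r) * Q1)\<^sup>2 - (y - r) * Q * (2 * Q1 + (y - r) * Q2)) - (y - r) * Q * (Q + (y - r) * Q1)"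
    by (simp add: power2_eq_square algebra_simps)
  finally show ?case unfolding vals using R yr by simp
qed

section \<open>The Bessel series as limits of rescaled Laguerre polynomials\<close>

primrec bessel_poly :: "real \<Rightarrow> nat \<Rightarrow> nat \<Rightarrow> real poly" where
  "bessel_poly \<nu> 0 n = smult (1 / 2 powr \<nu>) (laguerre_poly \<nu> n \<circ>\<^sub>p [:0, 1 / (4 * real n):])"
| "bessel_poly \<nu> (Suc N) n = smult (\<nu> - real N) (bessel_poly \<nu> N n) + [:0, 2:] * pderiv (bessel_poly \<nu> N n)"

text \<open>The scaling y / (4 n) is that of the Mehler-Heine limit: coefficientwise the polynomial
  is the Bessel series damped by n (n - 1) ... (n - k + 1) / n^k. The Euler operator respects the
  damping because it acts diagonally on coefficients.\<close>

lemma coeff_bessel_poly: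
  "coeff (bessel_poly \<nu> N n) k = bessel_coeff \<nu> N k * (real (n choose k) * fact k / real n ^ k)"
proof (induction N arbitrary: k)
  case 0
  show ?case by (simp add: coeff_laguerre_poly bessel_coeff_def coeff_pcompose_linear field_simps)
next
  case (Suc N)
  show ?case by (simp only: bessel_poly.simps coeff_euler_operator Suc.IH bessel_coeff_Suc mult.assoc)
qed

text \<open>Passing from N to N + 1 applies the Euler operator with a = \<nu> - N, which must be
  positive; this is the source of the bound N \<le> \<nu>.\<close>

lemma pos_rooted_bessel_poly:
  assumes "real N \<le> \<nu>" "n > 0"
  shows "pos_rooted (bessel_poly \<nu> N n)"
  using assms(1)
proof (induction N)
  case 0
  then show ?case using assms by (simp add: pos_rooted_smult pos_rooted_scale pos_rooted_laguerre_poly)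
next
  case (Suc N)
  then show ?case by (simp add: pos_rooted_euler_operator del: mult_pCons_left)
qed

text \<open>Tannery's theorem: the damping factors lie between 0 and 1 and tend to 1 for each fixed
  k, so the absolutely convergent Bessel series dominates.\<close>

lemma bessel_poly_tendsto:
  assumes "\<nu> \<ge> 0"
  shows "(\<lambda>n. poly (bessel_poly \<nu> N n) y) \<longlonglongrightarrow> bessel_series \<nu> N y"
proof -
  define t where "t k n = real (n choose k) * fact k / real n ^ k" for k n :: nat
  have t: "t k n \<le> 1" "t k n \<ge> 0" for k n
  proof -
    have "(n choose k) * fact k \<le> n ^ k" using binomial_fact_pow by blast
    then have "real ((n choose k) * fact k) \<le> real (n ^ k)" by (simp only: of_nat_le_iff)
    then show "t k n \<le> 1" by (simp add: t_def divide_simps)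
  qed (simp add: t_def)
  have t_lim: "t k \<longlonglongrightarrow> 1" for k
  proof (induction k)
    case (Suc k)
    have step: "t (Suc k) n = t k n * (1 - real k / real n)" if "n > k" for n
    proof -
      have "Suc k * (n choose Suc k) = (n - k) * (n choose k)"
        using binomial_absorb_comp[of n k] binomial_absorption[of k n] by simp
      then have "real (Suc k) * real (n choose Suc k) = (real n - real k) * real (n choose k)"
        using that by (metis of_nat_mult of_nat_diff less_imp_le)
      then have "real (n choose Suc k) * fact (Suc k) = (real n - real k) * (real (n choose k) * fact k)"
        by (metis fact_Suc mult.assoc mult.left_commute of_nat_fact of_nat_mult)
      then show ?thesis using that by (simp add: t_def field_simps)
    qed
    have ev: "\<forall>\<^sub>F n in sequentially. t k n * (1 - real k / real n) = t (Suc k) n"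
      by (rule eventually_mono[OF eventually_gt_at_top[of k]]) (simp add: step)
    have "(\<lambda>n. t k n * (1 - real k / real n)) \<longlonglongrightarrow> 1 * (1 - 0)"
      by (intro tendsto_intros Suc lim_const_over_n)
    then show ?case using Lim_transform_eventually[OF _ ev] by simp
  qed (auto simp: t_def intro!: tendsto_eventually eventually_sequentiallyI[of 1])
  have "(\<lambda>n. \<Sum>k. bessel_coeff \<nu> N k * y ^ k * t k n) \<longlonglongrightarrow> (\<Sum>k. bessel_coeff \<nu> N k * y ^ k)"
  proof (rule conjunct2[OF conjunct2[OF tannerys_theorem]])
    show "((\<lambda>n. bessel_coeff \<nu> N k * y ^ k * t k n) \<longlonglongrightarrow> bessel_coeff \<nu> N k * y ^ k)" for k
      by (auto intro!: tendsto_eq_intros t_lim)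
    have "norm (bessel_coeff \<nu> N k * y ^ k * t k n) \<le> norm (bessel_coeff \<nu> N k * y ^ k)" for k n
      using mult_left_mono[OF t(1)[of k n], of "\<bar>bessel_coeff \<nu> N k * y ^ k\<bar>"] t(2)[of k n] by (simp add: abs_mult)
    then show "\<forall>\<^sub>F (k, n) in at_top \<times>\<^sub>F sequentially. norm (bessel_coeff \<nu> N k * y ^ k * t k n) \<le> norm (bessel_coeff \<nu> N k * y ^ k)"
      by (simp add: case_prod_unfold)
    have "summable (\<lambda>k. norm (bessel_coeff \<nu> N k * norm y ^ k))"
      by (rule powser_insidea[of _ "norm y + 1"]) (auto intro: summable_bessel_coeff assms)
    then show "summable (\<lambda>k. norm (bessel_coeff \<nu> N k * y ^ k))"
      by (simp add: abs_mult power_abs)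
  qed auto
  moreover have "(\<Sum>k. bessel_coeff \<nu> N k * y ^ k * t k n) = poly (bessel_poly \<nu> N n) y" for n
  proof -
    have "poly (bessel_poly \<nu> N n) y = (\<Sum>k. coeff (bessel_poly \<nu> N n) k * y ^ k)"
      unfolding poly_altdef by (rule suminf_finite[symmetric]) (auto simp: coeff_eq_0)
    then show ?thesis by (simp add: coeff_bessel_poly t_def mult_ac)
  qed
  ultimately show ?thesis by (simp add: bessel_series_def)
qed

text \<open>At -y, which corresponds to imaginary x, the alternating signs cancel and all terms are
  nonnegative.\<close>

lemma bessel_series_neg_pos:
  assumes "real N \<le> \<nu>" "y > 0"
  shows "bessel_series \<nu> N (- y) > 0" "bessel_series \<nu> (Suc N) (- y) > 0"
proof -
  have nu: "\<nu> \<ge> 0" using assms by linarith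
  have eq: "bessel_coeff \<nu> M k * (- y) ^ k = rGamma (\<nu> + real k + 1) / (fact k * 4 ^ k) * (\<Prod>j<M. \<nu> - real j + 2 * real k) / 2 powr \<nu> * y ^ k" for M k
    by (simp add: bessel_coeff_def power_minus[of y])
  have pr: "(\<Prod>j<N. \<nu> - real j + 2 * real k) > 0" for k
    using assms by (intro prod_pos) auto
  have pr': "(\<Prod>j<Suc N. \<nu> - real j + 2 * real k) \<ge> 0" "(\<Prod>j<Suc N. \<nu> - real j + 2 * real (Suc k)) > 0" for k
    using assms by (auto intro!: prod_nonneg prod_pos simp del: prod.lessThan_Suc)
  have rg: "rGamma (\<nu> + real k + 1) > 0" for k by (rule rGamma_nat_shift_bounds[OF nu])
  have "0 < (\<Sum>k. bessel_coeff \<nu> N k * (- y) ^ k)"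
    by (rule suminf_pos[OF summable_bessel_coeff[OF nu]]) (use pr rg assms in \<open>simp add: eq\<close>)
  then show "bessel_series \<nu> N (- y) > 0" by (simp add: bessel_series_def)
  have "0 < (\<Sum>k. bessel_coeff \<nu> (Suc N) k * (- y) ^ k)"
  \<comment> \<open>If \<nu> = N the constant term carries the factor \<nu> - N = 0, so strict
    positivity is taken from the term k = 1.\<close>
  proof (rule suminf_pos2[OF summable_bessel_coeff[OF nu], of _ _ 1])
    show "0 \<le> bessel_coeff \<nu> (Suc N) k * (- y) ^ k" for k
      unfolding eq using rg[of k] pr'(1)[of k] assms by (intro mult_nonneg_nonneg divide_nonneg_nonneg) auto
    show "0 < bessel_coeff \<nu> (Suc N) 1 * (- y) ^ 1"
      unfolding eq using rg[of 1] pr'(2)[of 0] assms by (intro mult_pos_pos divide_pos_pos) auto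
  qed
  then show "bessel_series \<nu> (Suc N) (- y) > 0" by (simp add: bessel_series_def)
qed

text \<open>Limit of the inequality for the approximating polynomials. The lower bound is an
  explicit quantity, positive wherever the series does not vanish, and so survives the limit as a
  strict inequality; a bare \<open>> 0\<close> would weaken to \<open>\<ge> 0\<close>.\<close>

lemma bessel_series_laguerre_inequality:
  assumes "real N \<le> \<nu>" "y > 0"
  shows "(bessel_series \<nu> (Suc N) y)\<^sup>2 - bessel_series \<nu> N y * bessel_series \<nu> (Suc (Suc N)) y
     \<ge> (bessel_series \<nu> N y)\<^sup>2 * bessel_series \<nu> (Suc N) (- y) / bessel_series \<nu> N (- y)"
proof (rule tendsto_le[OF sequentially_bot])
  have nu: "\<nu> \<ge> 0" using assms by linarith
  note lim = bessel_poly_tendsto[OF nu]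
  let ?P = "\<lambda>N y n. poly (bessel_poly \<nu> N n) y"
  show "(\<lambda>n. (?P (Suc N) y n)\<^sup>2 - ?P N y n * ?P (Suc (Suc N)) y n) \<longlonglongrightarrow>
     (bessel_series \<nu> (Suc N) y)\<^sup>2 - bessel_series \<nu> N y * bessel_series \<nu> (Suc (Suc N)) y"
    by (intro tendsto_intros lim)
  show "(\<lambda>n. (?P N y n)\<^sup>2 * ?P (Suc N) (- y) n / ?P N (- y) n) \<longlonglongrightarrow>
     (bessel_series \<nu> N y)\<^sup>2 * bessel_series \<nu> (Suc N) (- y) / bessel_series \<nu> N (- y)"
    using bessel_series_neg_pos[OF assms] by (intro tendsto_intros lim) auto
  show "\<forall>\<^sub>F n in sequentially. (?P N y n)\<^sup>2 * ?P (Suc N) (- y) n / ?P N (- y) n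
      \<le> (?P (Suc N) y n)\<^sup>2 - ?P N y n * ?P (Suc (Suc N)) y n"
    using eventually_gt_at_top[of 0]
  proof eventually_elim
    case (elim n)
    define p where "p = bessel_poly \<nu> N n"
    define a where "a = \<nu> - real N"
    define P P1 P2 R R1 where "P = poly p y" and "P1 = poly (pderiv p) y"
      and "P2 = poly (pderiv (pderiv p)) y" and "R = poly p (- y)" and "R1 = poly (pderiv p) (- y)"
    have R: "R \<noteq> 0" and ineq: "- P\<^sup>2 * R1 / R \<le> 2 * y * (P1\<^sup>2 - P * P2) - P * P1"
      using pos_rooted_laguerre_inequality[OF pos_rooted_bessel_poly[OF assms(1) elim], of y] assms(2)
      by (auto simp: P_def P1_def P2_def R_def R1_def p_def)
    have S: "?P (Suc N) z n = a * poly p z + 2 * z * poly (pderiv p) z" for z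
      by (simp add: p_def a_def algebra_simps)
    have SS: "?P (Suc (Suc N)) y n = (a - 1) * (a * P + 2 * y * P1) + 2 * y * (a * P1 + 2 * P1 + 2 * y * P2)"
      by (simp add: p_def a_def P_def P1_def P2_def algebra_simps pderiv_add pderiv_smult pderiv_pCons)
    have "P\<^sup>2 * (a * R + 2 * (- y) * R1) / R = a * P\<^sup>2 + 2 * y * (- P\<^sup>2 * R1 / R)"
      using R by (simp add: field_simps)
    also have "\<dots> \<le> a * P\<^sup>2 + 2 * y * (2 * y * (P1\<^sup>2 - P * P2) - P * P1)"
      using ineq assms(2) by (intro add_left_mono mult_left_mono) auto
    also have "\<dots> = (a * P + 2 * y * P1)\<^sup>2 - P * ((a - 1) * (a * P + 2 * y * P1) + 2 * y * (a * P1 + 2 * P1 + 2 * y * P2))"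
      by (simp add: power2_eq_square algebra_simps)
    finally show ?case unfolding S SS by (simp add: P_def P1_def R_def R1_def p_def)
  qed
qed

text \<open>Equivalent to f'/f being strictly decreasing between the zeros of f =
  \<open>bessel_J_deriv \<nu> N\<close>, which is how it is used. The powers of x on both sides
  agree because N + (N + 2) = 2 (N + 1).\<close>

lemma bessel_J_deriv_laguerre_inequality:
  assumes "real N \<le> \<nu>" "x > 0" "bessel_J_deriv \<nu> N x \<noteq> 0"
  shows "(bessel_J_deriv \<nu> (Suc N) x)\<^sup>2 > bessel_J_deriv \<nu> N x * bessel_J_deriv \<nu> (Suc (Suc N)) x"
proof -
  have nu: "\<nu> \<ge> 0" using assms by linarith
  define u where "u = x powr (\<nu> - real (Suc (Suc N)))"
  have u: "u > 0" "x powr (\<nu> - real (Suc N)) = u * x" "x powr (\<nu> - real N) = u * x * x"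
    using assms by (simp_all add: u_def powr_diff powr_add power2_eq_square)
  have ne: "bessel_series \<nu> N (x\<^sup>2) \<noteq> 0"
    using assms nu by (simp add: bessel_J_deriv_eq)
  have "0 < (bessel_series \<nu> N (x\<^sup>2))\<^sup>2 * bessel_series \<nu> (Suc N) (- (x\<^sup>2)) / bessel_series \<nu> N (- (x\<^sup>2))"
    using bessel_series_neg_pos[OF assms(1), of "x\<^sup>2"] assms ne by simp
  also note bessel_series_laguerre_inequality[OF assms(1), of "x\<^sup>2"]
  finally have "0 < (u * x)\<^sup>2 * ((bessel_series \<nu> (Suc N) (x\<^sup>2))\<^sup>2 - bessel_series \<nu> N (x\<^sup>2) * bessel_series \<nu> (Suc (Suc N)) (x\<^sup>2))"
    using u assms by simp
  then show ?thesis
    unfolding bessel_J_deriv_eq[OF nu assms(2)] u u_def[symmetric] by (simp add: power2_eq_square algebra_simps)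
qed

section \<open>Laplace transforms\<close>

text \<open>Integrability is required for all x > 0 at once: half of the exponential decay can then
  be traded for polynomial growth, which makes the class stable under multiplication by s and hence
  under differentiation in x.\<close>

definition laplace_admissible :: "(real \<Rightarrow> complex) \<Rightarrow> bool" where
  "laplace_admissible \<phi> \<longleftrightarrow> \<phi> \<in> borel_measurable borel \<and>
     (\<forall>x>0. set_integrable lborel {0<..} (\<lambda>s. \<phi> s * of_real (exp (- (x * s)))))"

definition laplace :: "(real \<Rightarrow> complex) \<Rightarrow> real \<Rightarrow> complex" where
  "laplace \<phi> x = (LBINT s:{0<..}. \<phi> s * of_real (exp (- (x * s))))"

lemma laplace_admissible_measurable: "laplace_admissible \<phi> \<Longrightarrow> \<phi> \<in> borel_measurable borel"
  by (simp add: laplace_admissible_def)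

lemma laplace_admissible_integrable:
  "laplace_admissible \<phi> \<Longrightarrow> x > 0 \<Longrightarrow> set_integrable lborel {0<..} (\<lambda>s. \<phi> s * of_real (exp (- (x * s))))"
  by (simp add: laplace_admissible_def)

lemma laplace_admissible_bound:
  assumes "laplace_admissible \<psi>" "\<phi> \<in> borel_measurable borel" "\<And>s. s > 0 \<Longrightarrow> norm (\<phi> s) \<le> norm (\<psi> s)"
  shows "laplace_admissible \<phi>"
  unfolding laplace_admissible_def
proof (intro conjI allI impI assms)
  fix x :: real assume "x > 0"
  have [measurable]: "\<phi> \<in> borel_measurable borel" by fact
  show "set_integrable lborel {0<..} (\<lambda>s. \<phi> s * of_real (exp (- (x * s))))"
  proof (rule set_integrable_bound[OF laplace_admissible_integrable[OF assms(1) \<open>x > 0\<close>]])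
    show "set_borel_measurable lborel {0<..} (\<lambda>s. \<phi> s * of_real (exp (- (x * s))))"
      unfolding set_borel_measurable_def by measurable
  qed (use assms(3) in \<open>auto simp: norm_mult intro!: mult_right_mono\<close>)
qed

lemma laplace_admissible_add:
  "laplace_admissible \<phi> \<Longrightarrow> laplace_admissible \<psi> \<Longrightarrow> laplace_admissible (\<lambda>s. \<phi> s + \<psi> s)"
  using set_integral_add(1)[of lborel "{0<..}"] by (auto simp: laplace_admissible_def distrib_right)

lemma laplace_admissible_cmult:
  "laplace_admissible \<phi> \<Longrightarrow> laplace_admissible (\<lambda>s. c * \<phi> s)"
  by (auto simp: laplace_admissible_def mult.assoc)

lemma laplace_admissible_uminus:
  "laplace_admissible \<phi> \<Longrightarrow> laplace_admissible (\<lambda>s. - \<phi> s)"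
  using laplace_admissible_cmult[of \<phi> "-1"] by simp

lemma laplace_admissible_sum:
  "(\<And>i. i \<in> I \<Longrightarrow> laplace_admissible (f i)) \<Longrightarrow> laplace_admissible (\<lambda>s. \<Sum>i\<in>I. f i s)"
proof (induction I rule: infinite_finite_induct)
  case (insert i I)
  then show ?case by (simp add: laplace_admissible_add)
qed (simp_all add: laplace_admissible_def set_integrable_def)

lemma laplace_admissible_mult_ident:
  assumes "laplace_admissible \<phi>"
  shows "laplace_admissible (\<lambda>s. of_real s * \<phi> s)"
  unfolding laplace_admissible_def
proof (intro conjI allI impI)
  have [measurable]: "\<phi> \<in> borel_measurable borel" using assms by (rule laplace_admissible_measurable)
  show "(\<lambda>s. of_real s * \<phi> s) \<in> borel_measurable borel" by measurable
  fix x :: real assume x: "x > 0"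
  show "set_integrable lborel {0<..} (\<lambda>s. of_real s * \<phi> s * of_real (exp (- (x * s))))"
  proof (rule set_integrable_bound)
    show "set_integrable lborel {0<..} (\<lambda>s. of_real (2 / x) * (\<phi> s * of_real (exp (- (x / 2 * s)))))"
      using laplace_admissible_integrable[OF assms, of "x / 2"] x by simp
    show "set_borel_measurable lborel {0<..} (\<lambda>s. of_real s * \<phi> s * of_real (exp (- (x * s))))"
      unfolding set_borel_measurable_def by measurable
    have "norm (of_real s * \<phi> s * of_real (exp (- (x * s)))) \<le> norm (of_real (2 / x) * (\<phi> s * of_real (exp (- (x / 2 * s)))))" if "s > 0" for s
    proof -
      have "x / 2 * s \<le> exp (x / 2 * s)" using exp_ge_add_one_self[of "x / 2 * s"] by linarith
      then have "s \<le> 2 / x * exp (x / 2 * s)" using x by (simp add: field_simps)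
      then have "s * exp (- (x * s)) \<le> 2 / x * exp (x / 2 * s) * exp (- (x * s))" by (intro mult_right_mono) auto
      also have "\<dots> = 2 / x * exp (- (x / 2 * s))" by (simp add: mult_exp_exp)
      finally have "norm (\<phi> s) * (s * exp (- (x * s))) \<le> norm (\<phi> s) * (2 / x * exp (- (x / 2 * s)))"
        by (intro mult_left_mono) auto
      then show ?thesis using that x by (simp add: norm_mult norm_divide mult_ac)
    qed
    then show "AE s in lborel. s \<in> {0<..} \<longrightarrow> norm (of_real s * \<phi> s * of_real (exp (- (x * s)))) \<le> norm (of_real (2 / x) * (\<phi> s * of_real (exp (- (x / 2 * s)))))"
      by auto
  qed
qed

lemma laplace_add:
  "laplace_admissible \<phi> \<Longrightarrow> laplace_admissible \<psi> \<Longrightarrow> x > 0 \<Longrightarrow>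
     laplace (\<lambda>s. \<phi> s + \<psi> s) x = laplace \<phi> x + laplace \<psi> x"
  by (simp add: laplace_def distrib_right set_integral_add laplace_admissible_integrable)

lemma laplace_cmult: "laplace (\<lambda>s. c * \<phi> s) x = c * laplace \<phi> x"
  by (simp add: laplace_def mult.assoc)

lemma laplace_uminus: "laplace (\<lambda>s. - \<phi> s) x = - laplace \<phi> x"
  using laplace_cmult[of "-1"] by simp

lemma laplace_sum:
  assumes "finite I" "\<And>i. i \<in> I \<Longrightarrow> laplace_admissible (f i)" "x > 0"
  shows "laplace (\<lambda>s. \<Sum>i\<in>I. f i s) x = (\<Sum>i\<in>I. laplace (f i) x)"
  using assms
proof (induction I rule: finite_induct)
  case (insert i I)
  then have "laplace (\<lambda>s. f i s + (\<Sum>i\<in>I. f i s)) x = laplace (f i) x + laplace (\<lambda>s. \<Sum>i\<in>I. f i s) x"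
    by (intro laplace_add laplace_admissible_sum) auto
  then show ?case using insert by simp
qed (simp add: laplace_def)

lemma laplace_norm_bound:
  assumes "laplace_admissible \<phi>" "laplace_admissible (\<lambda>s. of_real (\<psi> s))" "x > 0"
    and "\<And>s. s > 0 \<Longrightarrow> norm (\<phi> s) \<le> \<psi> s"
  shows "norm (laplace \<phi> x) \<le> norm (laplace (\<lambda>s. of_real (\<psi> s)) x)"
proof -
  have int: "set_integrable lborel {0<..} (\<lambda>s. \<psi> s * exp (- (x * s)))"
  proof -
    have "integrable lborel (\<lambda>s. indicator {0<..} s *\<^sub>R (complex_of_real (\<psi> s) * of_real (exp (- (x * s)))))"
      using laplace_admissible_integrable[OF assms(2,3)] by (simp only: set_integrable_def)
    then have "integrable lborel (\<lambda>s. Re (indicator {0<..} s *\<^sub>R (complex_of_real (\<psi> s) * of_real (exp (- (x * s))))))"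
      by (rule integrable_Re)
    then show ?thesis by (simp add: set_integrable_def)
  qed
  have "norm (laplace \<phi> x) \<le> (LBINT s:{0<..}. \<psi> s * exp (- (x * s)))"
    unfolding laplace_def set_lebesgue_integral_def
  proof (rule Bochner_Integration.integral_norm_bound_integral)
    show "integrable lborel (\<lambda>s. indicator {0<..} s *\<^sub>R (\<phi> s * of_real (exp (- (x * s)))))"
      using laplace_admissible_integrable[OF assms(1,3)] by (simp add: set_integrable_def)
    show "integrable lborel (\<lambda>s. indicator {0<..} s *\<^sub>R (\<psi> s * exp (- (x * s))))"
      using int by (simp add: set_integrable_def)
  qed (use assms(4) in \<open>auto simp: indicator_def norm_mult intro!: mult_right_mono\<close>)
  also have "\<dots> \<le> norm (laplace (\<lambda>s. of_real (\<psi> s)) x)"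
    unfolding laplace_def by (simp add: set_integral_complex_of_real flip: of_real_mult)
  finally show ?thesis .
qed

lemma exp_quadratic_bound: "\<bar>exp u - 1 - u\<bar> \<le> u\<^sup>2 * exp \<bar>u\<bar>" for u :: real
proof -
  have upper: "exp v - 1 \<le> v * exp v" for v :: real
  proof -
    have "(1 - v) * exp v \<le> exp (- v) * exp v"
      using exp_ge_add_one_self[of "- v"] by (intro mult_right_mono) auto
    then show ?thesis by (simp add: algebra_simps flip: exp_add)
  qed
  have lower: "exp u - 1 \<ge> u" using exp_ge_add_one_self[of u] by linarith
  have "exp u - 1 - u \<le> u * (exp u - 1)" using upper[of u] by (simp add: algebra_simps)
  also have "\<dots> \<le> u\<^sup>2 * exp \<bar>u\<bar>"
  proof (cases "u \<ge> 0")
    case True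
    then have "u * (exp u - 1) \<le> u * (u * exp u)" using upper[of u] by (intro mult_left_mono) auto
    then show ?thesis using True by (simp add: power2_eq_square)
  next
    case False
    then have "(- u) * (1 - exp u) \<le> (- u) * (- u)" using lower by (intro mult_left_mono) auto
    also have "\<dots> \<le> u\<^sup>2 * exp \<bar>u\<bar>" by (simp add: power2_eq_square mult_le_cancel_left1 flip: mult.assoc)
    finally show ?thesis by (simp add: algebra_simps)
  qed
  finally show ?thesis using lower by simp
qed

text \<open>Differentiation under the integral with an explicit remainder. For |y - x| < x/2 the
  factor exp |u| in the second-order remainder of exp costs at most half of the decay exp (-x s), so
  the error is at most (y - x)^2 K, where K is the transform of s^2 |\<phi>| at x/2.\<close>

lemma laplace_has_vector_derivative:
  assumes adm: "laplace_admissible \<phi>" and x: "x > 0"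
  shows "(laplace \<phi> has_vector_derivative laplace (\<lambda>s. - (of_real s * \<phi> s)) x) (at x)"
proof -
  define \<phi>1 where "\<phi>1 = (\<lambda>s. of_real s * \<phi> s)"
  define \<phi>2 where "\<phi>2 = (\<lambda>s. of_real s * \<phi>1 s)"
  have adm1: "laplace_admissible \<phi>1" and adm2: "laplace_admissible \<phi>2"
    unfolding \<phi>1_def \<phi>2_def by (intro laplace_admissible_mult_ident adm)+
  have intK: "set_integrable lborel {0<..} (\<lambda>s. norm (\<phi>2 s * of_real (exp (- (x / 2 * s)))))"
    by (intro set_integrable_norm laplace_admissible_integrable adm2) (use x in auto)
  define K where "K = (LBINT s:{0<..}. norm (\<phi>2 s * of_real (exp (- (x / 2 * s)))))"
  have bound: "norm (laplace \<phi> y - laplace \<phi> x - (y - x) *\<^sub>R laplace (\<lambda>s. - \<phi>1 s) x) \<le> (y - x)\<^sup>2 * K"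
    if y: "\<bar>y - x\<bar> < x / 2" for y
  proof -
    have y0: "y > 0" using y x by (auto simp: abs_if split: if_splits)
    let ?E = "\<lambda>x s. of_real (exp (- (x * s))) :: complex"
    have "(LBINT s:{0<..}. \<phi> s * ?E y s - \<phi> s * ?E x s - of_real (y - x) * ((- \<phi>1 s) * ?E x s))
       = (LBINT s:{0<..}. \<phi> s * ?E y s - \<phi> s * ?E x s) - (LBINT s:{0<..}. of_real (y - x) * ((- \<phi>1 s) * ?E x s))"
      by (intro set_integral_diff(2) set_integral_diff(1) set_integrable_mult_right laplace_admissible_integrable adm x y0 laplace_admissible_uminus adm1)
    also have "(LBINT s:{0<..}. \<phi> s * ?E y s - \<phi> s * ?E x s) = laplace \<phi> y - laplace \<phi> x"
      unfolding laplace_def by (intro set_integral_diff(2) laplace_admissible_integrable adm x y0)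
    also have "(LBINT s:{0<..}. of_real (y - x) * ((- \<phi>1 s) * ?E x s)) = (y - x) *\<^sub>R laplace (\<lambda>s. - \<phi>1 s) x"
      unfolding laplace_def scaleR_conv_of_real by (rule set_integral_mult_right)
    finally have eq: "laplace \<phi> y - laplace \<phi> x - (y - x) *\<^sub>R laplace (\<lambda>s. - \<phi>1 s) x
       = (LBINT s:{0<..}. \<phi> s * ?E y s - \<phi> s * ?E x s - of_real (y - x) * ((- \<phi>1 s) * ?E x s))" by simp
    have "norm (LBINT s:{0<..}. \<phi> s * ?E y s - \<phi> s * ?E x s - of_real (y - x) * ((- \<phi>1 s) * ?E x s))
       \<le> (LBINT s:{0<..}. (y - x)\<^sup>2 * norm (\<phi>2 s * of_real (exp (- (x / 2 * s)))))"
      unfolding set_lebesgue_integral_def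
    proof (rule Bochner_Integration.integral_norm_bound_integral)
      show "integrable lborel (\<lambda>s. indicator {0<..} s *\<^sub>R (\<phi> s * ?E y s - \<phi> s * ?E x s - of_real (y - x) * ((- \<phi>1 s) * ?E x s)))"
        unfolding set_integrable_def[symmetric]
        by (intro set_integral_diff(1) set_integrable_mult_right laplace_admissible_integrable adm x y0 laplace_admissible_uminus adm1)
      show "integrable lborel (\<lambda>s. indicator {0<..} s *\<^sub>R ((y - x)\<^sup>2 * norm (\<phi>2 s * of_real (exp (- (x / 2 * s))))))"
        unfolding set_integrable_def[symmetric] by (intro set_integrable_mult_right intK)
      fix s :: real
      show "norm (indicator {0<..} s *\<^sub>R (\<phi> s * ?E y s - \<phi> s * ?E x s - of_real (y - x) * ((- \<phi>1 s) * ?E x s)))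
          \<le> indicator {0<..} s *\<^sub>R ((y - x)\<^sup>2 * norm (\<phi>2 s * of_real (exp (- (x / 2 * s)))))"
      proof (cases "s > 0")
        case True
        define u where "u = - ((y - x) * s)"
        have "exp (- (y * s)) = exp (- (x * s)) * exp u" by (simp add: u_def mult_exp_exp algebra_simps)
        then have "\<phi> s * ?E y s - \<phi> s * ?E x s - of_real (y - x) * ((- \<phi>1 s) * ?E x s)
           = \<phi> s * of_real (exp (- (x * s)) * (exp u - 1 - u))"
          by (simp add: \<phi>1_def u_def algebra_simps)
        also have "norm \<dots> \<le> norm (\<phi> s) * ((y - x)\<^sup>2 * s\<^sup>2 * exp (- (x / 2 * s)))"
        proof -
          have "exp (- (x * s)) * \<bar>exp u - 1 - u\<bar> \<le> exp (- (x * s)) * (u\<^sup>2 * exp \<bar>u\<bar>)"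
            by (intro mult_left_mono exp_quadratic_bound) auto
          also have "\<dots> = u\<^sup>2 * exp (\<bar>u\<bar> - x * s)" by (simp add: exp_diff exp_minus field_simps)
          also have "\<dots> \<le> u\<^sup>2 * exp (- (x / 2 * s))"
          proof -
            have "\<bar>u\<bar> \<le> x / 2 * s" using y True by (simp add: u_def abs_mult)
            then show ?thesis by (intro mult_left_mono) auto
          qed
          finally have "\<bar>exp (- (x * s)) * (exp u - 1 - u)\<bar> \<le> (y - x)\<^sup>2 * s\<^sup>2 * exp (- (x / 2 * s))"
            by (simp add: abs_mult u_def power_mult_distrib)
          then show ?thesis unfolding norm_mult norm_of_real by (intro mult_left_mono) auto
        qed
        also have "\<dots> = (y - x)\<^sup>2 * norm (\<phi>2 s * of_real (exp (- (x / 2 * s))))"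
          using True by (simp add: \<phi>1_def \<phi>2_def norm_mult power2_eq_square)
        finally show ?thesis using True by (simp only: indicator_simps greaterThan_iff scaleR_one)
      qed simp
    qed
    also have "\<dots> = (y - x)\<^sup>2 * K" unfolding K_def by (rule set_integral_mult_right)
    finally show ?thesis unfolding eq .
  qed
  have "((\<lambda>y. norm (laplace \<phi> y - laplace \<phi> x - (y - x) *\<^sub>R laplace (\<lambda>s. - \<phi>1 s) x) / norm (y - x)) \<longlongrightarrow> 0) (at x)"
  proof (rule tendsto_sandwich[where f = "\<lambda>_. 0"])
    show "\<forall>\<^sub>F y in at x. norm (laplace \<phi> y - laplace \<phi> x - (y - x) *\<^sub>R laplace (\<lambda>s. - \<phi>1 s) x) / norm (y - x) \<le> K * \<bar>y - x\<bar>"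
    proof -
      have "\<forall>\<^sub>F y in at x. dist y x < x / 2"
        using x by (auto simp: eventually_at intro!: exI[of _ "x / 2"])
      then show ?thesis
        using eventually_neq_at_within[of x x]
      proof eventually_elim
        case (elim y)
        then show ?case using bound[of y] by (auto simp: dist_real_def divide_simps power2_eq_square mult_ac)
      qed
    qed
    show "((\<lambda>y. K * \<bar>y - x\<bar>) \<longlongrightarrow> 0) (at x)" by (auto intro!: tendsto_eq_intros)
  qed (auto intro!: always_eventually divide_nonneg_nonneg)
  then show ?thesis
    unfolding has_vector_derivative_def has_derivative_iff_norm \<phi>1_def
    by (intro conjI bounded_linear_scaleR_left)
qed

lemma integrable_Gamma_kernel:
  fixes b x :: real
  assumes b: "b > -1" and x: "x > 0"
  shows "set_integrable lborel {0<..} (\<lambda>s. s powr b * exp (- (x * s)))"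
    and "(LBINT s:{0<..}. s powr b * exp (- (x * s))) = Gamma (b + 1) / x powr (b + 1)"
proof -
  have "integral\<^sup>N lborel (\<lambda>s. ennreal (indicator {0..} s * (s powr (b + 1 - 1) / exp s))) = Gamma (b + 1)"
    by (rule nn_integral_has_integral_lebesgue[OF _ Gamma_integral_real]) (use b in auto)
  then have "integral\<^sup>N lborel (\<lambda>s. ennreal (indicator {0<..} s *\<^sub>R (s powr b * exp (- s)))) = Gamma (b + 1)"
    by (subst nn_integral_cong_AE[where v = "\<lambda>s. ennreal (indicator {0..} s * (s powr (b + 1 - 1) / exp s))"])
       (auto intro!: AE_I[of _ _ "{0}"] simp: indicator_def exp_minus field_simps)
  then have "has_bochner_integral lborel (\<lambda>s. indicator {0<..} s *\<^sub>R (s powr b * exp (- s))) (Gamma (b + 1))"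
    using b by (intro has_bochner_integral_nn_integral) (auto intro!: Gamma_real_nonneg)
  then have int: "integrable lborel (\<lambda>s. indicator {0<..} s *\<^sub>R (s powr b * exp (- s)))"
    and val: "(LINT s|lborel. indicator {0<..} s *\<^sub>R (s powr b * exp (- s))) = Gamma (b + 1)"
    by (auto simp: has_bochner_integral_iff)
  have eq: "indicator {0<..} (0 + x * s) *\<^sub>R ((0 + x * s) powr b * exp (- (0 + x * s)))
     = x powr b * (indicator {0<..} s *\<^sub>R (s powr b * exp (- (x * s))))" for s
    using x by (auto simp: indicator_def powr_mult zero_less_mult_iff)
  have "integrable lborel (\<lambda>s. x powr b * (indicator {0<..} s *\<^sub>R (s powr b * exp (- (x * s)))))"
    using lborel_integrable_real_affine[OF int, of x 0] x unfolding eq by simp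
  then show "set_integrable lborel {0<..} (\<lambda>s. s powr b * exp (- (x * s)))"
    using x by (simp add: set_integrable_def)
  have "Gamma (b + 1) = x * (x powr b * (LINT s|lborel. indicator {0<..} s *\<^sub>R (s powr b * exp (- (x * s)))))"
    using lborel_integral_real_affine[of x "\<lambda>s. indicator {0<..} s *\<^sub>R (s powr b * exp (- s))" 0] x
    unfolding eq val by simp
  then show "(LBINT s:{0<..}. s powr b * exp (- (x * s))) = Gamma (b + 1) / x powr (b + 1)"
    using x by (simp add: set_lebesgue_integral_def powr_add field_simps)
qed

lemma laplace_powr:
  assumes "b > -1"
  shows "laplace_admissible (\<lambda>s. of_real (s powr b))"
    and "x > 0 \<Longrightarrow> laplace (\<lambda>s. of_real (s powr b)) x = of_real (Gamma (b + 1) / x powr (b + 1))"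
proof -
  show "laplace_admissible (\<lambda>s. of_real (s powr b))"
    unfolding laplace_admissible_def
  proof (intro conjI allI impI)
    fix x :: real assume "x > 0"
    then have "integrable lborel (\<lambda>s. indicator {0<..} s *\<^sub>R (s powr b * exp (- (x * s))))"
      using integrable_Gamma_kernel(1)[OF assms] by (simp add: set_integrable_def)
    then have "integrable lborel (\<lambda>s. complex_of_real (indicator {0<..} s *\<^sub>R (s powr b * exp (- (x * s)))))"
      by (rule integrable_of_real)
    then show "set_integrable lborel {0<..} (\<lambda>s. complex_of_real (s powr b) * complex_of_real (exp (- (x * s))))"
      by (simp add: set_integrable_def scaleR_conv_of_real)
  qed measurable
  show "laplace (\<lambda>s. of_real (s powr b)) x = of_real (Gamma (b + 1) / x powr (b + 1))" if "x > 0"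
    unfolding laplace_def integrable_Gamma_kernel(2)[OF assms that, symmetric]
    by (simp add: set_integral_complex_of_real flip: of_real_mult)
qed

section \<open>The Hankel integral\<close>

text \<open>The base has real part 1, so the principal power stays off its branch cut and is smooth
  in s.\<close>

definition hankel_factor :: "real \<Rightarrow> real \<Rightarrow> complex" where
  "hankel_factor a s = (1 + \<i> * of_real s / 2) powr of_real a"

text \<open>Powers of -s in the kernel are derivatives in x of the transform, so
  \<open>hankel_integral \<nu> j\<close> is the j-th derivative of
  \<open>hankel_integral \<nu> 0\<close>.\<close>

definition hankel_kernel :: "real \<Rightarrow> nat \<Rightarrow> real \<Rightarrow> complex" where
  "hankel_kernel \<nu> j s = (- of_real s) ^ j * (of_real (s powr (\<nu> - 1/2)) * hankel_factor (\<nu> - 1/2) s)"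

definition hankel_integral :: "real \<Rightarrow> nat \<Rightarrow> real \<Rightarrow> complex" where
  "hankel_integral \<nu> j x = laplace (hankel_kernel \<nu> j) x"

lemma norm_hankel_factor: "norm (hankel_factor a s) = norm (1 + \<i> * of_real s / 2) powr a"
  by (simp add: hankel_factor_def norm_powr_real_powr')

lemma norm_one_plus_i:
  assumes "s \<ge> 0"
  shows "norm (1 + \<i> * of_real s / 2) \<ge> 1" "norm (1 + \<i> * of_real s / 2) \<le> 1 + s"
proof -
  show "norm (1 + \<i> * of_real s / 2) \<ge> 1"
    using abs_Re_le_cmod[of "1 + \<i> * of_real s / 2"] by simp
  show "norm (1 + \<i> * of_real s / 2) \<le> 1 + s"
    by (rule order.trans[OF norm_triangle_ineq]) (use assms in \<open>simp add: norm_mult norm_divide\<close>)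
qed

lemma norm_hankel_factor_le:
  assumes "s \<ge> 0" "a \<le> real n"
  shows "norm (hankel_factor a s) \<le> (1 + s) ^ n"
proof -
  have "norm (1 + \<i> * of_real s / 2) powr a \<le> norm (1 + \<i> * of_real s / 2) powr real n"
    using norm_one_plus_i(1)[OF assms(1)] assms by (intro powr_mono) auto
  also have "\<dots> = norm (1 + \<i> * of_real s / 2) ^ n"
    using norm_one_plus_i(1)[OF assms(1)] by (intro powr_realpow) linarith
  also have "\<dots> \<le> (1 + s) ^ n" using norm_one_plus_i(2)[OF assms(1)] by (intro power_mono) auto
  finally show ?thesis by (simp add: norm_hankel_factor)
qed

lemma DERIV_hankel_factor:
  "(hankel_factor a has_vector_derivative of_real a * (\<i> / 2) * hankel_factor (a - 1) s) (at s)"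
proof -
  have "((\<lambda>z. (1 + \<i> * z / 2) powr of_real a) has_field_derivative
      (of_real a * (1 + \<i> * of_real s / 2) powr (of_real a - 1)) * (\<i> / 2)) (at (of_real s))"
    by (rule DERIV_chain2[OF has_field_derivative_powr])
       (auto intro!: derivative_eq_intros simp: complex_nonpos_Reals_iff)
  from has_vector_derivative_real_field[OF this] show ?thesis
    by (simp add: hankel_factor_def[abs_def] mult_ac)
qed

lemma continuous_hankel_factor: "continuous_on UNIV (hankel_factor a)"
  using DERIV_hankel_factor
  by (meson continuous_at_imp_continuous_on has_vector_derivative_continuous)

lemma hankel_factor_measurable [measurable]: "hankel_factor a \<in> borel_measurable borel"
  by (rule borel_measurable_continuous_onI[OF continuous_hankel_factor])

lemma hankel_factor_plus_one: "hankel_factor (a + 1) s = (1 + \<i> * of_real s / 2) * hankel_factor a s"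
proof -
  have "(1 + \<i> * complex_of_real s / 2) \<noteq> 0" by (auto simp: complex_eq_iff)
  then show ?thesis by (simp add: hankel_factor_def powr_add)
qed

lemma hankel_kernel_Suc: "hankel_kernel \<nu> (Suc j) = (\<lambda>s. - (of_real s * hankel_kernel \<nu> j s))"
  by (simp add: hankel_kernel_def fun_eq_iff)

lemma one_plus_power_le: "(1 + s) ^ n \<le> 2 ^ n * (1 + s ^ n)" if "s \<ge> 0" for s :: real
proof -
  have "(1 + s) ^ n \<le> (2 * max 1 s) ^ n" using that by (intro power_mono) auto
  also have "\<dots> = 2 ^ n * (max 1 s) ^ n" by (rule power_mult_distrib)
  also have "\<dots> \<le> 2 ^ n * (1 + s ^ n)" using that by (intro mult_left_mono) (auto simp: max_def)
  finally show ?thesis .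
qed

lemma laplace_admissible_hankel_kernel:
  assumes "\<nu> \<ge> 0"
  shows "laplace_admissible (hankel_kernel \<nu> j)"
proof (induction j)
  case 0
  define n where "n = nat \<lceil>\<nu>\<rceil>"
  have n: "\<nu> \<le> real n" unfolding n_def by linarith
  show ?case
  proof (rule laplace_admissible_bound)
    show "laplace_admissible (\<lambda>s. 2 ^ n * (of_real (s powr (\<nu> - 1/2)) + of_real (s powr (\<nu> - 1/2 + real n))))"
      using assms by (intro laplace_admissible_cmult laplace_admissible_add laplace_powr) auto
    show "hankel_kernel \<nu> 0 \<in> borel_measurable borel" unfolding hankel_kernel_def by measurable
    fix s :: real assume s: "s > 0"
    have "norm (hankel_factor (\<nu> - 1/2) s) \<le> 2 ^ n * (1 + s ^ n)"
      using norm_hankel_factor_le[of s "\<nu> - 1/2" n] one_plus_power_le[of s n] n s by linarith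
    then have "s powr (\<nu> - 1/2) * norm (hankel_factor (\<nu> - 1/2) s) \<le> s powr (\<nu> - 1/2) * (2 ^ n * (1 + s ^ n))"
      by (intro mult_left_mono) auto
    also have "\<dots> = 2 ^ n * (s powr (\<nu> - 1/2) + s powr (\<nu> - 1/2 + real n))"
      using s by (simp add: powr_add[of s "\<nu> - 1/2" "real n"] powr_realpow ring_distribs del: powr_add)
    also have "\<dots> = norm (2 ^ n * (complex_of_real (s powr (\<nu> - 1/2)) + complex_of_real (s powr (\<nu> - 1/2 + real n))))"
      by (simp add: norm_mult norm_power del: of_real_add flip: of_real_add)
    finally show "norm (hankel_kernel \<nu> 0 s) \<le> norm (2 ^ n * (complex_of_real (s powr (\<nu> - 1/2)) + complex_of_real (s powr (\<nu> - 1/2 + real n))))"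
      by (simp add: hankel_kernel_def norm_mult)
  qed
next
  case (Suc j)
  show ?case unfolding hankel_kernel_Suc
    by (intro laplace_admissible_uminus laplace_admissible_mult_ident Suc)
qed

lemma DERIV_hankel_integral:
  assumes "\<nu> \<ge> 0" "x > 0"
  shows "(hankel_integral \<nu> j has_vector_derivative hankel_integral \<nu> (Suc j) x) (at x)"
  unfolding hankel_integral_def[abs_def] hankel_kernel_Suc
  by (rule laplace_has_vector_derivative[OF laplace_admissible_hankel_kernel]) fact+

text \<open>The bound is global in s, so that it can be integrated without splitting the half-line.
  For s < 1 it is the tail of the binomial series at modulus at most 1/2; for s \<ge> 1 both the
  function and the Taylor polynomial are O(s^M), because M is at least a.\<close>

lemma hankel_factor_taylor:
  assumes "a \<le> real M"
  shows "\<exists>C. \<forall>s>0. norm (hankel_factor a s - (\<Sum>k<M. (of_real a gchoose k) * (\<i> * of_real s / 2) ^ k)) \<le> C * s ^ M"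
proof -
  define c where "c k = (complex_of_real a gchoose k)" for k
  \<comment> \<open>Convergence of the binomial series at 3/4 gives absolute convergence at 1/2,
    which bounds the modulus of i s / 2 for s < 1.\<close>
  have sm: "summable (\<lambda>k. norm (c k * (1/2) ^ k))"
    by (rule powser_insidea[of c "3/4"]) (use gen_binomial_complex[of "3/4" a] in \<open>auto simp: c_def sums_iff\<close>)
  define K where "K = (\<Sum>k. norm (c (k + M)) * (1/2) ^ k)"
  have smM: "summable (\<lambda>k. norm (c (k + M)) * (1/2) ^ k)"
  proof -
    have "summable (\<lambda>k. norm (c (k + M) * (1/2) ^ (k + M)) * 2 ^ M)"
      using summable_ignore_initial_segment[OF sm, of M] by (intro summable_mult2)
    moreover have "norm (c (k + M) * (1/2) ^ (k + M)) * 2 ^ M = norm (c (k + M)) * (1/2) ^ k" for k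
      by (simp add: norm_mult norm_power norm_divide power_add power_divide)
    ultimately show ?thesis by simp
  qed
  have K0: "K \<ge> 0" unfolding K_def by (intro suminf_nonneg smM) auto
  define C where "C = K + 2 ^ M + (\<Sum>k<M. norm (c k))"
  have "norm (hankel_factor a s - (\<Sum>k<M. c k * (\<i> * of_real s / 2) ^ k)) \<le> C * s ^ M" if s: "s > 0" for s
  proof (cases "s < 1")
    case True
    define z where "z = \<i> * complex_of_real s / 2"
    have z: "norm z = s / 2" using s by (simp add: z_def norm_mult norm_divide)
    have "(\<lambda>k. c k * z ^ k) sums hankel_factor a s"
      unfolding c_def hankel_factor_def z_def[symmetric] using z True by (intro gen_binomial_complex) auto
    then have "(\<lambda>k. c (k + M) * z ^ (k + M)) sums (hankel_factor a s - (\<Sum>k<M. c k * z ^ k))"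
      by (rule sums_split_initial_segment)
    then have eq: "hankel_factor a s - (\<Sum>k<M. c k * z ^ k) = (\<Sum>k. c (k + M) * z ^ (k + M))"
      by (rule sums_unique)
    have bd: "norm (c (k + M) * z ^ (k + M)) \<le> s ^ M * (norm (c (k + M)) * (1/2) ^ k)" for k
    proof -
      have "norm z ^ k \<le> (1/2) ^ k" using z True s by (intro power_mono) auto
      moreover have "norm z ^ M \<le> s ^ M" using z s by (intro power_mono) auto
      ultimately have "norm z ^ k * norm z ^ M \<le> (1/2) ^ k * s ^ M" by (intro mult_mono) auto
      from mult_left_mono[OF this, of "norm (c (k + M))"] show ?thesis
        by (simp add: norm_mult norm_power power_add mult_ac)
    qed
    have "norm (\<Sum>k. c (k + M) * z ^ (k + M)) \<le> (\<Sum>k. s ^ M * (norm (c (k + M)) * (1/2) ^ k))"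
      by (rule norm_suminf_le[OF bd summable_mult[OF smM]])
    also have "\<dots> = s ^ M * K" unfolding K_def by (rule suminf_mult[OF smM])
    also have "\<dots> \<le> s ^ M * C" using s by (intro mult_left_mono) (auto simp: C_def intro!: add_nonneg_nonneg sum_nonneg)
    finally show ?thesis unfolding eq z_def[symmetric] by (simp add: mult.commute)
  next
    case False
    have "norm (hankel_factor a s) \<le> (1 + s) ^ M" using s assms by (intro norm_hankel_factor_le) auto
    also have "\<dots> \<le> (2 * s) ^ M" using False by (intro power_mono) auto
    finally have 1: "norm (hankel_factor a s) \<le> 2 ^ M * s ^ M" by (simp add: power_mult_distrib)
    have "norm (\<Sum>k<M. c k * (\<i> * of_real s / 2) ^ k) \<le> (\<Sum>k<M. norm (c k) * s ^ M)"
    proof (rule sum_norm_le)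
      fix k assume k: "k \<in> {..<M}"
      have "(s / 2) ^ k \<le> s ^ k" using s by (intro power_mono) auto
      also have "\<dots> \<le> s ^ M" using False k by (intro power_increasing) auto
      finally show "norm (c k * (\<i> * of_real s / 2) ^ k) \<le> norm (c k) * s ^ M"
        using s by (auto simp: norm_mult norm_power norm_divide intro!: mult_left_mono)
    qed
    then have 2: "norm (\<Sum>k<M. c k * (\<i> * of_real s / 2) ^ k) \<le> (\<Sum>k<M. norm (c k)) * s ^ M"
      by (simp add: sum_distrib_right)
    have "norm (hankel_factor a s - (\<Sum>k<M. c k * (\<i> * of_real s / 2) ^ k)) \<le> 2 ^ M * s ^ M + (\<Sum>k<M. norm (c k)) * s ^ M"
      using norm_triangle_ineq4 1 2 by (meson add_mono order_trans)
    also have "\<dots> \<le> C * s ^ M" using K0 s by (simp add: C_def distrib_right)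
    finally show ?thesis .
  qed
  then show ?thesis unfolding c_def by blast
qed

definition hankel_exp_coeff :: "real \<Rightarrow> nat \<Rightarrow> nat \<Rightarrow> complex" where
  "hankel_exp_coeff \<nu> j k =
     (-1) ^ j * ((of_real (\<nu> - 1/2) gchoose k) * (\<i> / 2) ^ k * of_real (Gamma (\<nu> + 1/2 + real k + real j)))"

text \<open>Watson's lemma: each Taylor term integrates to a Gamma value over a power of x, and so
  does the remainder bound C s^(a + M + j), with M in place of k.\<close>

lemma hankel_integral_watson:
  assumes "\<nu> \<ge> 0" "\<nu> \<le> real M"
  shows "\<exists>C. \<forall>x>0. norm (of_real (x powr (\<nu> + 1/2 + real j)) * hankel_integral \<nu> j x
            - (\<Sum>k<M. hankel_exp_coeff \<nu> j k / of_real x ^ k)) \<le> C / x ^ M"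
proof -
  define a where "a = \<nu> - 1/2"
  define c where "c k = (complex_of_real a gchoose k) * (\<i> / 2) ^ k" for k
  have a: "a > -1" "a \<le> real M" using assms by (auto simp: a_def)
  obtain C where C: "\<And>s. s > 0 \<Longrightarrow> norm (hankel_factor a s - (\<Sum>k<M. (of_real a gchoose k) * (\<i> * of_real s / 2) ^ k)) \<le> C * s ^ M"
    using hankel_factor_taylor[OF a(2)] by blast
  define t where "t k = (\<lambda>s::real. ((-1) ^ j * c k) * complex_of_real (s powr (a + real k + real j)))" for k
  have adm_t: "laplace_admissible (t k)" for k
    unfolding t_def using a by (intro laplace_admissible_cmult laplace_powr) auto
  have lap_t: "laplace (t k) x = hankel_exp_coeff \<nu> j k / of_real x ^ k / of_real (x powr (\<nu> + 1/2 + real j))" if "x > 0" for k x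
  proof -
    have "laplace (t k) x = ((-1) ^ j * c k) * of_real (Gamma (a + real k + real j + 1) / x powr (a + real k + real j + 1))"
      unfolding t_def laplace_cmult using a that by (subst laplace_powr(2)) auto
    also have "a + real k + real j + 1 = (\<nu> + 1/2 + real j) + real k" by (simp add: a_def)
    also have "x powr ((\<nu> + 1/2 + real j) + real k) = x powr (\<nu> + 1/2 + real j) * x ^ k"
      using that by (simp add: powr_add powr_realpow)
    finally show ?thesis
      by (simp add: hankel_exp_coeff_def c_def a_def algebra_simps)
  qed
  define \<rho> where "\<rho> = (\<lambda>s. hankel_kernel \<nu> j s - (\<Sum>k<M. t k s))"
  have adm_h: "laplace_admissible (hankel_kernel \<nu> j)" by (rule laplace_admissible_hankel_kernel[OF assms(1)])
  have adm_sum: "laplace_admissible (\<lambda>s. \<Sum>k<M. t k s)" by (intro laplace_admissible_sum adm_t)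
  have adm_\<rho>: "laplace_admissible \<rho>"
    unfolding \<rho>_def diff_conv_add_uminus by (intro laplace_admissible_add laplace_admissible_uminus adm_h adm_sum)
  have \<rho>_bound: "norm (\<rho> s) \<le> C * s powr (a + real M + real j)" if s: "s > 0" for s
  proof -
    have t_eq: "t k s = (- of_real s) ^ j * (of_real (s powr a) * ((of_real a gchoose k) * (\<i> * of_real s / 2) ^ k))" for k
      using s by (simp add: t_def c_def powr_add powr_realpow power_mult_distrib power_divide power_minus[of "complex_of_real s"])
    have "\<rho> s = (- of_real s) ^ j * (of_real (s powr a) * (hankel_factor a s - (\<Sum>k<M. (of_real a gchoose k) * (\<i> * of_real s / 2) ^ k)))"
      unfolding \<rho>_def hankel_kernel_def t_eq a_def[symmetric] by (simp add: sum_distrib_left right_diff_distrib)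
    then have "norm (\<rho> s) = s ^ j * (s powr a * norm (hankel_factor a s - (\<Sum>k<M. (of_real a gchoose k) * (\<i> * of_real s / 2) ^ k)))"
      using s by (simp add: norm_mult norm_power)
    also have "\<dots> \<le> s ^ j * (s powr a * (C * s ^ M))" using s by (intro mult_left_mono C) auto
    also have "\<dots> = C * s powr (a + real M + real j)" using s by (simp add: powr_add powr_realpow)
    finally show ?thesis .
  qed
  have main: "norm (of_real (x powr (\<nu> + 1/2 + real j)) * hankel_integral \<nu> j x
            - (\<Sum>k<M. hankel_exp_coeff \<nu> j k / of_real x ^ k)) \<le> \<bar>C\<bar> * Gamma (\<nu> + 1/2 + real M + real j) / x ^ M" if x: "x > 0" for x
  proof -
    define P where "P = x powr (\<nu> + 1/2 + real j)"
    have P: "P > 0" using x by (simp add: P_def)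
    have "laplace \<rho> x = hankel_integral \<nu> j x - (\<Sum>k<M. laplace (t k) x)"
      unfolding \<rho>_def diff_conv_add_uminus hankel_integral_def
        laplace_add[OF adm_h laplace_admissible_uminus[OF adm_sum] x] laplace_uminus
      by (subst laplace_sum) (use adm_t x in auto)
    also have "(\<Sum>k<M. laplace (t k) x) = (\<Sum>k<M. hankel_exp_coeff \<nu> j k / of_real x ^ k) / of_real P"
      by (simp add: lap_t[OF x] sum_divide_distrib P_def)
    finally have eq: "of_real P * hankel_integral \<nu> j x - (\<Sum>k<M. hankel_exp_coeff \<nu> j k / of_real x ^ k) = of_real P * laplace \<rho> x"
      using P by (simp add: field_simps)
    have "norm (laplace \<rho> x) \<le> norm (laplace (\<lambda>s. of_real (C * s powr (a + real M + real j))) x)"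
    proof (rule laplace_norm_bound[OF adm_\<rho> _ x])
      show "laplace_admissible (\<lambda>s. complex_of_real (C * s powr (a + real M + real j)))"
        unfolding of_real_mult using a by (intro laplace_admissible_cmult laplace_powr) auto
    qed (rule \<rho>_bound)
    also have "laplace (\<lambda>s. of_real (C * s powr (a + real M + real j))) x = of_real C * of_real (Gamma (a + real M + real j + 1) / x powr (a + real M + real j + 1))"
      unfolding of_real_mult laplace_cmult using a x by (subst laplace_powr(2)) auto
    also have "a + real M + real j + 1 = (\<nu> + 1/2 + real j) + real M" by (simp add: a_def)
    also have "x powr ((\<nu> + 1/2 + real j) + real M) = P * x ^ M"
      using x by (simp add: powr_add powr_realpow P_def)
    finally have "norm (laplace \<rho> x) \<le> \<bar>C\<bar> * (Gamma (\<nu> + 1/2 + real M + real j) / (P * x ^ M))"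
      using assms(1) P x by (simp add: norm_mult norm_divide Gamma_real_nonneg norm_power add_ac)
    then have "P * norm (laplace \<rho> x) \<le> P * (\<bar>C\<bar> * (Gamma (\<nu> + 1/2 + real M + real j) / (P * x ^ M)))"
      using P by (intro mult_left_mono) auto
    also have "\<dots> = \<bar>C\<bar> * Gamma (\<nu> + 1/2 + real M + real j) / x ^ M" using P by simp
    finally show ?thesis unfolding P_def[symmetric] eq using P by (simp add: norm_mult)
  qed
  then show ?thesis by blast
qed

text \<open>The combination q is chosen so that q e^(-x s) is the derivative in s of F = s^(a+1) (1
  + i s / 2)^(a+1) e^(-x s). As F vanishes at 0 and at infinity, the transform of q is 0.\<close>

lemma hankel_integral_ODE:
  assumes \<nu>: "\<nu> \<ge> 0" and x: "x > 0"
  shows "of_real x * hankel_integral \<nu> 2 x + (of_real (2 * \<nu> + 1) + 2 * \<i> * of_real x) * hankel_integral \<nu> 1 x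
           + \<i> * of_real (2 * \<nu> + 1) * hankel_integral \<nu> 0 x = 0"
proof -
  define a where "a = \<nu> - 1/2"
  have a: "a \<ge> -1/2" using \<nu> by (simp add: a_def)
  define F where "F s = of_real (s powr (a + 1)) * hankel_factor (a + 1) s * of_real (exp (- (x * s)))" for s
  define k where "k j s = hankel_kernel \<nu> j s" for j s
  define f where "f s = (of_real (a + 1) * k 0 s + (of_real x - of_real (a + 1) * \<i>) * k 1 s + (- (\<i> / 2) * of_real x) * k 2 s) * of_real (exp (- (x * s)))" for s
  define q where "q s = of_real (a + 1) * k 0 s + (of_real x - of_real (a + 1) * \<i>) * k 1 s + (- (\<i> / 2) * of_real x) * k 2 s" for s
  have adm: "laplace_admissible (k j)" for j unfolding k_def by (rule laplace_admissible_hankel_kernel[OF \<nu>])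
  have admq: "laplace_admissible q"
    unfolding q_def by (intro laplace_admissible_add laplace_admissible_cmult adm)
  have lap: "laplace q x = of_real (a + 1) * hankel_integral \<nu> 0 x + (of_real x - of_real (a + 1) * \<i>) * hankel_integral \<nu> 1 x
      + (- (\<i> / 2) * of_real x) * hankel_integral \<nu> 2 x"
    unfolding q_def
    by (subst laplace_add laplace_cmult; (intro laplace_admissible_add laplace_admissible_cmult adm x)?)+
       (simp add: hankel_integral_def k_def[abs_def])
  have dF: "(F has_vector_derivative q s * of_real (exp (- (x * s)))) (at s)" if s: "s > 0" for s
  proof -
    have d1: "((\<lambda>s. complex_of_real (s powr (a + 1))) has_vector_derivative of_real ((a + 1) * s powr a)) (at s)"
      using has_real_derivative_powr[OF s, of "a + 1"]
      by (intro has_vector_derivative_of_real) (simp add: has_real_derivative_iff_has_vector_derivative)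
    have d3: "((\<lambda>s. complex_of_real (exp (- (x * s)))) has_vector_derivative of_real (- x * exp (- (x * s)))) (at s)"
      by (intro has_vector_derivative_of_real)
         (auto intro!: derivative_eq_intros simp flip: has_real_derivative_iff_has_vector_derivative)
    have d2: "(hankel_factor (a + 1) has_vector_derivative of_real (a + 1) * (\<i> / 2) * hankel_factor a s) (at s)"
      using DERIV_hankel_factor[of "a + 1" s] by simp
    have p: "s powr (a + 1) = s powr a * s" using s by (simp add: powr_add)
    show ?thesis unfolding F_def
      by (rule has_vector_derivative_eq_rhs[OF has_vector_derivative_mult[OF has_vector_derivative_mult[OF d1 d2] d3]])
         (simp only: q_def k_def hankel_kernel_def a_def[symmetric] p hankel_factor_plus_one, simp add: power2_eq_square algebra_simps)
  qed
  have "(LBINT s=0..\<infinity>. q s * of_real (exp (- (x * s)))) = 0 - 0"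
  proof (rule interval_integral_FTC_integrable)
    show "(F has_vector_derivative q s * of_real (exp (- (x * s)))) (at s)" if "0 < ereal s" "ereal s < \<infinity>" for s
      using dF that by simp
    show "isCont (\<lambda>s. q s * of_real (exp (- (x * s)))) s" if "0 < ereal s" "ereal s < \<infinity>" for s
    proof -
      have "isCont (hankel_factor (\<nu> - 1/2)) s"
        using continuous_hankel_factor by (simp add: continuous_on_eq_continuous_at)
      then show ?thesis unfolding q_def k_def hankel_kernel_def using that
        by (intro continuous_intros) auto
    qed
    show "set_integrable lborel (einterval 0 \<infinity>) (\<lambda>s. q s * of_real (exp (- (x * s))))"
      using laplace_admissible_integrable[OF admq x] by (simp add: zero_ereal_def)
    show "((F \<circ> real_of_ereal) \<longlongrightarrow> 0) (at_right 0)"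
    proof -
      have "(F \<longlongrightarrow> 0) (at_right 0)"
      proof (rule tendsto_norm_zero_cancel)
        define n where "n = nat \<lceil>a + 1\<rceil>"
        have n: "a + 1 \<le> real n" unfolding n_def by linarith
        show "((\<lambda>s. norm (F s)) \<longlongrightarrow> 0) (at_right 0)"
        proof (rule tendsto_sandwich[where f = "\<lambda>_. 0"])
          show "\<forall>\<^sub>F s in at_right 0. norm (F s) \<le> s powr (a + 1) * (1 + s) ^ n * 1"
            using eventually_at_right_less[of 0]
          proof eventually_elim
            case (elim s)
            then show ?case unfolding F_def norm_mult
              by (intro mult_mono norm_hankel_factor_le n) (use x in auto)
          qed
          show "((\<lambda>s. s powr (a + 1) * (1 + s) ^ n * 1) \<longlongrightarrow> 0) (at_right 0)"
          proof -
            have "((\<lambda>s. s powr (a + 1)) \<longlongrightarrow> 0) (at_right (0::real))"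
              using a by (intro tendsto_eq_intros) (auto simp: eventually_at_filter)
            moreover have "((\<lambda>s. (1 + s) ^ n) \<longlongrightarrow> (1 + 0) ^ n) (at_right (0::real))"
              by (intro tendsto_intros)
            ultimately show ?thesis using tendsto_mult by fastforce
          qed
        qed auto
      qed
      then show ?thesis by (simp add: zero_ereal_def ereal_tendsto_simps)
    qed
    show "((F \<circ> real_of_ereal) \<longlongrightarrow> 0) (at_left \<infinity>)"
    proof -
      have "(F \<longlongrightarrow> 0) at_top"
      proof (rule tendsto_norm_zero_cancel)
        define n where "n = nat \<lceil>a + 1\<rceil>"
        have n: "a + 1 \<le> real n" unfolding n_def by linarith
        show "((\<lambda>s. norm (F s)) \<longlongrightarrow> 0) at_top"
        proof (rule tendsto_sandwich[where f = "\<lambda>_. 0"])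
          show "\<forall>\<^sub>F s in at_top. norm (F s) \<le> s powr (a + 1) * (1 + s) ^ n * exp (- (x * s))"
            using eventually_gt_at_top[of 0]
          proof eventually_elim
            case (elim s)
            then show ?case unfolding F_def norm_mult
              by (intro mult_mono norm_hankel_factor_le n) auto
          qed
          show "((\<lambda>s. s powr (a + 1) * (1 + s) ^ n * exp (- (x * s))) \<longlongrightarrow> 0) at_top"
            using x by real_asymp
        qed auto
      qed
      then show ?thesis by (simp add: ereal_tendsto_simps)
    qed
  qed simp
  then have "laplace q x = 0"
    by (simp add: laplace_def interval_lebesgue_integral_def zero_ereal_def)
  \<comment> \<open>The factor 2 i turns the coefficient - i/2 of x times the second derivative into
    1.\<close>
  then have "2 * \<i> * (of_real (a + 1) * hankel_integral \<nu> 0 x + (of_real x - of_real (a + 1) * \<i>) * hankel_integral \<nu> 1 x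
      + (- (\<i> / 2) * of_real x) * hankel_integral \<nu> 2 x) = 0" unfolding lap by simp
  then show ?thesis by (simp add: a_def algebra_simps)
qed

section \<open>The Hankel integral near the origin\<close>

lemma integrable_powr_one_plus_exp:
  fixes b :: real
  assumes "b > -1"
  shows "set_integrable lborel {0<..} (\<lambda>t. t powr b * (1 + t) ^ n * exp (- t))"
proof (rule set_integrable_bound)
  have "set_integrable lborel {0<..} (\<lambda>t. 2 ^ n * (t powr b * exp (- (1 * t)) + t powr (b + real n) * exp (- (1 * t))))"
    using assms by (intro set_integrable_mult_right set_integral_add(1) integrable_Gamma_kernel) auto
  then show "set_integrable lborel {0<..} (\<lambda>t. 2 ^ n * (t powr b * exp (- t) + t powr (b + real n) * exp (- t)))" by simp
  show "set_borel_measurable lborel {0<..} (\<lambda>t. t powr b * (1 + t) ^ n * exp (- t))"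
    unfolding set_borel_measurable_def by measurable
  have "t powr b * (1 + t) ^ n * exp (- t) \<le> 2 ^ n * (t powr b * exp (- t) + t powr (b + real n) * exp (- t))" if t: "t > 0" for t
  proof -
    have "t powr b * (1 + t) ^ n * exp (- t) \<le> t powr b * (2 ^ n * (1 + t ^ n)) * exp (- t)"
      using t by (intro mult_right_mono mult_left_mono one_plus_power_le) auto
    also have "\<dots> = 2 ^ n * (t powr b * exp (- t) + t powr (b + real n) * exp (- t))"
      using t by (simp add: powr_add powr_realpow algebra_simps)
    finally show ?thesis .
  qed
  then show "AE t in lborel. t \<in> {0<..} \<longrightarrow> norm (t powr b * (1 + t) ^ n * exp (- t)) \<le> norm (2 ^ n * (t powr b * exp (- t) + t powr (b + real n) * exp (- t)))"
    by (auto simp: abs_mult)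
qed

text \<open>After s = t / x the factor (1 + i s / 2)^a becomes x^(-a) (x + i t / 2)^a, and the
  second power has a limit as x tends to 0.\<close>

definition scaled_factor :: "real \<Rightarrow> real \<Rightarrow> real \<Rightarrow> complex" where
  "scaled_factor a x t = (of_real x + \<i> * of_real t / 2) powr of_real a"

lemma scaled_factor_eq: "x > 0 \<Longrightarrow> scaled_factor a x t = of_real (x powr a) * hankel_factor a (t / x)"
proof -
  assume x: "x > 0"
  have "of_real x + \<i> * of_real t / 2 = of_real x * (1 + \<i> * of_real (t / x) / 2)" using x by (simp add: field_simps)
  then have "scaled_factor a x t = of_real x powr of_real a * hankel_factor a (t / x)"
    unfolding scaled_factor_def hankel_factor_def using x by (simp only: powr_times_real_left[of "of_real x"] Reals_of_real Re_complex_of_real less_imp_le)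
  then show ?thesis using x by (simp add: powr_of_real)
qed

lemma scaled_factor_measurable [measurable]: "x > 0 \<Longrightarrow> (\<lambda>t. scaled_factor a x t) \<in> borel_measurable borel"
  by (simp add: scaled_factor_eq) measurable

lemma hankel_integral_scaled:
  assumes x: "x > 0"
  shows "of_real (x powr (2 * \<nu> + 1)) * hankel_integral \<nu> 0 x
           = (LBINT t. indicator {0<..} t *\<^sub>R (of_real (x * t powr (\<nu> - 1/2) * exp (- t)) * scaled_factor (\<nu> - 1/2) x t))"
    and "of_real (x powr (2 * \<nu> + 1)) * hankel_integral \<nu> 1 x
           = (LBINT t. indicator {0<..} t *\<^sub>R (- of_real (t * t powr (\<nu> - 1/2) * exp (- t)) * scaled_factor (\<nu> - 1/2) x t))"
proof -
  define a where "a = \<nu> - 1/2"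
  have sub: "hankel_integral \<nu> j x = of_real (1 / x) * (LBINT t. indicator {0<..} t *\<^sub>R (hankel_kernel \<nu> j (t / x) * of_real (exp (- t))))" for j
  proof -
    have "hankel_integral \<nu> j x = (LBINT s. indicator {0<..} s *\<^sub>R (hankel_kernel \<nu> j s * of_real (exp (- (x * s)))))"
      by (simp add: hankel_integral_def laplace_def set_lebesgue_integral_def)
    also have "\<dots> = \<bar>1 / x\<bar> *\<^sub>R (LBINT t. indicator {0<..} (0 + 1 / x * t) *\<^sub>R (hankel_kernel \<nu> j (0 + 1 / x * t) * of_real (exp (- (x * (0 + 1 / x * t))))))"
      using x by (intro lborel_integral_real_affine) auto
    also have "(\<lambda>t. indicator {0<..} (0 + 1 / x * t) *\<^sub>R (hankel_kernel \<nu> j (0 + 1 / x * t) * of_real (exp (- (x * (0 + 1 / x * t))))))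
       = (\<lambda>t. indicator {0<..} t *\<^sub>R (hankel_kernel \<nu> j (t / x) * complex_of_real (exp (- t))))"
      using x by (auto simp: fun_eq_iff indicator_def zero_less_divide_iff)
    finally show ?thesis using x by (simp add: scaleR_conv_of_real)
  qed
  have pw: "x powr (2 * \<nu> + 1) * (1 / x) * (t / x) powr a = x * x powr a * t powr a" if "t > 0" for t
  proof -
    have "x powr (2 * \<nu> + 1) = x * x * (x powr a * x powr a)"
    proof -
      have "2 * \<nu> + 1 = 1 + (1 + (a + a))" by (simp add: a_def)
      then show ?thesis using x by (simp only: powr_add powr_one abs_of_pos mult.assoc)
    qed
    then show ?thesis using x that by (simp add: powr_divide field_simps)
  qed
  have "of_real (x powr (2 * \<nu> + 1)) * hankel_integral \<nu> 0 x
     = (LBINT t. of_real (x powr (2 * \<nu> + 1) * (1 / x)) * (indicator {0<..} t *\<^sub>R (hankel_kernel \<nu> 0 (t / x) * of_real (exp (- t)))))"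
    unfolding sub by (subst integral_mult_right_zero) simp
  also have "\<dots> = (LBINT t. indicator {0<..} t *\<^sub>R (of_real (x * t powr a * exp (- t)) * scaled_factor a x t))"
  proof (rule Bochner_Integration.integral_cong[OF refl])
    fix t :: real
    show "of_real (x powr (2 * \<nu> + 1) * (1 / x)) * (indicator {0<..} t *\<^sub>R (hankel_kernel \<nu> 0 (t / x) * of_real (exp (- t))))
       = indicator {0<..} t *\<^sub>R (complex_of_real (x * t powr a * exp (- t)) * scaled_factor a x t)"
    proof (cases "t > 0")
      case True
      have "of_real (x powr (2 * \<nu> + 1) * (1 / x)) * (hankel_kernel \<nu> 0 (t / x) * of_real (exp (- t)))
         = complex_of_real (x powr (2 * \<nu> + 1) * (1 / x) * (t / x) powr a) * of_real (exp (- t)) * hankel_factor a (t / x)"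
        by (simp add: hankel_kernel_def a_def[symmetric] mult_ac)
      then show ?thesis unfolding pw[OF True] using True x by (simp add: scaled_factor_eq mult_ac)
    qed simp
  qed
  finally show "of_real (x powr (2 * \<nu> + 1)) * hankel_integral \<nu> 0 x
           = (LBINT t. indicator {0<..} t *\<^sub>R (of_real (x * t powr (\<nu> - 1/2) * exp (- t)) * scaled_factor (\<nu> - 1/2) x t))"
    by (simp add: a_def)
  have "of_real (x powr (2 * \<nu> + 1)) * hankel_integral \<nu> 1 x
     = (LBINT t. of_real (x powr (2 * \<nu> + 1) * (1 / x)) * (indicator {0<..} t *\<^sub>R (hankel_kernel \<nu> 1 (t / x) * of_real (exp (- t)))))"
    unfolding sub by (subst integral_mult_right_zero) simp
  also have "\<dots> = (LBINT t. indicator {0<..} t *\<^sub>R (- of_real (t * t powr a * exp (- t)) * scaled_factor a x t))"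
  proof (rule Bochner_Integration.integral_cong[OF refl])
    fix t :: real
    show "of_real (x powr (2 * \<nu> + 1) * (1 / x)) * (indicator {0<..} t *\<^sub>R (hankel_kernel \<nu> 1 (t / x) * of_real (exp (- t))))
       = indicator {0<..} t *\<^sub>R (- complex_of_real (t * t powr a * exp (- t)) * scaled_factor a x t)"
    proof (cases "t > 0")
      case True
      have "of_real (x powr (2 * \<nu> + 1) * (1 / x)) * (hankel_kernel \<nu> 1 (t / x) * of_real (exp (- t)))
         = - (complex_of_real (x powr (2 * \<nu> + 1) * (1 / x) * (t / x) powr a) * of_real (t / x) * of_real (exp (- t)) * hankel_factor a (t / x))"
        by (simp add: hankel_kernel_def a_def[symmetric] mult_ac)
      then show ?thesis unfolding pw[OF True] using True x by (simp add: scaled_factor_eq mult_ac)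
    qed simp
  qed
  finally show "of_real (x powr (2 * \<nu> + 1)) * hankel_integral \<nu> 1 x
           = (LBINT t. indicator {0<..} t *\<^sub>R (- of_real (t * t powr (\<nu> - 1/2) * exp (- t)) * scaled_factor (\<nu> - 1/2) x t))"
    by (simp add: a_def)
qed

text \<open>The exponent \<nu> - 1/2 is split because it may be negative: the power \<nu> is bounded
  from above, while the power -1/2 requires a lower bound r for the modulus. Of the two available
  ones, r = x serves the integral itself and r = t / 2 its derivative.\<close>

lemma norm_scaled_factor_le:
  assumes "\<nu> \<le> real n" "\<nu> \<ge> 0" "0 \<le> x" "x \<le> 1" "t \<ge> 0" "0 < r" "r \<le> max x (t / 2)"
  shows "norm (scaled_factor (\<nu> - 1/2) x t) \<le> (1 + t) ^ n * r powr (-1/2)"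
proof -
  define z where "z = complex_of_real x + \<i> * of_real t / 2"
  have lo: "r \<le> norm z"
    using abs_Re_le_cmod[of z] abs_Im_le_cmod[of z] assms by (auto simp: z_def)
  have hi: "norm z \<le> 1 + t"
    unfolding z_def by (rule order.trans[OF norm_triangle_ineq]) (use assms in \<open>simp add: norm_mult norm_divide\<close>)
  have "norm (scaled_factor (\<nu> - 1/2) x t) = norm z powr (\<nu> + -1/2)"
    by (simp add: scaled_factor_def z_def norm_powr_real_powr')
  also have "\<dots> = norm z powr \<nu> * norm z powr (-1/2)" by (rule powr_add)
  also have "\<dots> \<le> (1 + t) ^ n * r powr (-1/2)"
  proof (intro mult_mono)
    have "norm z powr \<nu> \<le> (1 + t) powr \<nu>" using hi assms by (intro powr_mono2) auto
    also have "\<dots> \<le> (1 + t) powr real n" using assms by (intro powr_mono) auto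
    finally show "norm z powr \<nu> \<le> (1 + t) ^ n" using assms by (simp add: powr_realpow)
    show "norm z powr (-1/2) \<le> r powr (-1/2)" using lo assms by (intro powr_mono2') auto
  qed (use assms in auto)
  finally show ?thesis .
qed

lemma scaled_factor_tendsto:
  assumes "t > 0" "X \<longlonglongrightarrow> 0"
  shows "(\<lambda>n. scaled_factor a (X n) t) \<longlonglongrightarrow> of_real ((t / 2) powr a) * cis (pi / 2 * a)"
proof -
  have "(\<lambda>n. scaled_factor a (X n) t) \<longlonglongrightarrow> (of_real 0 + \<i> * of_real t / 2) powr of_real a"
    unfolding scaled_factor_def using assms
    by (intro tendsto_powr_complex tendsto_intros) (auto simp: complex_nonpos_Reals_iff)
  also have "(of_real 0 + \<i> * of_real t / 2) powr of_real a = (of_real (t / 2) * \<i>) powr complex_of_real a"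
    by (simp add: mult_ac)
  also have "\<dots> = of_real (t / 2) powr of_real a * \<i> powr complex_of_real a"
    using assms by (intro powr_times_real_left) auto
  also have "\<i> powr complex_of_real a = cis (pi / 2 * a)"
    by (simp add: powr_def cis_conv_exp mult_ac)
  also have "of_real (t / 2) powr of_real a = complex_of_real ((t / 2) powr a)"
    using assms by (intro powr_of_real) auto
  finally show ?thesis .
qed

text \<open>Dominated convergence after the substitution s = t / x; with the weight x^(2 \<nu> + 1)
  the derivative has a finite limit. What counts later is the phase of that limit, which comes from
  the power (i t / 2)^(\<nu> - 1/2).\<close>

lemma hankel_integral_small:
  assumes \<nu>: "\<nu> \<ge> 0"
  shows "((\<lambda>x. of_real (x powr (2 * \<nu> + 1)) * hankel_integral \<nu> 0 x) \<longlongrightarrow> 0) (at_right 0)"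
    and "\<exists>r. ((\<lambda>x. of_real (x powr (2 * \<nu> + 1)) * hankel_integral \<nu> 1 x) \<longlongrightarrow> of_real r * cis (pi / 2 * (\<nu> - 1/2))) (at_right 0)"
proof -
  define a where "a = \<nu> - 1/2"
  have a: "a \<ge> -1/2" using \<nu> by (simp add: a_def)
  define n where "n = nat \<lceil>\<nu>\<rceil>"
  have n: "\<nu> \<le> real n" unfolding n_def by linarith
  show "((\<lambda>x. of_real (x powr (2 * \<nu> + 1)) * hankel_integral \<nu> 0 x) \<longlongrightarrow> 0) (at_right 0)"
  proof (rule tendsto_at_right_sequentially[of 0 1])
    fix X :: "nat \<Rightarrow> real" assume X: "\<And>n. 0 < X n" "\<And>n. X n < 1" "X \<longlonglongrightarrow> 0"
    have "(\<lambda>i. LBINT t. indicator {0<..} t *\<^sub>R (of_real (X i * t powr a * exp (- t)) * scaled_factor a (X i) t))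
       \<longlonglongrightarrow> (LBINT t::real. indicator {0<..} t *\<^sub>R (0 :: complex))"
    proof (rule integral_dominated_convergence[where M = lborel and w = "\<lambda>t. indicator {0<..} t *\<^sub>R (t powr a * (1 + t) ^ n * exp (- t))"])
      show "(\<lambda>t. indicator {0<..} t *\<^sub>R (of_real (X i * t powr a * exp (- t)) * scaled_factor a (X i) t)) \<in> borel_measurable lborel" for i
        using X(1)[of i] by measurable
      show "integrable lborel (\<lambda>t. indicator {0<..} t *\<^sub>R (t powr a * (1 + t) ^ n * exp (- t)))"
        using integrable_powr_one_plus_exp[of a n] a by (simp add: set_integrable_def)
      have "(\<lambda>i. indicator {0<..} t *\<^sub>R (of_real (X i * t powr a * exp (- t)) * scaled_factor a (X i) t)) \<longlonglongrightarrow> indicator {0<..} t *\<^sub>R (0 :: complex)" for t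
      proof (cases "t > 0")
        case True
        have "(\<lambda>i. of_real (X i * t powr a * exp (- t)) * scaled_factor a (X i) t) \<longlonglongrightarrow> of_real (0 * t powr a * exp (- t)) * (of_real ((t / 2) powr a) * cis (pi / 2 * a))"
          using X by (intro tendsto_intros scaled_factor_tendsto True)
        then show ?thesis using True by simp
      qed simp
      then show "AE t in lborel. (\<lambda>i. indicator {0<..} t *\<^sub>R (of_real (X i * t powr a * exp (- t)) * scaled_factor a (X i) t)) \<longlonglongrightarrow> indicator {0<..} t *\<^sub>R (0 :: complex)" by simp
      have "norm (indicator {0<..} t *\<^sub>R (of_real (X i * t powr a * exp (- t)) * scaled_factor a (X i) t)) \<le> indicator {0<..} t *\<^sub>R (t powr a * (1 + t) ^ n * exp (- t))" for t i
      proof (cases "t > 0")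
        case True
        have x: "0 < X i" "X i < 1" using X by auto
        have "norm (scaled_factor a (X i) t) \<le> (1 + t) ^ n * X i powr (-1/2)"
          unfolding a_def by (rule norm_scaled_factor_le[OF n \<nu>]) (use x True in auto)
        then have "X i * norm (scaled_factor a (X i) t) \<le> X i * ((1 + t) ^ n * X i powr (-1/2))"
          using x by (intro mult_left_mono) auto
        also have "\<dots> = (1 + t) ^ n * X i powr (1/2)"
        proof -
          have "X i powr (1/2) = X i * X i powr (-1/2)" using x powr_add[of "X i" 1 "-1/2"] by simp
          then show ?thesis by simp
        qed
        also have "\<dots> \<le> (1 + t) ^ n * 1" using x True by (intro mult_left_mono powr_le1) auto
        finally have "(t powr a * exp (- t)) * (X i * norm (scaled_factor a (X i) t)) \<le> (t powr a * exp (- t)) * ((1 + t) ^ n * 1)"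
          by (intro mult_left_mono) auto
        then show ?thesis using True x by (simp add: norm_mult mult_ac)
      qed simp
      then show "AE t in lborel. norm (indicator {0<..} t *\<^sub>R (of_real (X i * t powr a * exp (- t)) * scaled_factor a (X i) t)) \<le> indicator {0<..} t *\<^sub>R (t powr a * (1 + t) ^ n * exp (- t))" for i by simp
    qed simp
    then show "(\<lambda>i. of_real (X i powr (2 * \<nu> + 1)) * hankel_integral \<nu> 0 (X i)) \<longlonglongrightarrow> 0"
      using X by (simp add: hankel_integral_scaled a_def)
  qed simp
  define r where "r = - (LBINT t. indicator {0<..} t *\<^sub>R (t * t powr a * exp (- t) * (t / 2) powr a))"
  have "((\<lambda>x. of_real (x powr (2 * \<nu> + 1)) * hankel_integral \<nu> 1 x) \<longlongrightarrow> of_real r * cis (pi / 2 * a)) (at_right 0)"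
  proof (rule tendsto_at_right_sequentially[of 0 1])
    fix X :: "nat \<Rightarrow> real" assume X: "\<And>n. 0 < X n" "\<And>n. X n < 1" "X \<longlonglongrightarrow> 0"
    let ?f = "\<lambda>t. indicator {0<..} t *\<^sub>R (- of_real (t * t powr a * exp (- t)) * (of_real ((t / 2) powr a) * cis (pi / 2 * a))) :: complex"
    have "(\<lambda>i. LBINT t. indicator {0<..} t *\<^sub>R (- of_real (t * t powr a * exp (- t)) * scaled_factor a (X i) t))
       \<longlonglongrightarrow> (LBINT t. ?f t)"
    proof (rule integral_dominated_convergence[where M = lborel and w = "\<lambda>t. 2 * (indicator {0<..} t *\<^sub>R (t powr (a + 1/2) * (1 + t) ^ n * exp (- t)))"])
      show "(\<lambda>t. indicator {0<..} t *\<^sub>R (- of_real (t * t powr a * exp (- t)) * scaled_factor a (X i) t)) \<in> borel_measurable lborel" for i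
        using X(1)[of i] by measurable
      show "integrable lborel (\<lambda>t. 2 * (indicator {0<..} t *\<^sub>R (t powr (a + 1/2) * (1 + t) ^ n * exp (- t))))"
        using integrable_powr_one_plus_exp[of "a + 1/2" n] a by (intro integrable_mult_right) (simp add: set_integrable_def)
      have "(\<lambda>i. indicator {0<..} t *\<^sub>R (- of_real (t * t powr a * exp (- t)) * scaled_factor a (X i) t)) \<longlonglongrightarrow> ?f t" for t
      proof (cases "t > 0")
        case True
        have "(\<lambda>i. - of_real (t * t powr a * exp (- t)) * scaled_factor a (X i) t) \<longlonglongrightarrow> - of_real (t * t powr a * exp (- t)) * (of_real ((t / 2) powr a) * cis (pi / 2 * a))"
          using X by (intro tendsto_intros scaled_factor_tendsto True)
        then show ?thesis using True by simp
      qed simp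
      then show "AE t in lborel. (\<lambda>i. indicator {0<..} t *\<^sub>R (- of_real (t * t powr a * exp (- t)) * scaled_factor a (X i) t)) \<longlonglongrightarrow> ?f t" by simp
      have "norm (indicator {0<..} t *\<^sub>R (- of_real (t * t powr a * exp (- t)) * scaled_factor a (X i) t)) \<le> 2 * (indicator {0<..} t *\<^sub>R (t powr (a + 1/2) * (1 + t) ^ n * exp (- t)))" for t i
      proof (cases "t > 0")
        case True
        have x: "0 < X i" "X i < 1" using X by auto
        have "norm (scaled_factor a (X i) t) \<le> (1 + t) ^ n * (t / 2) powr (-1/2)"
          unfolding a_def by (rule norm_scaled_factor_le[OF n \<nu>]) (use x True in auto)
        then have "t * norm (scaled_factor a (X i) t) \<le> t * ((1 + t) ^ n * (t / 2) powr (-1/2))"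
          using True by (intro mult_left_mono) auto
        also have "\<dots> = (1 + t) ^ n * (2 powr (1/2) * t powr (1/2))"
        proof -
          have "t powr (1/2) = t * t powr (-1/2)" using True powr_add[of t 1 "-1/2"] by simp
          then show ?thesis using True by (simp add: powr_divide powr_minus field_simps)
        qed
        also have "\<dots> \<le> (1 + t) ^ n * (2 * t powr (1/2))"
          using True powr_mono[of "1/2" 1 "2::real"] by (intro mult_left_mono mult_right_mono) auto
        finally have "(t powr a * exp (- t)) * (t * norm (scaled_factor a (X i) t)) \<le> (t powr a * exp (- t)) * ((1 + t) ^ n * (2 * t powr (1/2)))"
          by (intro mult_left_mono) auto
        then show ?thesis using True x by (simp add: norm_mult powr_add mult_ac)
      qed simp
      then show "AE t in lborel. norm (indicator {0<..} t *\<^sub>R (- of_real (t * t powr a * exp (- t)) * scaled_factor a (X i) t)) \<le> 2 * (indicator {0<..} t *\<^sub>R (t powr (a + 1/2) * (1 + t) ^ n * exp (- t)))" for i by simp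
    qed measurable
    also have "(LBINT t. ?f t) = of_real r * cis (pi / 2 * a)"
    proof -
      define W where "W t = indicator {0<..} t *\<^sub>R (t * t powr a * exp (- t) * (t / 2) powr a)" for t :: real
      have "?f = (\<lambda>t. complex_of_real (W t) * (- cis (pi / 2 * a)))"
        by (auto simp: fun_eq_iff indicator_def W_def)
      then have "(LBINT t. ?f t) = complex_of_real (LBINT t. W t) * (- cis (pi / 2 * a))"
        by (simp only: integral_mult_left_zero integral_complex_of_real)
      moreover have "r = - (LBINT t. W t)" by (simp add: r_def W_def)
      ultimately show ?thesis by simp
    qed
    finally show "(\<lambda>i. of_real (X i powr (2 * \<nu> + 1)) * hankel_integral \<nu> 1 (X i)) \<longlonglongrightarrow> of_real r * cis (pi / 2 * a)"
      by (simp only: hankel_integral_scaled(2)[OF X(1)] a_def)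
  qed simp
  then show "\<exists>r. ((\<lambda>x. of_real (x powr (2 * \<nu> + 1)) * hankel_integral \<nu> 1 x) \<longlongrightarrow> of_real r * cis (pi / 2 * (\<nu> - 1/2))) (at_right 0)"
    unfolding a_def by blast
qed

section \<open>Asymptotic expansion of the derivatives\<close>

definition has_expansion :: "(real \<Rightarrow> complex) \<Rightarrow> (nat \<Rightarrow> complex) \<Rightarrow> bool" where
  "has_expansion F f \<longleftrightarrow>
     (\<forall>M. \<exists>C. \<forall>\<^sub>F x in at_top. norm (F x - (\<Sum>k<M. f k / of_real x ^ k)) \<le> C / x ^ M)"

text \<open>A bound of high order implies the lower ones, the extra terms being absorbed into the
  constant. Watson's lemma above supplies the orders M \<ge> \<nu>.\<close>

lemma has_expansionI_large:
  assumes "\<And>M. M \<ge> M0 \<Longrightarrow> \<exists>C. \<forall>\<^sub>F x in at_top. norm (F x - (\<Sum>k<M. f k / of_real x ^ k)) \<le> C / x ^ M"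
  shows "has_expansion F f"
  unfolding has_expansion_def
proof
  fix M :: nat
  define M' where "M' = max M M0"
  obtain C where C: "\<forall>\<^sub>F x in at_top. norm (F x - (\<Sum>k<M'. f k / of_real x ^ k)) \<le> C / x ^ M'"
    using assms[of M'] by (auto simp: M'_def)
  define D where "D = \<bar>C\<bar> + (\<Sum>k\<in>{M..<M'}. norm (f k))"
  have "\<forall>\<^sub>F x in at_top. norm (F x - (\<Sum>k<M. f k / of_real x ^ k)) \<le> D / x ^ M"
    using C eventually_ge_at_top[of 1]
  proof eventually_elim
    case (elim x)
    have le: "c / x ^ k \<le> c / x ^ M" if "k \<ge> M" "c \<ge> 0" for c k
      using that elim by (intro divide_left_mono power_increasing) auto
    have split: "(\<Sum>k<M'. f k / of_real x ^ k) = (\<Sum>k<M. f k / of_real x ^ k) + (\<Sum>k\<in>{M..<M'}. f k / of_real x ^ k)"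
      by (subst sum.union_disjoint[symmetric]) (auto intro!: sum.cong simp: M'_def)
    have "norm (F x - (\<Sum>k<M. f k / of_real x ^ k)) = norm ((F x - (\<Sum>k<M'. f k / of_real x ^ k)) + (\<Sum>k\<in>{M..<M'}. f k / of_real x ^ k))"
      by (simp add: split)
    also have "\<dots> \<le> \<bar>C\<bar> / x ^ M + (\<Sum>k\<in>{M..<M'}. norm (f k) / x ^ M)"
    proof (rule order.trans[OF norm_triangle_ineq add_mono])
      have "C / x ^ M' \<le> \<bar>C\<bar> / x ^ M'" using elim by (intro divide_right_mono) auto
      also have "\<dots> \<le> \<bar>C\<bar> / x ^ M" by (rule le) (auto simp: M'_def)
      finally show "norm (F x - (\<Sum>k<M'. f k / of_real x ^ k)) \<le> \<bar>C\<bar> / x ^ M" using elim by linarith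
      show "norm (\<Sum>k\<in>{M..<M'}. f k / of_real x ^ k) \<le> (\<Sum>k\<in>{M..<M'}. norm (f k) / x ^ M)"
        by (rule sum_norm_le) (use elim le in \<open>auto simp: norm_divide norm_power\<close>)
    qed
    finally show ?case by (simp add: D_def add_divide_distrib sum_divide_distrib)
  qed
  then show "\<exists>C. \<forall>\<^sub>F x in at_top. norm (F x - (\<Sum>k<M. f k / of_real x ^ k)) \<le> C / x ^ M" by blast
qed

lemma has_expansion_add:
  assumes "has_expansion F f" "has_expansion G g"
  shows "has_expansion (\<lambda>x. F x + G x) (\<lambda>k. f k + g k)"
  unfolding has_expansion_def
proof
  fix M
  obtain C D where "\<forall>\<^sub>F x in at_top. norm (F x - (\<Sum>k<M. f k / of_real x ^ k)) \<le> C / x ^ M"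
    "\<forall>\<^sub>F x in at_top. norm (G x - (\<Sum>k<M. g k / of_real x ^ k)) \<le> D / x ^ M"
    using assms unfolding has_expansion_def by blast
  then have "\<forall>\<^sub>F x in at_top. norm (F x + G x - (\<Sum>k<M. (f k + g k) / of_real x ^ k)) \<le> (C + D) / x ^ M"
  proof eventually_elim
    case (elim x)
    have eq: "F x + G x - (\<Sum>k<M. (f k + g k) / of_real x ^ k) = (F x - (\<Sum>k<M. f k / of_real x ^ k)) + (G x - (\<Sum>k<M. g k / of_real x ^ k))"
      by (simp add: add_divide_distrib sum.distrib)
    have "norm (F x + G x - (\<Sum>k<M. (f k + g k) / of_real x ^ k)) \<le> C / x ^ M + D / x ^ M"
      unfolding eq by (rule norm_triangle_mono[OF elim])
    then show ?case by (simp only: add_divide_distrib[of C D])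
  qed
  then show "\<exists>C. \<forall>\<^sub>F x in at_top. norm (F x + G x - (\<Sum>k<M. (f k + g k) / of_real x ^ k)) \<le> C / x ^ M" by blast
qed

lemma has_expansion_cmult:
  assumes "has_expansion F f"
  shows "has_expansion (\<lambda>x. c * F x) (\<lambda>k. c * f k)"
  unfolding has_expansion_def
proof
  fix M
  obtain C where "\<forall>\<^sub>F x in at_top. norm (F x - (\<Sum>k<M. f k / of_real x ^ k)) \<le> C / x ^ M"
    using assms unfolding has_expansion_def by blast
  then have "\<forall>\<^sub>F x in at_top. norm (c * F x - (\<Sum>k<M. c * f k / of_real x ^ k)) \<le> (norm c * C) / x ^ M"
  proof eventually_elim
    case (elim x)
    have "c * F x - (\<Sum>k<M. c * f k / of_real x ^ k) = c * (F x - (\<Sum>k<M. f k / of_real x ^ k))"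
      by (simp add: right_diff_distrib sum_distrib_left)
    then show ?case using mult_left_mono[OF elim, of "norm c"] by (simp add: norm_mult)
  qed
  then show "\<exists>C. \<forall>\<^sub>F x in at_top. norm (c * F x - (\<Sum>k<M. c * f k / of_real x ^ k)) \<le> C / x ^ M" by blast
qed

definition shift_coeff :: "(nat \<Rightarrow> complex) \<Rightarrow> nat \<Rightarrow> complex" where
  "shift_coeff f k = (case k of 0 \<Rightarrow> 0 | Suc j \<Rightarrow> f j)"

definition deriv_coeff :: "(nat \<Rightarrow> complex) \<Rightarrow> nat \<Rightarrow> complex" where
  "deriv_coeff f k = (case k of 0 \<Rightarrow> 0 | Suc j \<Rightarrow> - of_nat j * f j)"

lemma has_expansion_div:
  assumes "has_expansion F f"
  shows "has_expansion (\<lambda>x. F x / of_real x) (shift_coeff f)"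
proof (rule has_expansionI_large[of 1])
  fix M :: nat assume "M \<ge> 1"
  then obtain L where M: "M = Suc L" by (cases M) auto
  obtain C where "\<forall>\<^sub>F x in at_top. norm (F x - (\<Sum>k<L. f k / of_real x ^ k)) \<le> C / x ^ L"
    using assms unfolding has_expansion_def by blast
  then have "\<forall>\<^sub>F x in at_top. norm (F x / of_real x - (\<Sum>k<M. shift_coeff f k / of_real x ^ k)) \<le> C / x ^ M"
    using eventually_gt_at_top[of 0]
  proof eventually_elim
    case (elim x)
    have "F x / of_real x - (\<Sum>k<M. shift_coeff f k / of_real x ^ k) = (F x - (\<Sum>k<L. f k / of_real x ^ k)) / of_real x"
      unfolding M sum.lessThan_Suc_shift by (simp add: shift_coeff_def diff_divide_distrib sum_divide_distrib mult.commute)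
    then show ?case using divide_right_mono[OF elim(1), of x] elim(2) by (simp add: norm_divide M mult.commute)
  qed
  then show "\<exists>C. \<forall>\<^sub>F x in at_top. norm (F x / of_real x - (\<Sum>k<M. shift_coeff f k / of_real x ^ k)) \<le> C / x ^ M" by blast
qed

lemma has_expansion_tendsto:
  assumes "has_expansion F f"
  shows "(F \<longlongrightarrow> f 0) at_top"
proof -
  obtain C where C: "\<forall>\<^sub>F x in at_top. norm (F x - (\<Sum>k<1. f k / of_real x ^ k)) \<le> C / x ^ 1"
    using assms unfolding has_expansion_def by blast
  have "((\<lambda>x. F x - f 0) \<longlongrightarrow> 0) at_top"
  proof (rule Lim_null_comparison)
    show "\<forall>\<^sub>F x in at_top. norm (F x - f 0) \<le> C / x" using C by simp
    show "((\<lambda>x. C / x) \<longlongrightarrow> 0) at_top" by real_asymp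
  qed
  then show ?thesis by (simp add: LIM_zero_iff)
qed

text \<open>\<open>smooth_expansion n F f\<close>: the expansion of \<open>F\<close> may be differentiated term by term \<open>n\<close> times.\<close>

primrec smooth_expansion :: "nat \<Rightarrow> (real \<Rightarrow> complex) \<Rightarrow> (nat \<Rightarrow> complex) \<Rightarrow> bool" where
  "smooth_expansion 0 F f \<longleftrightarrow> has_expansion F f"
| "smooth_expansion (Suc n) F f \<longleftrightarrow> has_expansion F f \<and>
     (\<exists>F'. (\<forall>x>0. (F has_vector_derivative F' x) (at x)) \<and> smooth_expansion n F' (deriv_coeff f))"

lemma smooth_expansion_SucD: "smooth_expansion (Suc n) F f \<Longrightarrow> smooth_expansion n F f"
proof (induction n arbitrary: F f)
  case (Suc n)
  then show ?case by (metis smooth_expansion.simps(2))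
qed simp

lemma smooth_expansion_add:
  "smooth_expansion n F f \<Longrightarrow> smooth_expansion n G g \<Longrightarrow> smooth_expansion n (\<lambda>x. F x + G x) (\<lambda>k. f k + g k)"
proof (induction n arbitrary: F f G g)
  case (Suc n)
  then obtain F' G' where FG: "\<forall>x>0. (F has_vector_derivative F' x) (at x)" "smooth_expansion n F' (deriv_coeff f)"
    "\<forall>x>0. (G has_vector_derivative G' x) (at x)" "smooth_expansion n G' (deriv_coeff g)" by auto
  have "deriv_coeff (\<lambda>k. f k + g k) = (\<lambda>k. deriv_coeff f k + deriv_coeff g k)"
    by (auto simp: deriv_coeff_def fun_eq_iff algebra_simps split: nat.splits)
  then show ?case using Suc FG
    by (auto intro!: has_expansion_add exI[of _ "\<lambda>x. F' x + G' x"] has_vector_derivative_add)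
qed (simp add: has_expansion_add)

lemma smooth_expansion_cmult:
  "smooth_expansion n F f \<Longrightarrow> smooth_expansion n (\<lambda>x. c * F x) (\<lambda>k. c * f k)"
proof (induction n arbitrary: F f)
  case (Suc n)
  then obtain F' where F: "\<forall>x>0. (F has_vector_derivative F' x) (at x)" "smooth_expansion n F' (deriv_coeff f)" by auto
  have "deriv_coeff (\<lambda>k. c * f k) = (\<lambda>k. c * deriv_coeff f k)"
    by (auto simp: deriv_coeff_def fun_eq_iff split: nat.splits)
  then show ?case using Suc F
    by (auto intro!: has_expansion_cmult exI[of _ "\<lambda>x. c * F' x"] has_vector_derivative_mult_right)
qed (simp add: has_expansion_cmult)

lemma smooth_expansion_div:
  "smooth_expansion n F f \<Longrightarrow> smooth_expansion n (\<lambda>x. F x / of_real x) (shift_coeff f)"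
proof (induction n arbitrary: F f)
  case (Suc n)
  then obtain F' where F: "\<forall>x>0. (F has_vector_derivative F' x) (at x)" "smooth_expansion n F' (deriv_coeff f)" by auto
  let ?F1 = "\<lambda>x. F' x / of_real x + (-1) * (F x / of_real x / of_real x)"
  have "smooth_expansion n F f" using Suc.prems by (rule smooth_expansion_SucD)
  then have sm: "smooth_expansion n ?F1 (\<lambda>k. shift_coeff (deriv_coeff f) k + (-1) * shift_coeff (shift_coeff f) k)"
    by (intro smooth_expansion_add smooth_expansion_cmult Suc.IH F)
  have coeff: "(\<lambda>k. shift_coeff (deriv_coeff f) k + (-1) * shift_coeff (shift_coeff f) k) = deriv_coeff (shift_coeff f)"
    by (auto simp: deriv_coeff_def shift_coeff_def fun_eq_iff algebra_simps split: nat.splits)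
  have "((\<lambda>x. F x / of_real x) has_vector_derivative ?F1 x) (at x)" if x: "x > 0" for x
  proof -
    have "((\<lambda>x. inverse (complex_of_real x)) has_vector_derivative - (inverse (of_real x) ^ 2)) (at x)"
    proof -
      have "((\<lambda>z::complex. inverse z) has_field_derivative - (inverse (of_real x) ^ 2)) (at (of_real x))"
        using x by (auto intro!: derivative_eq_intros simp: power2_eq_square)
      then show ?thesis by (rule has_vector_derivative_real_field)
    qed
    from has_vector_derivative_mult[OF F(1)[rule_format, OF x] this] show ?thesis
      by (simp add: divide_inverse power2_eq_square algebra_simps)
  qed
  then show ?case
    unfolding smooth_expansion.simps using has_expansion_div Suc.prems sm[unfolded coeff]
    by (intro conjI exI[of _ ?F1]) auto
qed (simp add: has_expansion_div)

definition hankel_scaled :: "real \<Rightarrow> nat \<Rightarrow> real \<Rightarrow> complex" where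
  "hankel_scaled \<nu> j x = of_real (x powr (\<nu> + 1/2 + real j)) * hankel_integral \<nu> j x"

lemma has_expansion_hankel_scaled:
  assumes "\<nu> \<ge> 0"
  shows "has_expansion (hankel_scaled \<nu> j) (hankel_exp_coeff \<nu> j)"
proof (rule has_expansionI_large[of "nat \<lceil>\<nu>\<rceil>"])
  fix M assume "M \<ge> nat \<lceil>\<nu>\<rceil>"
  then have "\<nu> \<le> real M" by linarith
  from hankel_integral_watson[OF assms this, of j] obtain C where
    "\<And>x. x > 0 \<Longrightarrow> norm (hankel_scaled \<nu> j x - (\<Sum>k<M. hankel_exp_coeff \<nu> j k / of_real x ^ k)) \<le> C / x ^ M"
    unfolding hankel_scaled_def by blast
  then show "\<exists>C. \<forall>\<^sub>F x in at_top. norm (hankel_scaled \<nu> j x - (\<Sum>k<M. hankel_exp_coeff \<nu> j k / of_real x ^ k)) \<le> C / x ^ M"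
    by (intro exI[of _ C] eventually_mono[OF eventually_gt_at_top[of 0]]) auto
qed

lemma DERIV_of_real_powr:
  "x > 0 \<Longrightarrow> ((\<lambda>x. complex_of_real (x powr p)) has_vector_derivative of_real (p * x powr (p - 1))) (at x)"
  using has_real_derivative_powr[of x p]
  by (intro has_vector_derivative_of_real) (simp add: has_real_derivative_iff_has_vector_derivative)

text \<open>The derivative of a scaled transform is again a combination of scaled transforms,
  divided by x, so its expansion comes from Watson's lemma and not from the expansion being
  differentiated. That its coefficients are the formal ones is the identity Gamma (q + 1) = q Gamma
  q.\<close>

lemma smooth_expansion_hankel_scaled:
  assumes "\<nu> \<ge> 0"
  shows "smooth_expansion n (hankel_scaled \<nu> j) (hankel_exp_coeff \<nu> j)"
proof (induction n arbitrary: j)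
  case 0
  then show ?case using has_expansion_hankel_scaled[OF assms] by simp
next
  case (Suc n)
  define p where "p = \<nu> + 1/2 + real j"
  let ?F' = "\<lambda>x. (of_real p * hankel_scaled \<nu> j x + hankel_scaled \<nu> (Suc j) x) / of_real x"
  have "(hankel_scaled \<nu> j has_vector_derivative ?F' x) (at x)" if x: "x > 0" for x
  proof -
    have "\<nu> + 1/2 + real (Suc j) = p + 1" by (simp add: p_def)
    then have e: "x powr (p - 1) = x powr p / x" "x powr (\<nu> + 1/2 + real (Suc j)) = x powr p * x"
      using x by (simp_all add: powr_diff powr_add)
    show ?thesis
      unfolding hankel_scaled_def[abs_def] p_def[symmetric] e
      by (rule has_vector_derivative_eq_rhs[OF has_vector_derivative_mult[OF DERIV_of_real_powr[OF x] DERIV_hankel_integral[OF assms x]]])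
         (use x in \<open>simp add: e field_simps\<close>)
  qed
  moreover have "smooth_expansion n ?F' (shift_coeff (\<lambda>k. of_real p * hankel_exp_coeff \<nu> j k + hankel_exp_coeff \<nu> (Suc j) k))"
    by (intro smooth_expansion_div smooth_expansion_add smooth_expansion_cmult Suc.IH)
  moreover have "shift_coeff (\<lambda>k. of_real p * hankel_exp_coeff \<nu> j k + hankel_exp_coeff \<nu> (Suc j) k) = deriv_coeff (hankel_exp_coeff \<nu> j)"
  proof -
    have "of_real p * hankel_exp_coeff \<nu> j k + hankel_exp_coeff \<nu> (Suc j) k = - of_nat k * hankel_exp_coeff \<nu> j k" for k
    proof -
      define q where "q = \<nu> + 1/2 + real k + real j"
      have "q > 0" using assms by (simp add: q_def)
      then have "Gamma (q + 1) = q * Gamma q" by (intro Gamma_plus1) (auto elim!: nonpos_Ints_cases)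
      moreover have "\<nu> + 1/2 + real k + real (Suc j) = q + 1" by (simp add: q_def)
      ultimately have "hankel_exp_coeff \<nu> (Suc j) k = - of_real q * hankel_exp_coeff \<nu> j k"
        by (simp add: hankel_exp_coeff_def flip: q_def)
      then show ?thesis by (simp only:) (simp add: q_def p_def algebra_simps)
    qed
    then show ?thesis by (auto simp: shift_coeff_def deriv_coeff_def fun_eq_iff split: nat.splits)
  qed
  ultimately show ?case
    unfolding smooth_expansion.simps using has_expansion_hankel_scaled[OF assms]
    by (intro conjI exI[of _ ?F']) auto
qed

section \<open>The Bessel function as a multiple of the real part of a Hankel function\<close>

definition hankel_phase :: "real \<Rightarrow> complex" where
  "hankel_phase \<nu> = cis (- (\<nu> * pi / 2 + pi / 4))"

text \<open>By the classical integral representation this is the Hankel function H^(1) of order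
  \<nu> times sqrt (pi / 2) Gamma (\<nu> + 1/2).\<close>

definition hankel_fun :: "real \<Rightarrow> real \<Rightarrow> complex" where
  "hankel_fun \<nu> x = hankel_phase \<nu> * cis x * of_real (x powr \<nu>) * hankel_integral \<nu> 0 x"

definition hankel_fun' :: "real \<Rightarrow> real \<Rightarrow> complex" where
  "hankel_fun' \<nu> x = hankel_phase \<nu> * cis x * of_real (x powr \<nu>) *
     ((\<i> + of_real (\<nu> / x)) * hankel_integral \<nu> 0 x + hankel_integral \<nu> 1 x)"

lemma DERIV_cis: "(cis has_vector_derivative \<i> * cis x) (at x)"
proof -
  have "((\<lambda>z. exp (\<i> * z)) has_field_derivative \<i> * exp (\<i> * of_real x)) (at (of_real x))"
    by (auto intro!: derivative_eq_intros)
  from has_vector_derivative_real_field[OF this] show ?thesis by (simp add: cis_conv_exp[abs_def])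
qed

lemma DERIV_phase_powr:
  assumes "x > 0"
  shows "((\<lambda>x. c * cis x * of_real (x powr p)) has_vector_derivative c * cis x * of_real (x powr p) * (\<i> + of_real (p / x))) (at x)"
proof -
  have e: "x powr (p - 1) = x powr p / x" using assms by (simp add: powr_diff)
  show ?thesis
    by (rule has_vector_derivative_eq_rhs[OF has_vector_derivative_mult[OF has_vector_derivative_mult_right[OF DERIV_cis] DERIV_of_real_powr[OF assms]]])
       (simp only: e, simp add: algebra_simps divide_inverse)
qed

lemma DERIV_hankel_fun:
  assumes "\<nu> \<ge> 0" "x > 0"
  shows "(hankel_fun \<nu> has_vector_derivative hankel_fun' \<nu> x) (at x)"
  unfolding hankel_fun_def[abs_def] hankel_fun'_def
  by (rule has_vector_derivative_eq_rhs[OF has_vector_derivative_mult[OF DERIV_phase_powr[OF assms(2)] DERIV_hankel_integral[OF assms]]])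
     (simp add: algebra_simps)

lemma DERIV_hankel_fun':
  assumes "\<nu> \<ge> 0" "x > 0"
  shows "(hankel_fun' \<nu> has_vector_derivative - hankel_fun' \<nu> x / of_real x - of_real (1 - \<nu>\<^sup>2 / x\<^sup>2) * hankel_fun \<nu> x) (at x)"
proof -
  define h0 h1 h2 E where "h0 = hankel_integral \<nu> 0 x" and "h1 = hankel_integral \<nu> 1 x" and "h2 = hankel_integral \<nu> 2 x"
    and "E = hankel_phase \<nu> * cis x * of_real (x powr \<nu>)"
  have dq: "((\<lambda>x. \<i> + complex_of_real (\<nu> / x)) has_vector_derivative of_real (- \<nu> / x\<^sup>2)) (at x)"
  proof -
    have "((\<lambda>x. \<nu> / x) has_real_derivative - \<nu> / x\<^sup>2) (at x)"
      using assms by (auto intro!: derivative_eq_intros simp: power2_eq_square)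
    from has_vector_derivative_add[OF has_vector_derivative_const has_vector_derivative_of_real[OF this]]
    show ?thesis by (rule has_vector_derivative_eq_rhs) simp
  qed
  have "(hankel_fun' \<nu> has_vector_derivative
      E * ((\<i> + of_real (\<nu> / x)) * h1 + of_real (- \<nu> / x\<^sup>2) * h0 + h2)
      + E * (\<i> + of_real (\<nu> / x)) * ((\<i> + of_real (\<nu> / x)) * h0 + h1)) (at x)"
    unfolding hankel_fun'_def[abs_def] E_def h0_def h1_def h2_def
    using DERIV_hankel_integral[OF assms, of 0] DERIV_hankel_integral[OF assms, of 1]
    by (intro has_vector_derivative_mult DERIV_phase_powr assms has_vector_derivative_add dq)
       (simp_all add: numeral_2_eq_2)
  moreover have "E * ((\<i> + of_real (\<nu> / x)) * h1 + of_real (- \<nu> / x\<^sup>2) * h0 + h2)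
      + E * (\<i> + of_real (\<nu> / x)) * ((\<i> + of_real (\<nu> / x)) * h0 + h1)
     = - hankel_fun' \<nu> x / of_real x - of_real (1 - \<nu>\<^sup>2 / x\<^sup>2) * hankel_fun \<nu> x"
  proof -
    have ode: "of_real x * h2 + (of_real (2 * \<nu> + 1) + 2 * \<i> * of_real x) * h1 + \<i> * of_real (2 * \<nu> + 1) * h0 = 0"
      unfolding h0_def h1_def h2_def by (rule hankel_integral_ODE[OF assms])
    define X where "X = complex_of_real x"
    have X: "X \<noteq> 0" using assms by (simp add: X_def)
    have ode': "h2 = - ((of_real (2 * \<nu> + 1) + 2 * \<i> * X) * h1 + \<i> * of_real (2 * \<nu> + 1) * h0) / X"
      using ode X unfolding X_def[symmetric] by (simp add: field_simps add_eq_0_iff)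
    show ?thesis
      unfolding hankel_fun_def hankel_fun'_def E_def[symmetric] h0_def[symmetric] h1_def[symmetric] of_real_divide of_real_diff of_real_power X_def[symmetric] ode'
      using X by (simp add: field_simps power2_eq_square)
  qed
  ultimately show ?thesis by simp
qed

text \<open>Abel's identity: for y'' + y'/x + p y = 0 the Wronskian is a constant divided by
  x.\<close>

lemma wronskian_constant:
  fixes f f1 g g1 p :: "real \<Rightarrow> real"
  assumes "\<And>x. x > 0 \<Longrightarrow> (f has_real_derivative f1 x) (at x)"
    and "\<And>x. x > 0 \<Longrightarrow> (f1 has_real_derivative - f1 x / x - p x * f x) (at x)"
    and "\<And>x. x > 0 \<Longrightarrow> (g has_real_derivative g1 x) (at x)"
    and "\<And>x. x > 0 \<Longrightarrow> (g1 has_real_derivative - g1 x / x - p x * g x) (at x)"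
  shows "\<exists>C. \<forall>x>0. x * (f x * g1 x - f1 x * g x) = C"
proof -
  have "\<exists>C. \<forall>x\<in>{0<..}. x * (f x * g1 x - f1 x * g x) = C"
  proof (rule has_field_derivative_zero_constant)
    fix x :: real assume "x \<in> {0<..}"
    then have x: "x > 0" by simp
    have "((\<lambda>x. x * (f x * g1 x - f1 x * g x)) has_real_derivative 0) (at x)"
      by (rule DERIV_cong[OF DERIV_mult[OF DERIV_ident DERIV_diff[OF DERIV_mult[OF assms(1)[OF x] assms(4)[OF x]] DERIV_mult[OF assms(2)[OF x] assms(3)[OF x]]]]])
         (use x in \<open>simp add: field_simps\<close>)
    then show "((\<lambda>x. x * (f x * g1 x - f1 x * g x)) has_real_derivative 0) (at x within {0<..})"
      by (rule has_field_derivative_at_within)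
  qed (simp add: convex_real_interval)
  then show ?thesis by auto
qed

lemma DERIV_hankel_parts:
  assumes "\<nu> \<ge> 0" "x > 0"
  shows "((\<lambda>x. Re (hankel_fun \<nu> x)) has_real_derivative Re (hankel_fun' \<nu> x)) (at x)"
    and "((\<lambda>x. Im (hankel_fun \<nu> x)) has_real_derivative Im (hankel_fun' \<nu> x)) (at x)"
    and "((\<lambda>x. Re (hankel_fun' \<nu> x)) has_real_derivative - Re (hankel_fun' \<nu> x) / x - (1 - \<nu>\<^sup>2 / x\<^sup>2) * Re (hankel_fun \<nu> x)) (at x)"
    and "((\<lambda>x. Im (hankel_fun' \<nu> x)) has_real_derivative - Im (hankel_fun' \<nu> x) / x - (1 - \<nu>\<^sup>2 / x\<^sup>2) * Im (hankel_fun \<nu> x)) (at x)"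
proof -
  have parts: "Re (- hankel_fun' \<nu> x / of_real x - of_real (1 - \<nu>\<^sup>2 / x\<^sup>2) * hankel_fun \<nu> x) = - Re (hankel_fun' \<nu> x) / x - (1 - \<nu>\<^sup>2 / x\<^sup>2) * Re (hankel_fun \<nu> x)"
    "Im (- hankel_fun' \<nu> x / of_real x - of_real (1 - \<nu>\<^sup>2 / x\<^sup>2) * hankel_fun \<nu> x) = - Im (hankel_fun' \<nu> x) / x - (1 - \<nu>\<^sup>2 / x\<^sup>2) * Im (hankel_fun \<nu> x)"
    by (simp_all only: minus_complex.simps Re_divide_of_real Im_divide_of_real Re_complex_of_real times_complex.simps Im_complex_of_real uminus_complex.simps)
  show "((\<lambda>x. Re (hankel_fun \<nu> x)) has_real_derivative Re (hankel_fun' \<nu> x)) (at x)"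
    "((\<lambda>x. Im (hankel_fun \<nu> x)) has_real_derivative Im (hankel_fun' \<nu> x)) (at x)"
    unfolding has_real_derivative_iff_has_vector_derivative
    by (rule bounded_linear.has_vector_derivative[OF bounded_linear_Re DERIV_hankel_fun[OF assms]]
          bounded_linear.has_vector_derivative[OF bounded_linear_Im DERIV_hankel_fun[OF assms]])+
  show "((\<lambda>x. Re (hankel_fun' \<nu> x)) has_real_derivative - Re (hankel_fun' \<nu> x) / x - (1 - \<nu>\<^sup>2 / x\<^sup>2) * Re (hankel_fun \<nu> x)) (at x)"
    unfolding has_real_derivative_iff_has_vector_derivative parts(1)[symmetric]
    by (rule bounded_linear.has_vector_derivative[OF bounded_linear_Re DERIV_hankel_fun'[OF assms]])
  show "((\<lambda>x. Im (hankel_fun' \<nu> x)) has_real_derivative - Im (hankel_fun' \<nu> x) / x - (1 - \<nu>\<^sup>2 / x\<^sup>2) * Im (hankel_fun \<nu> x)) (at x)"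
    unfolding has_real_derivative_iff_has_vector_derivative parts(2)[symmetric]
    by (rule bounded_linear.has_vector_derivative[OF bounded_linear_Im DERIV_hankel_fun'[OF assms]])
qed

lemma hankel_fun_eq_scaled:
  assumes "x > 0"
  shows "hankel_fun \<nu> x = hankel_phase \<nu> * cis x * of_real (x powr (-1/2)) * hankel_scaled \<nu> 0 x"
    and "hankel_fun' \<nu> x = hankel_phase \<nu> * cis x * of_real (x powr (-1/2)) *
           ((\<i> + of_real (\<nu> / x)) * hankel_scaled \<nu> 0 x + hankel_scaled \<nu> 1 x / of_real x)"
proof -
  have "x powr (\<nu> + 1/2 + real 1) = x powr (\<nu> + 1/2) * x powr 1" by (subst powr_add[symmetric]) simp
  moreover have "x powr (\<nu> + 1/2) = x powr \<nu> * x powr (1/2)" by (rule powr_add)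
  moreover have "x powr (-1/2) * x powr (1/2) = 1" using assms by (subst powr_add[symmetric]) simp
  ultimately have e: "x powr (-1/2) * x powr (\<nu> + 1/2) = x powr \<nu>" "x powr (-1/2) * x powr (\<nu> + 1/2 + real 1) = x powr \<nu> * x"
    using assms by (simp_all add: field_simps)
  have s: "of_real (x powr (-1/2)) * hankel_scaled \<nu> 0 x = of_real (x powr \<nu>) * hankel_integral \<nu> 0 x"
    "of_real (x powr (-1/2)) * hankel_scaled \<nu> 1 x = of_real (x powr \<nu>) * of_real x * hankel_integral \<nu> 1 x"
  proof -
    have "of_real (x powr (-1/2)) * hankel_scaled \<nu> j x = of_real (x powr (-1/2) * x powr (\<nu> + 1/2 + real j)) * hankel_integral \<nu> j x" for j
      by (simp only: hankel_scaled_def of_real_mult mult.assoc)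
    from this[of 0] this[of 1] show "of_real (x powr (-1/2)) * hankel_scaled \<nu> 0 x = of_real (x powr \<nu>) * hankel_integral \<nu> 0 x"
      "of_real (x powr (-1/2)) * hankel_scaled \<nu> 1 x = of_real (x powr \<nu>) * of_real x * hankel_integral \<nu> 1 x"
      unfolding e(2) of_nat_0 add_0_right e(1) by (simp_all only: of_real_mult)
  qed
  show "hankel_fun \<nu> x = hankel_phase \<nu> * cis x * of_real (x powr (-1/2)) * hankel_scaled \<nu> 0 x"
    unfolding hankel_fun_def using s(1) by (simp add: mult.assoc)
  have "of_real (x powr (-1/2)) * ((\<i> + of_real (\<nu> / x)) * hankel_scaled \<nu> 0 x + hankel_scaled \<nu> 1 x / of_real x)
     = (\<i> + of_real (\<nu> / x)) * (of_real (x powr (-1/2)) * hankel_scaled \<nu> 0 x) + of_real (x powr (-1/2)) * hankel_scaled \<nu> 1 x / of_real x"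
    by (simp add: algebra_simps)
  also have "\<dots> = of_real (x powr \<nu>) * ((\<i> + of_real (\<nu> / x)) * hankel_integral \<nu> 0 x + hankel_integral \<nu> 1 x)"
    unfolding s using assms by (simp add: algebra_simps)
  finally show "hankel_fun' \<nu> x = hankel_phase \<nu> * cis x * of_real (x powr (-1/2)) *
           ((\<i> + of_real (\<nu> / x)) * hankel_scaled \<nu> 0 x + hankel_scaled \<nu> 1 x / of_real x)"
    unfolding hankel_fun'_def by (simp add: mult.assoc)
qed

lemma hankel_exp_coeff_0: "hankel_exp_coeff \<nu> 0 0 = of_real (Gamma (\<nu> + 1/2))"
  by (simp add: hankel_exp_coeff_def)

text \<open>Makes the real and imaginary parts a basis of solutions. The Wronskian is Im (cnj H H'),
  in which the phases cancel; its constant is read off at infinity from the leading coefficient and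
  equals Gamma (\<nu> + 1/2)^2.\<close>

lemma hankel_wronskian:
  assumes "\<nu> \<ge> 0"
  shows "\<exists>w. w \<noteq> 0 \<and> (\<forall>x>0. x * (Re (hankel_fun \<nu> x) * Im (hankel_fun' \<nu> x) - Re (hankel_fun' \<nu> x) * Im (hankel_fun \<nu> x)) = w)"
proof -
  obtain w where w: "\<forall>x>0. x * (Re (hankel_fun \<nu> x) * Im (hankel_fun' \<nu> x) - Re (hankel_fun' \<nu> x) * Im (hankel_fun \<nu> x)) = w"
    using wronskian_constant[OF DERIV_hankel_parts(1)[OF assms] DERIV_hankel_parts(3)[OF assms] DERIV_hankel_parts(2)[OF assms] DERIV_hankel_parts(4)[OF assms]]
    by blast
  define q where "q x = cnj (hankel_scaled \<nu> 0 x) * ((\<i> + of_real (\<nu> / x)) * hankel_scaled \<nu> 0 x + hankel_scaled \<nu> 1 x / of_real x)" for x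
  have eq: "Im (q x) = w" if x: "x > 0" for x
  proof -
    have pw: "x powr (-1/2) * x powr (-1/2) = 1 / x" using x by (subst powr_add[symmetric]) (simp add: powr_minus divide_simps)
    have unit: "cnj (hankel_phase \<nu> * cis x) * (hankel_phase \<nu> * cis x) = 1"
      by (simp add: hankel_phase_def cis_cnj cis_mult)
    have "cnj (hankel_fun \<nu> x) * hankel_fun' \<nu> x = (cnj (hankel_phase \<nu> * cis x) * (hankel_phase \<nu> * cis x)) * of_real (x powr (-1/2) * x powr (-1/2)) * q x"
      unfolding hankel_fun_eq_scaled[OF x] q_def by simp
    also have "\<dots> = q x / of_real x" unfolding unit pw by simp
    finally have "Im (cnj (hankel_fun \<nu> x) * hankel_fun' \<nu> x) = Im (q x) / x" by simp
    then show ?thesis using w x by (simp add: field_simps)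
  qed
  have lim: "(hankel_scaled \<nu> j \<longlongrightarrow> hankel_exp_coeff \<nu> j 0) at_top" for j
    by (rule has_expansion_tendsto[OF has_expansion_hankel_scaled[OF assms]])
  have l1: "((\<lambda>x. complex_of_real (\<nu> / x)) \<longlongrightarrow> of_real 0) at_top"
    by (intro tendsto_of_real) real_asymp
  have l2: "((\<lambda>x. 1 / complex_of_real x) \<longlongrightarrow> of_real 0) at_top"
  proof -
    have "((\<lambda>x. complex_of_real (1 / x)) \<longlongrightarrow> of_real 0) at_top" by (intro tendsto_of_real) real_asymp
    then show ?thesis by simp
  qed
  let ?G = "Gamma (\<nu> + 1/2)"
  have "((\<lambda>x. cnj (hankel_scaled \<nu> 0 x) * ((\<i> + of_real (\<nu> / x)) * hankel_scaled \<nu> 0 x + hankel_scaled \<nu> 1 x * (1 / of_real x)))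
     \<longlongrightarrow> cnj (of_real ?G) * ((\<i> + of_real 0) * of_real ?G + hankel_exp_coeff \<nu> 1 0 * of_real 0)) at_top"
    by (intro tendsto_mult tendsto_add tendsto_cnj tendsto_const l1 l2 lim[of 1] lim[of 0, unfolded hankel_exp_coeff_0])
  then have "(q \<longlongrightarrow> \<i> * of_real (?G * ?G)) at_top"
    by (simp add: q_def[abs_def] mult_ac)
  then have "((\<lambda>x. Im (q x)) \<longlongrightarrow> Im (\<i> * of_real (?G * ?G))) at_top" by (rule tendsto_Im)
  moreover have "\<forall>\<^sub>F x in at_top. Im (q x) = w" using eventually_gt_at_top[of 0] by eventually_elim (rule eq)
  ultimately have "w = Im (\<i> * of_real (?G * ?G))"
    by (intro tendsto_unique[OF trivial_limit_at_top_linorder tendsto_eventually])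
  then have "w = ?G * ?G" by simp
  moreover have "?G > 0" using assms by (intro Gamma_real_pos) auto
  ultimately show ?thesis using w by (intro exI[of _ w]) auto
qed

lemma Re_of_real_mult: "Re (complex_of_real u * z) = u * Re z"
  by simp

text \<open>In the basis Re H, Im H one has w J = U Re H - V Im H, with U and V the Wronskian
  constants of J against Im H and Re H. V is computed at 0 and vanishes; U is nonzero because the
  series of J has a nonzero constant term.\<close>

lemma bessel_J_eq_hankel:
  assumes \<nu>: "\<nu> \<ge> 0"
  shows "\<exists>\<kappa>. \<kappa> \<noteq> 0 \<and> (\<forall>x>0. bessel_J \<nu> x = \<kappa> * Re (hankel_fun \<nu> x))"
proof -
  define R R1 S S1 where "R x = Re (hankel_fun \<nu> x)" and "R1 x = Re (hankel_fun' \<nu> x)"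
    and "S x = Im (hankel_fun \<nu> x)" and "S1 x = Im (hankel_fun' \<nu> x)" for x
  define J J1 where "J x = bessel_J \<nu> x" and "J1 x = bessel_J_deriv \<nu> 1 x" for x
  obtain w where w: "w \<noteq> 0" "\<And>x. x > 0 \<Longrightarrow> x * (R x * S1 x - R1 x * S x) = w"
    using hankel_wronskian[OF \<nu>] unfolding R_def R1_def S_def S1_def by blast
  have dJ: "(bessel_J \<nu> has_real_derivative bessel_J_deriv \<nu> 1 x) (at x)" if "x > 0" for x
    using DERIV_bessel_J_deriv[OF \<nu> that, of 0] by (simp add: bessel_J_deriv_0)
  obtain V where V: "\<And>x. x > 0 \<Longrightarrow> x * (J x * R1 x - J1 x * R x) = V"
    using wronskian_constant[OF dJ bessel_ODE[OF \<nu>] DERIV_hankel_parts(1)[OF \<nu>] DERIV_hankel_parts(3)[OF \<nu>]]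
    unfolding J_def J1_def R_def R1_def by blast
  obtain U where U: "\<And>x. x > 0 \<Longrightarrow> x * (J x * S1 x - J1 x * S x) = U"
    using wronskian_constant[OF dJ bessel_ODE[OF \<nu>] DERIV_hankel_parts(2)[OF \<nu>] DERIV_hankel_parts(4)[OF \<nu>]]
    unfolding J_def J1_def S_def S1_def by blast
  have "V = 0"
  proof -
    define T where "T j x = of_real (x powr (2 * \<nu> + 1)) * hankel_integral \<nu> j x" for j x
    obtain r where T1: "((\<lambda>x. T 1 x) \<longlongrightarrow> of_real r * cis (pi / 2 * (\<nu> - 1/2))) (at_right 0)"
      using hankel_integral_small(2)[OF \<nu>] unfolding T_def by blast
    have T0: "((\<lambda>x. T 0 x) \<longlongrightarrow> 0) (at_right 0)"
      using hankel_integral_small(1)[OF \<nu>] unfolding T_def .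
    \<comment> \<open>The Wronskian of J and Re H, rewritten so that every factor has a limit at 0;
      the terms with \<nu> / x have cancelled.\<close>
    define v where "v x = bessel_series \<nu> 0 (x\<^sup>2) * Re (hankel_phase \<nu> * cis x * (\<i> * T 0 x + T 1 x))
       + x * (bessel_series (\<nu> + 1) 0 (x\<^sup>2) * Re (hankel_phase \<nu> * cis x * T 0 x))" for x
    have v: "v x = V" if x: "x > 0" for x
    proof -
      define E h0 h1 where "E = hankel_phase \<nu> * cis x" and "h0 = hankel_integral \<nu> 0 x" and "h1 = hankel_integral \<nu> 1 x"
      define P where "P = x powr \<nu>"
      have pw: "x powr (2 * \<nu> + 1) = P * P * x" "x powr (\<nu> + 1) = P * x"
      proof -
        have "2 * \<nu> + 1 = \<nu> + \<nu> + 1" by simp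
        then show "x powr (2 * \<nu> + 1) = P * P * x" "x powr (\<nu> + 1) = P * x"
          using x by (simp_all only: P_def powr_add powr_one abs_of_pos)
      qed
      have Re_of_real: "Re (E * of_real u * z) = u * Re (E * z)" for u z
      proof -
        have "E * of_real u * z = of_real u * (E * z)" by (simp add: mult_ac)
        then show ?thesis by (simp only: Re_of_real_mult)
      qed
      have Rx: "R x = P * Re (E * h0)"
        unfolding R_def hankel_fun_def E_def[symmetric] h0_def[symmetric] P_def[symmetric] by (rule Re_of_real)
      have R1x: "R1 x = P * Re (E * ((\<i> + of_real (\<nu> / x)) * h0 + h1))"
        unfolding R1_def hankel_fun'_def E_def[symmetric] h0_def[symmetric] h1_def[symmetric] P_def[symmetric] by (rule Re_of_real)
      have split: "Re (E * ((\<i> + of_real (\<nu> / x)) * h0 + h1)) = Re (E * (\<i> * h0 + h1)) + \<nu> / x * Re (E * h0)"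
      proof -
        have "E * ((\<i> + of_real (\<nu> / x)) * h0 + h1) = E * (\<i> * h0 + h1) + of_real (\<nu> / x) * (E * h0)" by (simp add: algebra_simps)
        then show ?thesis by (simp only: plus_complex.sel Re_of_real_mult)
      qed
      have Tx: "Re (E * (\<i> * T 0 x + T 1 x)) = P * P * x * Re (E * (\<i> * h0 + h1))" "Re (E * T 0 x) = P * P * x * Re (E * h0)"
      proof -
        have "E * (\<i> * T 0 x + T 1 x) = of_real (P * P * x) * (E * (\<i> * h0 + h1))" "E * T 0 x = of_real (P * P * x) * (E * h0)"
          unfolding T_def pw h0_def h1_def by (simp_all add: algebra_simps)
        then show "Re (E * (\<i> * T 0 x + T 1 x)) = P * P * x * Re (E * (\<i> * h0 + h1))" "Re (E * T 0 x) = P * P * x * Re (E * h0)"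
          by (simp_all only: Re_of_real_mult)
      qed
      have Jx: "J x = P * bessel_series \<nu> 0 (x\<^sup>2)" using bessel_J_eq[OF \<nu> x] by (simp add: J_def P_def)
      have "bessel_J (\<nu> + 1) x = P * x * bessel_series (\<nu> + 1) 0 (x\<^sup>2)" using bessel_J_eq[of "\<nu> + 1" x] \<nu> x by (simp add: pw)
      then have J1x: "J1 x = \<nu> / x * J x - P * x * bessel_series (\<nu> + 1) 0 (x\<^sup>2)"
        using bessel_J_deriv_1(1)[OF \<nu> x] by (simp add: J1_def J_def)
      have "x * (J x * R1 x - J1 x * R x) = v x"
        unfolding v_def E_def[symmetric] Tx J1x Jx R1x Rx split using x by (simp add: field_simps)
      then show ?thesis using V[OF x] by simp
    qed
    have cont: "((\<lambda>x. bessel_series \<mu> 0 (x\<^sup>2)) \<longlongrightarrow> bessel_series \<mu> 0 0) (at_right 0)" if "\<mu> \<ge> 0" for \<mu>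
    proof -
      have "isCont (bessel_series \<mu> 0) 0" using DERIV_bessel_series[OF that] by (rule DERIV_isCont)
      then have "(bessel_series \<mu> 0 \<longlongrightarrow> bessel_series \<mu> 0 0) (nhds 0)"
        by (simp add: isCont_def tendsto_nhds_iff)
      moreover have "filterlim (\<lambda>x::real. x\<^sup>2) (nhds 0) (at_right 0)" by (auto intro!: tendsto_eq_intros)
      ultimately show ?thesis by (rule filterlim_compose)
    qed
    have cis0: "(cis \<longlongrightarrow> cis 0) (at_right 0)" by (intro tendsto_intros)
    have "(v \<longlongrightarrow> bessel_series \<nu> 0 0 * Re (hankel_phase \<nu> * cis 0 * (\<i> * 0 + of_real r * cis (pi / 2 * (\<nu> - 1/2))))
       + 0 * (bessel_series (\<nu> + 1) 0 0 * Re (hankel_phase \<nu> * cis 0 * 0))) (at_right 0)"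
      unfolding v_def using T0 T1 \<nu> by (intro tendsto_intros cont cis0) auto
    \<comment> \<open>The rotation by \<open>hankel_phase\<close> is exactly the one that makes the
      limit purely imaginary, so that its real part vanishes.\<close>
    also have "hankel_phase \<nu> * cis 0 * (\<i> * 0 + of_real r * cis (pi / 2 * (\<nu> - 1/2))) = of_real r * cis (- (pi / 2))"
    proof -
      have "- (\<nu> * pi / 2 + pi / 4) + pi / 2 * (\<nu> - 1/2) = - (pi / 2)" by (simp add: algebra_simps)
      then show ?thesis by (simp add: hankel_phase_def cis_mult mult.left_commute)
    qed
    finally have "(v \<longlongrightarrow> 0) (at_right 0)" by (simp add: cis.code)
    moreover have "\<forall>\<^sub>F x in at_right 0. v x = V" using eventually_at_right_less[of 0] by eventually_elim (rule v)
    ultimately show "V = 0"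
      by (intro tendsto_unique[OF trivial_limit_at_right_real tendsto_eventually])
  qed
  have eq: "J x = U / w * R x" if x: "x > 0" for x
  proof -
    have "J x * w = x * (J x * (R x * S1 x - R1 x * S x))" using w(2)[OF x] by (simp add: mult_ac)
    also have "\<dots> = R x * (x * (J x * S1 x - J1 x * S x)) - S x * (x * (J x * R1 x - J1 x * R x))" by (simp add: algebra_simps)
    also have "\<dots> = R x * U" using U[OF x] V[OF x] \<open>V = 0\<close> by simp
    finally show ?thesis using w(1) by (simp add: field_simps)
  qed
  have "U \<noteq> 0"
  proof
    assume "U = 0"
    then have "bessel_series \<nu> 0 (x\<^sup>2) = 0" if "x > 0" for x
      using eq[OF that] bessel_J_eq[OF \<nu> that] that by (simp add: J_def)
    then have ev: "\<forall>\<^sub>F x in at_right 0. bessel_series \<nu> 0 (x\<^sup>2) = 0"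
      using eventually_at_right_less[of "0::real"] by (auto elim: eventually_mono)
    have "isCont (bessel_series \<nu> 0) 0" using DERIV_bessel_series[OF \<nu>] by (rule DERIV_isCont)
    then have "(bessel_series \<nu> 0 \<longlongrightarrow> bessel_series \<nu> 0 0) (nhds 0)"
      by (simp add: isCont_def tendsto_nhds_iff)
    moreover have "filterlim (\<lambda>x::real. x\<^sup>2) (nhds 0) (at_right 0)" by (auto intro!: tendsto_eq_intros)
    ultimately have "((\<lambda>x. bessel_series \<nu> 0 (x\<^sup>2)) \<longlongrightarrow> bessel_series \<nu> 0 0) (at_right 0)" by (rule filterlim_compose)
    then have "bessel_series \<nu> 0 0 = 0"
      using ev by (intro tendsto_unique[OF trivial_limit_at_right_real _ tendsto_eventually])
    then show False using rGamma_nat_shift_bounds(1)[OF \<nu>, of 0] by (simp add: bessel_series_0 bessel_coeff_def)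
  qed
  then show ?thesis using eq w(1) by (intro exI[of _ "U / w"]) (auto simp: J_def R_def)
qed

text \<open>At a double zero Re H and its derivative would both vanish, against the nonzero
  Wronskian.\<close>

lemma bessel_J_simple_zero:
  assumes \<nu>: "\<nu> \<ge> 0" and x: "x > 0" and z: "bessel_J \<nu> x = 0"
  shows "bessel_J_deriv \<nu> 1 x \<noteq> 0"
proof
  assume d: "bessel_J_deriv \<nu> 1 x = 0"
  obtain \<kappa> where \<kappa>: "\<kappa> \<noteq> 0" "\<And>x. x > 0 \<Longrightarrow> bessel_J \<nu> x = \<kappa> * Re (hankel_fun \<nu> x)"
    using bessel_J_eq_hankel[OF \<nu>] by blast
  obtain w where w: "w \<noteq> 0" "x * (Re (hankel_fun \<nu> x) * Im (hankel_fun' \<nu> x) - Re (hankel_fun' \<nu> x) * Im (hankel_fun \<nu> x)) = w"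
    using hankel_wronskian[OF \<nu>] x by blast
  have "((\<lambda>x. \<kappa> * Re (hankel_fun \<nu> x)) has_real_derivative \<kappa> * Re (hankel_fun' \<nu> x)) (at x)"
    by (intro DERIV_cmult DERIV_hankel_parts assms)
  then have "(bessel_J \<nu> has_real_derivative \<kappa> * Re (hankel_fun' \<nu> x)) (at x)"
    by (rule has_field_derivative_transform_within_open[of _ _ _ "{0<..}"]) (use x \<kappa>(2) in auto)
  then have "\<kappa> * Re (hankel_fun' \<nu> x) = 0"
    using DERIV_unique[OF _ DERIV_bessel_J_deriv[OF \<nu> x, of 0, unfolded bessel_J_deriv_0]] d by simp
  then show False using z \<kappa> w x by auto
qed

text \<open>The amplitude of the N-th derivative has coefficients i^(N + k) times these real
  numbers. Differentiating e^(i x) x^(-1/2 - j) gives a factor i and a term with factor -(2 j + 1)/2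
  one power lower; for k = j + 1 the minus sign goes into i^2 and (2 k - 1)/2 remains.\<close>

primrec bessel_deriv_exp_coeff :: "real \<Rightarrow> nat \<Rightarrow> nat \<Rightarrow> real" where
  "bessel_deriv_exp_coeff \<nu> 0 k = hankel_A \<nu> k"
| "bessel_deriv_exp_coeff \<nu> (Suc N) k = bessel_deriv_exp_coeff \<nu> N k
     + (if k = 0 then 0 else (2 * real k - 1) / 2 * bessel_deriv_exp_coeff \<nu> N (k - 1))"

text \<open>Ratio of consecutive coefficients: the binomial contributes \<nu> - 1/2 - k and the
  Gamma value \<nu> + 1/2 + k, with product (4 \<nu>^2 - (2 k + 1)^2) / 4.\<close>

lemma hankel_exp_coeff_eq_hankel_A:
  assumes "\<nu> \<ge> 0"
  shows "hankel_exp_coeff \<nu> 0 k = of_real (Gamma (\<nu> + 1/2)) * (\<i> ^ k * of_real (hankel_A \<nu> k))"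
proof (induction k)
  case 0
  show ?case by (simp add: hankel_exp_coeff_def hankel_A_def)
next
  case (Suc k)
  define a where "a = complex_of_real (\<nu> - 1/2)"
  define q where "q = \<nu> + 1/2 + real k"
  have "q > 0" using assms by (simp add: q_def)
  then have G: "Gamma (\<nu> + 1/2 + real (Suc k)) = q * Gamma q"
  proof -
    have "q \<notin> \<int>\<^sub>\<le>\<^sub>0" using \<open>q > 0\<close> by (auto elim!: nonpos_Ints_cases)
    then have "Gamma (q + 1) = q * Gamma q" by (rule Gamma_plus1)
    moreover have "\<nu> + 1/2 + real (Suc k) = q + 1" by (simp add: q_def)
    ultimately show ?thesis by metis
  qed
  have gb: "a gchoose Suc k = (a gchoose k) * (a - of_nat k) / of_nat (Suc k)"
  proof -
    have "of_nat (Suc k) * (a gchoose Suc k) = (a - of_nat k) * (a gchoose k)"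
      using gbinomial_mult_1[of a k] by (simp add: left_diff_distrib del: of_nat_Suc)
    then show ?thesis by (simp add: nonzero_eq_divide_eq mult.commute del: of_nat_Suc)
  qed
  have aq: "a - of_nat k = of_real (\<nu> - 1/2 - real k)" by (simp add: a_def)
  have "hankel_exp_coeff \<nu> 0 (Suc k) = (a gchoose k) * of_real (\<nu> - 1/2 - real k) / of_nat (Suc k) * ((\<i> / 2) ^ k * (\<i> / 2)) * of_real (q * Gamma q)"
    unfolding hankel_exp_coeff_def a_def[symmetric] gb of_nat_0 add_0_right G aq by simp
  also have "\<dots> = ((a gchoose k) * (\<i> / 2) ^ k * of_real (Gamma q)) * (\<i> * (of_real ((\<nu> - 1/2 - real k) * q) / (2 * of_nat (Suc k))))"
    unfolding of_real_mult by (simp only: times_divide_eq_left times_divide_eq_right divide_divide_eq_left mult_ac)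
  also have "(a gchoose k) * (\<i> / 2) ^ k * of_real (Gamma q) = hankel_exp_coeff \<nu> 0 k"
    by (simp add: hankel_exp_coeff_def a_def q_def)
  also have "(\<nu> - 1/2 - real k) * q = (4 * \<nu>\<^sup>2 - (2 * real (Suc k) - 1)\<^sup>2) / 4"
    by (simp add: q_def power2_eq_square field_simps)
  finally have "hankel_exp_coeff \<nu> 0 (Suc k) = hankel_exp_coeff \<nu> 0 k * (\<i> * of_real ((4 * \<nu>\<^sup>2 - (2 * real (Suc k) - 1)\<^sup>2) / (8 * real (Suc k))))"
    by (simp del: of_nat_Suc)
  moreover have "hankel_A \<nu> (Suc k) = hankel_A \<nu> k * ((4 * \<nu>\<^sup>2 - (2 * real (Suc k) - 1)\<^sup>2) / (8 * real (Suc k)))"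
    by (simp add: hankel_A_def prod.nat_ivl_Suc' mult_ac del: of_nat_Suc)
  ultimately show ?case unfolding Suc by (simp del: of_nat_Suc)
qed

text \<open>Each derivative of J uses up one order of smoothness of the amplitude, so the induction
  on N keeps n arbitrary. A single \<kappa> serves all N, which makes a derivative and its successor
  comparable in the search for zeros.\<close>

lemma bessel_J_deriv_expansion:
  assumes \<nu>: "\<nu> \<ge> 0"
  shows "\<exists>\<kappa>. \<kappa> \<noteq> 0 \<and> (\<forall>N n. \<exists>Z. smooth_expansion n Z (\<lambda>k. \<i> ^ (N + k) * of_real (bessel_deriv_exp_coeff \<nu> N k)) \<and>
     (\<forall>x>0. bessel_J_deriv \<nu> N x = \<kappa> * Re (hankel_phase \<nu> * cis x * of_real (x powr (-1/2)) * Z x)))"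
proof -
  let ?z = "\<lambda>N k. \<i> ^ (N + k) * complex_of_real (bessel_deriv_exp_coeff \<nu> N k)"
  define G where "G = Gamma (\<nu> + 1/2)"
  have G: "G > 0" unfolding G_def using \<nu> by (intro Gamma_real_pos) auto
  obtain \<kappa> where \<kappa>: "\<kappa> \<noteq> 0" "\<And>x. x > 0 \<Longrightarrow> bessel_J \<nu> x = \<kappa> * Re (hankel_fun \<nu> x)"
    using bessel_J_eq_hankel[OF \<nu>] by blast
  have "\<exists>Z. smooth_expansion n Z (?z N) \<and>
     (\<forall>x>0. bessel_J_deriv \<nu> N x = (\<kappa> * G) * Re (hankel_phase \<nu> * cis x * of_real (x powr (-1/2)) * Z x))" for N n
  proof (induction N arbitrary: n)
    case 0
    define Z where "Z x = of_real (1 / G) * hankel_scaled \<nu> 0 x" for x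
    have "smooth_expansion n Z (\<lambda>k. of_real (1 / G) * hankel_exp_coeff \<nu> 0 k)"
      unfolding Z_def by (intro smooth_expansion_cmult smooth_expansion_hankel_scaled \<nu>)
    also have "(\<lambda>k. of_real (1 / G) * hankel_exp_coeff \<nu> 0 k) = ?z 0"
      using G by (simp add: hankel_exp_coeff_eq_hankel_A[OF \<nu>] G_def)
    finally have "smooth_expansion n Z (?z 0)" .
    moreover have "bessel_J_deriv \<nu> 0 x = (\<kappa> * G) * Re (hankel_phase \<nu> * cis x * of_real (x powr (-1/2)) * Z x)" if "x > 0" for x
    proof -
      have "hankel_fun \<nu> x = of_real G * (hankel_phase \<nu> * cis x * of_real (x powr (-1/2)) * Z x)"
        using G by (simp add: hankel_fun_eq_scaled[OF that] Z_def)
      then show ?thesis using \<kappa>(2)[OF that] by (simp add: bessel_J_deriv_0)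
    qed
    ultimately show ?case by blast
  next
    case (Suc N)
    obtain Z where Z: "smooth_expansion (Suc n) Z (?z N)"
      "\<And>x. x > 0 \<Longrightarrow> bessel_J_deriv \<nu> N x = (\<kappa> * G) * Re (hankel_phase \<nu> * cis x * of_real (x powr (-1/2)) * Z x)"
      using Suc[of "Suc n"] by blast
    obtain Z' where Z': "\<And>x. x > 0 \<Longrightarrow> (Z has_vector_derivative Z' x) (at x)" "smooth_expansion n Z' (deriv_coeff (?z N))"
      using Z(1) by auto
    \<comment> \<open>Amplitude of the derivative: e^(i x) x^(-1/2) Z has derivative e^(i x)
      x^(-1/2) (Z' + i Z - Z / (2 x)).\<close>
    define Y where "Y x = (Z' x + \<i> * Z x) + (-1/2) * (Z x / of_real x)" for x
    have smZ: "smooth_expansion n Z (?z N)" using Z(1) by (rule smooth_expansion_SucD)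
    have "smooth_expansion n Y (\<lambda>k. (deriv_coeff (?z N) k + \<i> * ?z N k) + (-1/2) * shift_coeff (?z N) k)"
      unfolding Y_def by (intro smooth_expansion_add smooth_expansion_cmult smooth_expansion_div smZ Z')
    also have "(\<lambda>k. (deriv_coeff (?z N) k + \<i> * ?z N k) + (-1/2) * shift_coeff (?z N) k) = ?z (Suc N)"
    proof
      fix k
      show "(deriv_coeff (?z N) k + \<i> * ?z N k) + (-1/2) * shift_coeff (?z N) k = ?z (Suc N) k"
      proof (cases k)
        case (Suc j)
        have "\<i> ^ (Suc N + Suc j) = - (\<i> ^ (N + j))" by simp
        then show ?thesis unfolding Suc
          by (simp add: deriv_coeff_def shift_coeff_def) (simp add: field_simps)
      qed (simp add: deriv_coeff_def shift_coeff_def)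
    qed
    finally have "smooth_expansion n Y (?z (Suc N))" .
    moreover have "bessel_J_deriv \<nu> (Suc N) x = (\<kappa> * G) * Re (hankel_phase \<nu> * cis x * of_real (x powr (-1/2)) * Y x)" if x: "x > 0" for x
    proof -
      have "((\<lambda>x. hankel_phase \<nu> * cis x * of_real (x powr (-1/2)) * Z x) has_vector_derivative
          hankel_phase \<nu> * cis x * of_real (x powr (-1/2)) * Y x) (at x)"
        by (rule has_vector_derivative_eq_rhs[OF has_vector_derivative_mult[OF DERIV_phase_powr[OF x] Z'(1)[OF x]]])
           (use x in \<open>simp add: Y_def algebra_simps\<close>)
      from bounded_linear.has_vector_derivative[OF bounded_linear_Re this]
      have "((\<lambda>x. (\<kappa> * G) * Re (hankel_phase \<nu> * cis x * of_real (x powr (-1/2)) * Z x)) has_real_derivative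
          (\<kappa> * G) * Re (hankel_phase \<nu> * cis x * of_real (x powr (-1/2)) * Y x)) (at x)"
        by (intro DERIV_cmult) (simp only: has_real_derivative_iff_has_vector_derivative)
      then have "(bessel_J_deriv \<nu> N has_real_derivative (\<kappa> * G) * Re (hankel_phase \<nu> * cis x * of_real (x powr (-1/2)) * Y x)) (at x)"
        by (rule has_field_derivative_transform_within_open[of _ _ _ "{0<..}"]) (use x Z(2) in auto)
      then show ?thesis by (rule DERIV_unique[OF DERIV_bessel_J_deriv[OF \<nu> x]])
    qed
    ultimately show ?case by blast
  qed
  then show ?thesis using \<kappa>(1) G by (intro exI[of _ "\<kappa> * G"]) auto
qed

section \<open>Counting zeros\<close>

definition zeros_upto :: "(real \<Rightarrow> real) \<Rightarrow> real \<Rightarrow> real set" where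
  "zeros_upto f X = {y. 0 < y \<and> y \<le> X \<and> f y = 0}"

text \<open>The count strictly increases at every zero, so it identifies the zero and the
  description in \<open>kth_positive_zero\<close> has a unique solution.\<close>

lemma kth_positive_zero_eq:
  assumes "\<And>X. finite (zeros_upto f X)" "0 < x" "f x = 0"
  shows "kth_positive_zero f (card (zeros_upto f x)) = x"
proof -
  have lt: "card (zeros_upto f y) < card (zeros_upto f z)" if "y < z" "0 < z" "f z = 0" for y z
  proof (intro psubset_card_mono assms(1) psubsetI)
    show "zeros_upto f y \<subseteq> zeros_upto f z" using that(1) by (auto simp: zeros_upto_def)
    have "z \<in> zeros_upto f z" "z \<notin> zeros_upto f y" using that by (auto simp: zeros_upto_def)
    then show "zeros_upto f y \<noteq> zeros_upto f z" by blast
  qed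
  show ?thesis
    unfolding kth_positive_zero_def zeros_upto_def[symmetric]
  proof (rule the_equality)
    fix y assume "0 < y \<and> f y = 0 \<and> finite (zeros_upto f y) \<and> card (zeros_upto f y) = card (zeros_upto f x)"
    then have "\<not> x < y" "\<not> y < x" using lt[of x y] lt[of y x] assms(2,3) by auto
    then show "y = x" by simp
  qed (use assms in auto)
qed

lemma card_zeros_upto_le:
  assumes fin: "finite (zeros_upto g X)"
    and sep: "\<And>a b. 0 < a \<Longrightarrow> a < b \<Longrightarrow> f a = 0 \<Longrightarrow> f b = 0 \<Longrightarrow> \<exists>c. a < c \<and> c \<le> b \<and> g c = 0"
  shows "finite (zeros_upto f X) \<and> card (zeros_upto f X) \<le> card (zeros_upto g X) + 1"
    and "(\<And>b. 0 < b \<Longrightarrow> f b = 0 \<Longrightarrow> \<exists>c. 0 < c \<and> c \<le> b \<and> g c = 0) \<Longrightarrow>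
           finite (zeros_upto f X) \<and> card (zeros_upto f X) \<le> card (zeros_upto g X)"
proof -
  have *: "\<exists>c\<in>zeros_upto g X. a < c \<and> c \<le> b" if "a \<in> zeros_upto f X" "b \<in> zeros_upto f X" "a < b" for a b
  proof -
    from that sep[of a b] obtain c where "a < c" "c \<le> b" "g c = 0" by (auto simp: zeros_upto_def)
    then show ?thesis using that by (intro bexI[of _ c]) (auto simp: zeros_upto_def)
  qed
  show "finite (zeros_upto f X) \<and> card (zeros_upto f X) \<le> card (zeros_upto g X) + 1"
    by (rule card_le_Suc_of_separated[OF fin *])
  assume below: "\<And>b. 0 < b \<Longrightarrow> f b = 0 \<Longrightarrow> \<exists>c. 0 < c \<and> c \<le> b \<and> g c = 0"
  have "\<exists>c\<in>zeros_upto g X. c \<le> b" if b: "b \<in> zeros_upto f X" for b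
  proof -
    from b below[of b] obtain c where "0 < c" "c \<le> b" "g c = 0" by (auto simp: zeros_upto_def)
    then show ?thesis using b by (intro bexI[of _ c]) (auto simp: zeros_upto_def)
  qed
  then show "finite (zeros_upto f X) \<and> card (zeros_upto f X) \<le> card (zeros_upto g X)"
    by (intro card_le_of_separated[OF fin *])
qed

text \<open>\<open>has_offset f \<beta> e\<close>: far out, \<open>f\<close> has its zeros near the points \<open>k\<pi> + \<beta>\<close>, and the zero near
  \<open>k\<pi> + \<beta>\<close> is zero number \<open>k + e\<close>.\<close>

definition has_offset :: "(real \<Rightarrow> real) \<Rightarrow> real \<Rightarrow> int \<Rightarrow> bool" where
  "has_offset f \<beta> e \<longleftrightarrow> (\<forall>\<^sub>F k in sequentially. \<forall>s. pi / 4 \<le> s \<longrightarrow> s \<le> 3 * pi / 4 \<longrightarrow>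
     int (card (zeros_upto f (real k * pi + \<beta> + s))) = int k + e)"

text \<open>The windows are half-open of length pi, so consecutive ones tile the line and no zero is
  counted twice.\<close>

definition window_zero :: "(real \<Rightarrow> real) \<Rightarrow> real \<Rightarrow> nat \<Rightarrow> real \<Rightarrow> bool" where
  "window_zero f \<beta> k z \<longleftrightarrow> 0 < real k * pi + \<beta> - pi / 2 \<and> \<bar>z - (real k * pi + \<beta>)\<bar> < pi / 4 \<and>
     {x. real k * pi + \<beta> - pi / 2 < x \<and> x \<le> real k * pi + \<beta> + pi / 2 \<and> f x = 0} = {z}"

lemma window_zeroD:
  assumes "window_zero f \<beta> k z"
  shows "f z = 0" "0 < z" "real k * pi + \<beta> - pi / 4 < z" "z < real k * pi + \<beta> + pi / 4"
    and "real k * pi + \<beta> - pi / 2 < x \<Longrightarrow> x \<le> real k * pi + \<beta> + pi / 2 \<Longrightarrow> f x = 0 \<Longrightarrow> x = z"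
proof -
  have "z \<in> {x. real k * pi + \<beta> - pi / 2 < x \<and> x \<le> real k * pi + \<beta> + pi / 2 \<and> f x = 0}"
    using assms unfolding window_zero_def by auto
  then show "f z = 0" "0 < z" using assms by (auto simp: window_zero_def)
  have "\<bar>z - (real k * pi + \<beta>)\<bar> < pi / 4" using assms by (simp add: window_zero_def)
  then show "real k * pi + \<beta> - pi / 4 < z" "z < real k * pi + \<beta> + pi / 4" unfolding abs_less_iff by linarith+
  show "real k * pi + \<beta> - pi / 2 < x \<Longrightarrow> x \<le> real k * pi + \<beta> + pi / 2 \<Longrightarrow> f x = 0 \<Longrightarrow> x = z"
    using assms unfolding window_zero_def by blast
qed

text \<open>From some K on every window contributes exactly one zero, so the count up to the end of
  window k, minus k, is constant. As the zeros stay within pi/4 of the grid points, the count is the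
  same from pi/4 to 3 pi/4 behind a grid point.\<close>

lemma has_offset_exists:
  assumes fin: "\<And>X. finite (zeros_upto f X)"
    and win: "\<forall>\<^sub>F k in sequentially. window_zero f \<beta> k (z k)"
  shows "\<exists>e. has_offset f \<beta> e \<and> (\<forall>\<^sub>F k in sequentially. int (card (zeros_upto f (z k))) = int k + e)"
proof -
  obtain K where K: "\<And>k. k \<ge> K \<Longrightarrow> window_zero f \<beta> k (z k)"
    using win unfolding eventually_sequentially by blast
  define c where "c k = int (card (zeros_upto f (real k * pi + \<beta> + pi / 2)))" for k
  define e where "e = c K - int K"
  have eqk: "real (Suc k) * pi = real k * pi + pi" for k by (simp add: algebra_simps)
  have c: "c k = int k + e" if "k \<ge> K" for k
    using that
  proof (induction k rule: dec_induct)
    case (step k)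
    have w: "window_zero f \<beta> (Suc k) (z (Suc k))" using step by (intro K) auto
    note zd = window_zeroD(1,2,3,4)[OF w, unfolded eqk] window_zeroD(5)[OF w, unfolded eqk]
    have "zeros_upto f (real (Suc k) * pi + \<beta> + pi / 2) = insert (z (Suc k)) (zeros_upto f (real k * pi + \<beta> + pi / 2))"
      unfolding zeros_upto_def eqk
    proof (intro set_eqI iffI)
      fix x assume x: "x \<in> {y. 0 < y \<and> y \<le> real k * pi + pi + \<beta> + pi / 2 \<and> f y = 0}"
      show "x \<in> insert (z (Suc k)) {y. 0 < y \<and> y \<le> real k * pi + \<beta> + pi / 2 \<and> f y = 0}"
      proof (cases "x \<le> real k * pi + \<beta> + pi / 2")
        case False
        then have "x = z (Suc k)" using x by (intro zd(5)) simp_all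
        then show ?thesis by simp
      qed (use x in simp)
    next
      fix x assume "x \<in> insert (z (Suc k)) {y. 0 < y \<and> y \<le> real k * pi + \<beta> + pi / 2 \<and> f y = 0}"
      then show "x \<in> {y. 0 < y \<and> y \<le> real k * pi + pi + \<beta> + pi / 2 \<and> f y = 0}"
      proof
        assume "x = z (Suc k)"
        moreover have "z (Suc k) \<le> real k * pi + pi + \<beta> + pi / 2" using zd(4) pi_gt_zero by linarith
        ultimately show ?thesis using zd(1,2) by simp
      next
        assume "x \<in> {y. 0 < y \<and> y \<le> real k * pi + \<beta> + pi / 2 \<and> f y = 0}"
        moreover from this have "x \<le> real k * pi + pi + \<beta> + pi / 2" using pi_gt_zero unfolding mem_Collect_eq by linarith
        ultimately show ?thesis by simp
      qed
    qed
    moreover have "z (Suc k) \<notin> zeros_upto f (real k * pi + \<beta> + pi / 2)"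
    proof -
      have "\<not> z (Suc k) \<le> real k * pi + \<beta> + pi / 2" using zd(3) pi_gt_zero by linarith
      then show ?thesis by (simp add: zeros_upto_def)
    qed
    ultimately show ?case using step.IH fin by (simp add: c_def)
  qed (simp add: e_def)
  have off: "int (card (zeros_upto f (real k * pi + \<beta> + s))) = int k + e" if k: "k \<ge> K" and s: "pi / 4 \<le> s" "s \<le> 3 * pi / 4" for k s
  proof -
    have w: "window_zero f \<beta> k (z k)" "window_zero f \<beta> (Suc k) (z (Suc k))" using k by (intro K; simp)+
    note w1 = window_zeroD[OF w(1)] and w2 = window_zeroD(1,2,3,4)[OF w(2), unfolded eqk] window_zeroD(5)[OF w(2), unfolded eqk]
    have "zeros_upto f (real k * pi + \<beta> + s) = zeros_upto f (real k * pi + \<beta> + pi / 2)"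
    proof (intro set_eqI iffI)
      fix x assume x: "x \<in> zeros_upto f (real k * pi + \<beta> + s)"
      show "x \<in> zeros_upto f (real k * pi + \<beta> + pi / 2)"
      proof (rule ccontr)
        assume "x \<notin> zeros_upto f (real k * pi + \<beta> + pi / 2)"
        then have gt: "x > real k * pi + \<beta> + pi / 2" using x by (auto simp: zeros_upto_def)
        have le: "x \<le> real k * pi + \<beta> + s" "f x = 0" using x by (simp_all add: zeros_upto_def)
        have "x = z (Suc k)" using gt le s pi_gt_zero by (intro w2(5)) linarith+
        then show False using w2(3) le s by linarith
      qed
    next
      fix x assume x: "x \<in> zeros_upto f (real k * pi + \<beta> + pi / 2)"
      show "x \<in> zeros_upto f (real k * pi + \<beta> + s)"
      proof (rule ccontr)
        assume "x \<notin> zeros_upto f (real k * pi + \<beta> + s)"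
        then have gt: "x > real k * pi + \<beta> + s" using x by (auto simp: zeros_upto_def)
        have le: "x \<le> real k * pi + \<beta> + pi / 2" "f x = 0" using x by (simp_all add: zeros_upto_def)
        have "x = z k" using gt le s pi_gt_zero by (intro w1(5)) linarith+
        then show False using w1(4) gt s by linarith
      qed
    qed
    then show ?thesis using c[OF k] by (simp add: c_def)
  qed
  have "int (card (zeros_upto f (z k))) = int k + e" if k: "k \<ge> K" for k
  proof -
    note w1 = window_zeroD[OF K[OF k]]
    have "zeros_upto f (z k) = zeros_upto f (real k * pi + \<beta> + pi / 2)"
    proof (intro set_eqI iffI)
      fix x assume "x \<in> zeros_upto f (z k)"
      then have "0 < x" "x \<le> z k" "f x = 0" by (simp_all add: zeros_upto_def)
      moreover from this(2) have "x \<le> real k * pi + \<beta> + pi / 2" using w1(4) pi_gt_zero by linarith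
      ultimately show "x \<in> zeros_upto f (real k * pi + \<beta> + pi / 2)" by (simp add: zeros_upto_def)
    next
      fix x assume x: "x \<in> zeros_upto f (real k * pi + \<beta> + pi / 2)"
      show "x \<in> zeros_upto f (z k)"
      proof (rule ccontr)
        assume "x \<notin> zeros_upto f (z k)"
        then have gt: "x > z k" using x by (auto simp: zeros_upto_def)
        have le: "x \<le> real k * pi + \<beta> + pi / 2" "f x = 0" using x by (simp_all add: zeros_upto_def)
        have "x = z k" using gt le w1(3) pi_gt_zero by (intro w1(5)) linarith+
        then show False using gt by simp
      qed
    qed
    then show ?thesis using c[OF k] by (simp add: c_def)
  qed
  then show ?thesis using off unfolding has_offset_def eventually_sequentially by blast
qed

text \<open>At pi/4 behind a grid point of f, both functions have passed their grid point number k;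
  at 3 pi/4 behind it, g has passed one more. The first inequality at the former point gives e \<le>
  d + c, the second at the latter d \<le> e - c.\<close>

lemma has_offset_quarter_shift:
  assumes f: "has_offset f \<beta> e" and g: "has_offset g (\<beta> - pi / 2) d"
    and le1: "\<And>X. int (card (zeros_upto f X)) \<le> int (card (zeros_upto g X)) + c"
    and le2: "\<And>X. int (card (zeros_upto g X)) \<le> int (card (zeros_upto f X)) + (1 - c)"
  shows "d = e - c"
proof -
  obtain k where k: "\<And>s. pi / 4 \<le> s \<Longrightarrow> s \<le> 3 * pi / 4 \<Longrightarrow> int (card (zeros_upto f (real k * pi + \<beta> + s))) = int k + e"
    "\<And>k' s. k' \<ge> k \<Longrightarrow> pi / 4 \<le> s \<Longrightarrow> s \<le> 3 * pi / 4 \<Longrightarrow> int (card (zeros_upto g (real k' * pi + (\<beta> - pi / 2) + s))) = int k' + d"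
  proof -
    from f obtain k1 where "\<And>k s. k \<ge> k1 \<Longrightarrow> pi / 4 \<le> s \<Longrightarrow> s \<le> 3 * pi / 4 \<Longrightarrow> int (card (zeros_upto f (real k * pi + \<beta> + s))) = int k + e"
      unfolding has_offset_def eventually_sequentially by blast
    moreover from g obtain k2 where "\<And>k s. k \<ge> k2 \<Longrightarrow> pi / 4 \<le> s \<Longrightarrow> s \<le> 3 * pi / 4 \<Longrightarrow> int (card (zeros_upto g (real k * pi + (\<beta> - pi / 2) + s))) = int k + d"
      unfolding has_offset_def eventually_sequentially by blast
    ultimately show ?thesis by (intro that[of "max k1 k2"]) auto
  qed
  have e1: "real k * pi + \<beta> + pi / 4 = real k * pi + (\<beta> - pi / 2) + 3 * pi / 4"
    and e2: "real k * pi + \<beta> + 3 * pi / 4 = real (Suc k) * pi + (\<beta> - pi / 2) + pi / 4" by (simp_all add: field_simps)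
  have "int (card (zeros_upto f (real k * pi + \<beta> + pi / 4))) = int k + e"
    by (rule k(1)) (use pi_gt_zero in linarith)+
  moreover have "int (card (zeros_upto g (real k * pi + \<beta> + pi / 4))) = int k + d"
    unfolding e1 by (rule k(2)) (use pi_gt_zero in linarith)+
  ultimately have "int k + e \<le> int k + d + c" using le1[of "real k * pi + \<beta> + pi / 4"] by linarith
  moreover have "int (card (zeros_upto f (real k * pi + \<beta> + 3 * pi / 4))) = int k + e"
    by (rule k(1)) (use pi_gt_zero in linarith)+
  moreover have "int (card (zeros_upto g (real k * pi + \<beta> + 3 * pi / 4))) = int (Suc k) + d"
    unfolding e2 by (rule k(2)) (use pi_gt_zero in linarith)+
  moreover note le2[of "real k * pi + \<beta> + 3 * pi / 4"]
  ultimately show ?thesis by simp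
qed

text \<open>For a grid shift of at most pi/2 some sampling point lies in the gaps of both functions
  for the same k, so the offsets compare like the counts.\<close>

lemma has_offset_mono:
  assumes f: "has_offset f \<beta> e" and g: "has_offset g \<gamma> d" and "\<gamma> \<le> \<beta>" "\<beta> \<le> \<gamma> + pi / 2"
    and le: "\<And>X. card (zeros_upto f X) \<le> card (zeros_upto g X)"
  shows "e \<le> d"
proof -
  have "\<forall>\<^sub>F k in sequentially. e \<le> d"
    using f g unfolding has_offset_def
  proof eventually_elim
    case (elim k)
    have "int (card (zeros_upto f (real k * pi + \<beta> + pi / 4))) = int k + e"
      by (rule elim(1)[rule_format]) (use pi_gt_zero in linarith)+
    moreover have "int (card (zeros_upto g (real k * pi + \<gamma> + (\<beta> - \<gamma> + pi / 4)))) = int k + d"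
      by (rule elim(2)[rule_format]) (use pi_gt_zero assms(3,4) in linarith)+
    moreover have "real k * pi + \<gamma> + (\<beta> - \<gamma> + pi / 4) = real k * pi + \<beta> + pi / 4" by simp
    ultimately show ?case using le[of "real k * pi + \<beta> + pi / 4"] by simp
  qed
  then show ?thesis by simp
qed

section \<open>Zeros of perturbed sine functions\<close>

lemma sin_bound_near_zero:
  assumes "\<bar>sin s\<bar> < sin \<eta>" "0 < \<eta>" "\<eta> \<le> pi / 2" "- pi / 2 < s" "s \<le> pi / 2"
  shows "\<bar>s\<bar> < \<eta>"
proof (rule ccontr)
  assume "\<not> \<bar>s\<bar> < \<eta>"
  then have "sin \<eta> \<le> sin \<bar>s\<bar>" using assms by (intro sin_monotone_2pi_le) auto
  moreover have "sin \<bar>s\<bar> \<le> \<bar>sin s\<bar>" by (simp add: abs_if)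
  ultimately show False using assms by linarith
qed

lemma sin_shift: "sin (x + real k * pi) = (-1) ^ k * sin x"
  by (simp only: sin_add cos_npi sin_npi mult_zero_right add_0_right, rule mult.commute)

lemma abs_sin_shift: "\<bar>sin (x + real k * pi)\<bar> = \<bar>sin x\<bar>"
  by (simp add: sin_shift abs_mult power_abs)

text \<open>Far out f is close to a multiple of sin (x - \<beta>) and its derivative g to the same
  multiple of cos (x - \<beta>). A sign change gives a zero in each window, smallness of the sine
  keeps it near the grid point, and by Rolle a second zero nearby would force a zero of g where the
  cosine is at least cos (pi/4) in modulus.\<close>

lemma oscillating_window_zeros:
  fixes f g r :: "real \<Rightarrow> real" and B D :: "real \<Rightarrow> complex"
  assumes f: "\<And>x. x > 0 \<Longrightarrow> f x = \<kappa> * r x * Im (cis (x - \<beta>) * B x)"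
    and g: "\<And>x. x > 0 \<Longrightarrow> g x = \<kappa> * r x * Im (cis (x - (\<beta> - pi / 2)) * D x)"
    and fg: "\<And>x. x > 0 \<Longrightarrow> (f has_real_derivative g x) (at x)"
    and B: "(B \<longlongrightarrow> 1) at_top" and D: "(D \<longlongrightarrow> 1) at_top"
    and "\<kappa> \<noteq> 0" "\<And>x. x > 0 \<Longrightarrow> r x > 0"
  shows "\<exists>z. (\<forall>\<^sub>F k in sequentially. window_zero f \<beta> k (z k)) \<and> (\<lambda>k. z k - (real k * pi + \<beta>)) \<longlonglongrightarrow> 0"
proof -
  have close: "\<bar>Im (cis y * b) - sin y\<bar> \<le> norm (b - 1)" for y b
  proof -
    have "Im (cis y * b) - sin y = Im (cis y * (b - 1))" by (simp add: algebra_simps)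
    also have "\<bar>\<dots>\<bar> \<le> norm (cis y * (b - 1))" by (rule abs_Im_le_cmod)
    finally show ?thesis by (simp add: norm_mult)
  qed
  have contf: "continuous_on S f" if "S \<subseteq> {0<..}" for S
  proof (intro continuous_at_imp_continuous_on ballI)
    fix x assume "x \<in> S"
    then show "isCont f x" using that by (intro DERIV_isCont[OF fg]) auto
  qed
  have large: "filterlim (\<lambda>k. real k * pi + \<beta> - pi / 2) at_top sequentially" by real_asymp
  have key: "\<forall>\<^sub>F k in sequentially. 0 < real k * pi + \<beta> - pi / 2 \<and>
      (\<forall>x. real k * pi + \<beta> - pi / 2 < x \<longrightarrow> x \<le> real k * pi + \<beta> + pi / 2 \<longrightarrow> f x = 0 \<longrightarrow> \<bar>x - (real k * pi + \<beta>)\<bar> < \<eta>) \<and>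
      (\<exists>x. \<bar>x - (real k * pi + \<beta>)\<bar> < \<eta> \<and> f x = 0) \<and>
      (\<forall>x. real k * pi + \<beta> - pi / 2 < x \<longrightarrow> x \<le> real k * pi + \<beta> + pi / 2 \<longrightarrow> \<bar>x - (real k * pi + \<beta>)\<bar> < pi / 4 \<longrightarrow> g x \<noteq> 0)"
    if \<eta>: "0 < \<eta>" "\<eta> < pi / 2" for \<eta>
  proof -
    have s: "0 < sin \<eta>" using \<eta> by (intro sin_gt_zero) auto
    \<comment> \<open>An error below sin \<eta> in B confines the zeros to distance \<eta> from the
      grid; for D the error 1/2 is small enough, being less than cos (pi/4).\<close>
    have "\<forall>\<^sub>F x in at_top. norm (B x - 1) < sin \<eta> \<and> norm (D x - 1) < 1/2"
      using tendstoD[OF B s] tendstoD[OF D, of "1/2"] by (simp add: dist_norm eventually_conj_iff)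
    then obtain X where X: "\<And>x. x \<ge> X \<Longrightarrow> norm (B x - 1) < sin \<eta> \<and> norm (D x - 1) < 1/2"
      unfolding eventually_at_top_linorder by blast
    have "\<forall>\<^sub>F k in sequentially. real k * pi + \<beta> - pi / 2 > max X 0"
      using large unfolding filterlim_at_top_dense by blast
    then show ?thesis
    proof eventually_elim
      case (elim k)
      define c where "c = real k * pi + \<beta>"
      have c: "c - pi / 2 > X" "c - pi / 2 > 0" using elim by (auto simp: c_def)
      have near: "\<bar>x - c\<bar> < \<eta>" if x: "c - pi / 2 < x" "x \<le> c + pi / 2" "f x = 0" for x
      proof -
        have xp: "x > 0" "x \<ge> X" using x c by linarith+
        have "Im (cis (x - \<beta>) * B x) = 0" using f[OF xp(1)] x(3) assms(6) assms(7)[OF xp(1)] by (auto simp: mult_eq_0_iff)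
        then have "\<bar>sin (x - \<beta>)\<bar> < sin \<eta>" using close[of "x - \<beta>" "B x"] X[OF xp(2)] by linarith
        moreover have "\<bar>sin (x - \<beta>)\<bar> = \<bar>sin (x - c)\<bar>"
          using abs_sin_shift[of "x - c" k] by (simp add: c_def)
        ultimately have "\<bar>sin (x - c)\<bar> < sin \<eta>" by simp
        then show ?thesis by (rule sin_bound_near_zero) (use x \<eta> in linarith)+
      qed
      have ex: "\<exists>x. \<bar>x - c\<bar> < \<eta> \<and> f x = 0"
      proof -
        \<comment> \<open>At both ends f has the sign of \<kappa> (-1)^k sin t; the product form
          treats all sign cases at once.\<close>
        have sgn: "f (c + t) * (\<kappa> * (-1) ^ k * sin t) > 0" if t: "\<bar>t\<bar> = \<eta>" for t
        proof -
          define x where "x = c + t"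
          have "t \<ge> - \<eta>" using t by linarith
          then have x: "x > 0" "x \<ge> X" using c \<eta> unfolding x_def by linarith+
          have sin_eq: "sin (x - \<beta>) = (-1) ^ k * sin t"
            using sin_shift[of t k] by (simp add: x_def c_def add.commute)
          have "\<bar>sin t\<bar> = sin \<eta>" proof (cases "t \<ge> 0")
            case True
            then show ?thesis using t s by simp
          next
            case False
            then have "t = - \<eta>" using t by linarith
            then show ?thesis using s by simp
          qed
          then have "norm (B x - 1) < \<bar>sin (x - \<beta>)\<bar>" using X[OF x(2)] by (simp add: sin_eq abs_mult)
          then have "Im (cis (x - \<beta>) * B x) * sin (x - \<beta>) > 0"
          proof -
            let ?u = "Im (cis (x - \<beta>) * B x)" and ?v = "sin (x - \<beta>)"
            assume "norm (B x - 1) < \<bar>?v\<bar>"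
            then have "\<bar>?u - ?v\<bar> < \<bar>?v\<bar>" using close[of "x - \<beta>" "B x"] by linarith
            then show ?thesis by (cases "?v > 0") (auto simp: zero_less_mult_iff)
          qed
          then have "0 < (\<kappa> * \<kappa> * r x) * (Im (cis (x - \<beta>) * B x) * sin (x - \<beta>))"
          proof (rule mult_pos_pos[rotated])
            have "0 < \<kappa> * \<kappa>" using assms(6) not_real_square_gt_zero by blast
            then show "0 < \<kappa> * \<kappa> * r x" using assms(7)[OF x(1)] by simp
          qed
          also have "\<dots> = f x * (\<kappa> * (-1) ^ k * sin t)" using f[OF x(1)] by (simp add: sin_eq mult_ac)
          finally show ?thesis by (simp add: x_def)
        qed
        have opp: "f (c - \<eta>) * f (c + \<eta>) < 0"
        proof -
          have "f (c + \<eta>) * (\<kappa> * (-1) ^ k * sin \<eta>) > 0" using sgn[of \<eta>] \<eta> by simp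
          moreover have "f (c - \<eta>) * (\<kappa> * (-1) ^ k * sin \<eta>) < 0" using sgn[of "- \<eta>"] \<eta> by simp
          ultimately show ?thesis by (auto simp: zero_less_mult_iff mult_less_0_iff)
        qed
        have cont: "continuous_on {c - \<eta>..c + \<eta>} f"
          using c \<eta> by (intro contf) auto
        have "\<exists>x\<ge>c - \<eta>. x \<le> c + \<eta> \<and> f x = 0"
        proof (cases "f (c - \<eta>) < 0")
          case True
          then show ?thesis using opp \<eta> cont by (intro IVT') (auto simp: mult_less_0_iff)
        next
          case False
          then show ?thesis using opp \<eta> cont by (intro IVT2') (auto simp: mult_less_0_iff)
        qed
        then obtain x where x: "x \<ge> c - \<eta>" "x \<le> c + \<eta>" "f x = 0" by blast
        then have "x \<noteq> c - \<eta>" "x \<noteq> c + \<eta>" using opp by auto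
        then show ?thesis using x by (intro exI[of _ x]) auto
      qed
      have gne: "g x \<noteq> 0" if x: "c - pi / 2 < x" "x \<le> c + pi / 2" "\<bar>x - c\<bar> < pi / 4" for x
      proof
        assume "g x = 0"
        have xp: "x > 0" "x \<ge> X" using x c by linarith+
        have "Im (cis (x - (\<beta> - pi / 2)) * D x) = 0" using \<open>g x = 0\<close> g[OF xp(1)] assms(6) assms(7)[OF xp(1)] by (auto simp: mult_eq_0_iff)
        then have "\<bar>sin (x - (\<beta> - pi / 2))\<bar> < 1/2" using close[of "x - (\<beta> - pi / 2)" "D x"] X[OF xp(2)] by linarith
        moreover have "\<bar>sin (x - (\<beta> - pi / 2))\<bar> = \<bar>cos (x - c)\<bar>"
        proof -
          have "x - (\<beta> - pi / 2) = (x - c + pi / 2) + real k * pi" by (simp add: c_def)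
          then have "\<bar>sin (x - (\<beta> - pi / 2))\<bar> = \<bar>sin (x - c + pi / 2)\<bar>" by (simp only: abs_sin_shift)
          also have "sin (x - c + pi / 2) = cos (x - c)" by (simp add: sin_add)
          finally show ?thesis .
        qed
        moreover have "cos (pi / 4) \<le> cos \<bar>x - c\<bar>" using x pi_gt_zero by (intro cos_monotone_0_pi_le) linarith+
        moreover have "cos (pi / 4) > 1/2"
        proof -
          have "sqrt 2 > 1" by simp
          then show ?thesis by (simp add: cos_45)
        qed
        ultimately show False by simp
      qed
      show ?case using near ex gne c unfolding c_def[symmetric] by (simp add: c_def)
    qed
  qed
  define z where "z k = (SOME x. \<bar>x - (real k * pi + \<beta>)\<bar> < pi / 4 \<and> f x = 0)" for k
  have win: "\<forall>\<^sub>F k in sequentially. window_zero f \<beta> k (z k)"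
  proof (rule eventually_mono[OF key[of "pi / 4"]])
    fix k :: nat
    assume elim: "0 < real k * pi + \<beta> - pi / 2 \<and>
      (\<forall>x. real k * pi + \<beta> - pi / 2 < x \<longrightarrow> x \<le> real k * pi + \<beta> + pi / 2 \<longrightarrow> f x = 0 \<longrightarrow> \<bar>x - (real k * pi + \<beta>)\<bar> < pi / 4) \<and>
      (\<exists>x. \<bar>x - (real k * pi + \<beta>)\<bar> < pi / 4 \<and> f x = 0) \<and>
      (\<forall>x. real k * pi + \<beta> - pi / 2 < x \<longrightarrow> x \<le> real k * pi + \<beta> + pi / 2 \<longrightarrow> \<bar>x - (real k * pi + \<beta>)\<bar> < pi / 4 \<longrightarrow> g x \<noteq> 0)"
    define c where "c = real k * pi + \<beta>"
    have "\<bar>z k - c\<bar> < pi / 4 \<and> f (z k) = 0"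
      unfolding z_def c_def by (rule someI_ex) (use elim in blast)
    then have z: "\<bar>z k - c\<bar> < pi / 4" "f (z k) = 0" by auto
    have near: "\<bar>x - c\<bar> < pi / 4" if "c - pi / 2 < x" "x \<le> c + pi / 2" "f x = 0" for x
      using elim that unfolding c_def[symmetric] by blast
    have c0: "c - pi / 2 > 0" using elim by (simp add: c_def)
    have no2: False if "a < b" "\<bar>a - c\<bar> < pi / 4" "\<bar>b - c\<bar> < pi / 4" "f a = 0" "f b = 0" for a b
    proof -
      have pos: "a > 0" using that(2) c0 pi_gt_zero by linarith
      have "\<exists>y>a. y < b \<and> g y = 0"
        by (rule Rolle_zeros[where g = f]) (use that pos fg in \<open>auto intro!: contf\<close>)
      then obtain y where "a < y" "y < b" "g y = 0" by blast
      moreover have "g y \<noteq> 0"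
      proof -
        have "c - pi / 2 < y" "y \<le> c + pi / 2" "\<bar>y - c\<bar> < pi / 4"
          using that(2,3) \<open>a < y\<close> \<open>y < b\<close> pi_gt_zero by linarith+
        then show ?thesis using elim unfolding c_def[symmetric] by blast
      qed
      ultimately show False by simp
    qed
    have "x = z k" if "c - pi / 2 < x" "x \<le> c + pi / 2" "f x = 0" for x
      using no2[of x "z k"] no2[of "z k" x] near[OF that] z that by (cases x "z k" rule: linorder_cases) auto
    moreover have "c - pi / 2 < z k" "z k \<le> c + pi / 2" using z pi_gt_zero by linarith+
    ultimately have "{x. c - pi / 2 < x \<and> x \<le> c + pi / 2 \<and> f x = 0} = {z k}" using z(2) by blast
    then show "window_zero f \<beta> k (z k)" using z(1) c0 unfolding window_zero_def c_def[symmetric] by (intro conjI)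
  qed (use pi_gt_zero in linarith)+
  moreover have "(\<lambda>k. z k - (real k * pi + \<beta>)) \<longlonglongrightarrow> 0"
  proof (rule tendstoI)
    fix \<epsilon> :: real assume "\<epsilon> > 0"
    define \<eta> where "\<eta> = min \<epsilon> (pi / 4)"
    have \<eta>: "0 < \<eta>" "\<eta> < pi / 2" "\<eta> \<le> \<epsilon>" using \<open>\<epsilon> > 0\<close> pi_gt_zero unfolding \<eta>_def by linarith+
    show "\<forall>\<^sub>F k in sequentially. dist (z k - (real k * pi + \<beta>)) 0 < \<epsilon>"
      using key[OF \<eta>(1,2)] win
    proof eventually_elim
      case (elim k)
      note w = window_zeroD[OF elim(2)]
      have "real k * pi + \<beta> - pi / 2 < z k" "z k \<le> real k * pi + \<beta> + pi / 2" using w(3,4) pi_gt_zero by linarith+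
      then have "\<bar>z k - (real k * pi + \<beta>)\<bar> < \<eta>" using elim(1) w(1) by blast
      then show ?case using \<eta> by (simp add: dist_real_def)
    qed
  qed
  ultimately show ?thesis by blast
qed

abbreviation (input) bessel_beta :: "real \<Rightarrow> nat \<Rightarrow> real" where
  "bessel_beta \<nu> N \<equiv> \<nu> * pi / 2 - pi / 4 - real N * pi / 2"

text \<open>The factor i^N of the amplitude is moved into the phase as a shift by N pi/2, and one
  more factor i turns the real part into an imaginary part, so that the zeros sit near those of a
  sine.\<close>

lemma bessel_J_deriv_oscillates:
  assumes \<nu>: "\<nu> \<ge> 0"
  shows "\<exists>\<kappa>. \<kappa> \<noteq> 0 \<and> (\<forall>N. \<exists>B. has_expansion B (\<lambda>k. \<i> ^ k * of_real (bessel_deriv_exp_coeff \<nu> N k)) \<and>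
     (\<forall>x>0. bessel_J_deriv \<nu> N x = \<kappa> * x powr (-1/2) * Im (cis (x - bessel_beta \<nu> N) * B x)))"
proof -
  obtain \<kappa> where \<kappa>: "\<kappa> \<noteq> 0" and ex: "\<And>N n. \<exists>Z. smooth_expansion n Z (\<lambda>k. \<i> ^ (N + k) * of_real (bessel_deriv_exp_coeff \<nu> N k)) \<and>
     (\<forall>x>0. bessel_J_deriv \<nu> N x = \<kappa> * Re (hankel_phase \<nu> * cis x * of_real (x powr (-1/2)) * Z x))"
    using bessel_J_deriv_expansion[OF \<nu>] by blast
  have "\<exists>B. has_expansion B (\<lambda>k. \<i> ^ k * of_real (bessel_deriv_exp_coeff \<nu> N k)) \<and>
     (\<forall>x>0. bessel_J_deriv \<nu> N x = \<kappa> * x powr (-1/2) * Im (cis (x - bessel_beta \<nu> N) * B x))" for N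
  proof -
    obtain Z where Z: "has_expansion Z (\<lambda>k. \<i> ^ (N + k) * of_real (bessel_deriv_exp_coeff \<nu> N k))"
      "\<And>x. x > 0 \<Longrightarrow> bessel_J_deriv \<nu> N x = \<kappa> * Re (hankel_phase \<nu> * cis x * of_real (x powr (-1/2)) * Z x)"
      using ex[of 0 N] by auto
    define B where "B x = (- \<i>) ^ N * Z x" for x
    have ii: "(- \<i>) ^ N * \<i> ^ N = 1" by (simp flip: power_mult_distrib)
    have "has_expansion B (\<lambda>k. (- \<i>) ^ N * (\<i> ^ (N + k) * of_real (bessel_deriv_exp_coeff \<nu> N k)))"
      unfolding B_def by (rule has_expansion_cmult[OF Z(1)])
    also have "(\<lambda>k. (- \<i>) ^ N * (\<i> ^ (N + k) * of_real (bessel_deriv_exp_coeff \<nu> N k))) = (\<lambda>k. \<i> ^ k * of_real (bessel_deriv_exp_coeff \<nu> N k))"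
      using ii by (simp add: power_add fun_eq_iff flip: mult.assoc)
    finally have 1: "has_expansion B (\<lambda>k. \<i> ^ k * of_real (bessel_deriv_exp_coeff \<nu> N k))" .
    have 2: "bessel_J_deriv \<nu> N x = \<kappa> * x powr (-1/2) * Im (cis (x - bessel_beta \<nu> N) * B x)" if x: "x > 0" for x
    proof -
      have phase: "cis (x - bessel_beta \<nu> N) * (- \<i>) ^ N = \<i> * (hankel_phase \<nu> * cis x)"
      proof -
        have N: "(- \<i>) ^ N = cis (- (real N * pi / 2))"
        proof -
          have "- \<i> = cis (- (pi / 2))" by (simp add: complex_eq_iff)
          then have "(- \<i>) ^ N = cis (- (pi / 2)) ^ N" by simp
          also have "\<dots> = cis (real N * - (pi / 2))" by (rule Complex.DeMoivre)
          finally show ?thesis by simp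
        qed
        have e: "x - bessel_beta \<nu> N + - (real N * pi / 2) = pi / 2 + (- (\<nu> * pi / 2 + pi / 4) + x)" by (simp add: field_simps)
        have "cis (x - bessel_beta \<nu> N) * (- \<i>) ^ N = cis (pi / 2) * (cis (- (\<nu> * pi / 2 + pi / 4)) * cis x)"
          by (simp only: N cis_mult e)
        then show ?thesis by (simp only: hankel_phase_def cis_pi_half)
      qed
      have "cis (x - bessel_beta \<nu> N) * B x = (cis (x - bessel_beta \<nu> N) * (- \<i>) ^ N) * Z x" by (simp add: B_def)
      also have "\<dots> = \<i> * (hankel_phase \<nu> * cis x * Z x)" unfolding phase by simp
      finally have im: "Im (cis (x - bessel_beta \<nu> N) * B x) = Re (hankel_phase \<nu> * cis x * Z x)" by (simp only: Im_i_times)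
      have "hankel_phase \<nu> * cis x * of_real (x powr (-1/2)) * Z x = of_real (x powr (-1/2)) * (hankel_phase \<nu> * cis x * Z x)" by (simp only: mult_ac)
      then show ?thesis using Z(2)[OF x] im by (simp only: Re_of_real_mult mult.assoc)
    qed
    show ?thesis using 1 2 by blast
  qed
  then show ?thesis using \<kappa> by blast
qed

lemma bessel_window_zeros:
  assumes \<nu>: "\<nu> \<ge> 0"
  shows "\<exists>z B. has_expansion B (\<lambda>k. \<i> ^ k * of_real (bessel_deriv_exp_coeff \<nu> N k)) \<and>
     (\<forall>\<^sub>F k in sequentially. window_zero (bessel_J_deriv \<nu> N) (bessel_beta \<nu> N) k (z k)) \<and>
     (\<lambda>k. z k - (real k * pi + bessel_beta \<nu> N)) \<longlonglongrightarrow> 0 \<and>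
     (\<forall>x>0. bessel_J_deriv \<nu> N x = 0 \<longrightarrow> Im (cis (x - bessel_beta \<nu> N) * B x) = 0)"
proof -
  obtain \<kappa> where \<kappa>: "\<kappa> \<noteq> 0" and ex: "\<And>N. \<exists>B. has_expansion B (\<lambda>k. \<i> ^ k * of_real (bessel_deriv_exp_coeff \<nu> N k)) \<and>
     (\<forall>x>0. bessel_J_deriv \<nu> N x = \<kappa> * x powr (-1/2) * Im (cis (x - bessel_beta \<nu> N) * B x))"
    using bessel_J_deriv_oscillates[OF \<nu>] by blast
  obtain B where B: "has_expansion B (\<lambda>k. \<i> ^ k * of_real (bessel_deriv_exp_coeff \<nu> N k))"
     "\<And>x. x > 0 \<Longrightarrow> bessel_J_deriv \<nu> N x = \<kappa> * x powr (-1/2) * Im (cis (x - bessel_beta \<nu> N) * B x)"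
    using ex[of N] by blast
  obtain D where D: "has_expansion D (\<lambda>k. \<i> ^ k * of_real (bessel_deriv_exp_coeff \<nu> (Suc N) k))"
     "\<And>x. x > 0 \<Longrightarrow> bessel_J_deriv \<nu> (Suc N) x = \<kappa> * x powr (-1/2) * Im (cis (x - bessel_beta \<nu> (Suc N)) * D x)"
    using ex[of "Suc N"] by blast
  have b0: "bessel_deriv_exp_coeff \<nu> N 0 = 1" for N by (induction N) (simp_all add: hankel_A_def)
  have beta: "bessel_beta \<nu> (Suc N) = bessel_beta \<nu> N - pi / 2" by (simp add: field_simps)
  have "\<exists>z. (\<forall>\<^sub>F k in sequentially. window_zero (bessel_J_deriv \<nu> N) (bessel_beta \<nu> N) k (z k)) \<and> (\<lambda>k. z k - (real k * pi + bessel_beta \<nu> N)) \<longlonglongrightarrow> 0"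
  proof (rule oscillating_window_zeros)
    show "(B \<longlongrightarrow> 1) at_top" using has_expansion_tendsto[OF B(1)] by (simp add: b0)
    show "(D \<longlongrightarrow> 1) at_top" using has_expansion_tendsto[OF D(1)] by (simp add: b0)
    show "x powr (-1/2) > 0" if "x > 0" for x :: real using that by simp
    fix x :: real assume x: "x > 0"
    show "bessel_J_deriv \<nu> N x = \<kappa> * x powr (-1/2) * Im (cis (x - bessel_beta \<nu> N) * B x)" by (rule B(2)[OF x])
    show "bessel_J_deriv \<nu> (Suc N) x = \<kappa> * x powr (-1/2) * Im (cis (x - (bessel_beta \<nu> N - pi / 2)) * D x)"
      by (rule D(2)[OF x, unfolded beta])
    show "(bessel_J_deriv \<nu> N has_real_derivative bessel_J_deriv \<nu> (Suc N) x) (at x)" by (rule DERIV_bessel_J_deriv[OF \<nu> x])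
  qed (rule \<kappa>)
  then obtain z where "\<forall>\<^sub>F k in sequentially. window_zero (bessel_J_deriv \<nu> N) (bessel_beta \<nu> N) k (z k)"
    "(\<lambda>k. z k - (real k * pi + bessel_beta \<nu> N)) \<longlonglongrightarrow> 0" by blast
  moreover have "Im (cis (x - bessel_beta \<nu> N) * B x) = 0" if "x > 0" "bessel_J_deriv \<nu> N x = 0" for x
    using B(2)[OF that(1)] that \<kappa> by auto
  ultimately show ?thesis using B(1) by blast
qed

section \<open>Indices of the zeros\<close>

lemma continuous_on_bessel_J_deriv:
  assumes "\<nu> \<ge> 0" "S \<subseteq> {0<..}"
  shows "continuous_on S (bessel_J_deriv \<nu> N)"
proof (intro continuous_at_imp_continuous_on ballI)
  fix x assume "x \<in> S"
  then show "isCont (bessel_J_deriv \<nu> N) x"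
    using assms by (intro DERIV_isCont[OF DERIV_bessel_J_deriv]) auto
qed

lemma continuous_on_bessel_series_square:
  assumes "\<nu> \<ge> 0"
  shows "continuous_on S (\<lambda>x. bessel_series \<nu> N (x\<^sup>2))"
proof -
  have "continuous_on UNIV (bessel_series \<nu> N)"
    by (intro continuous_at_imp_continuous_on ballI DERIV_isCont[OF DERIV_bessel_series[OF assms]])
  then show ?thesis
    by (rule continuous_on_compose2) (auto intro!: continuous_intros)
qed

text \<open>Infinitely many zeros would accumulate: not at 0, where the series has a nonzero
  constant term, nor at a positive point, where zeros are simple and hence isolated.\<close>

lemma finite_zeros_bessel_J:
  assumes \<nu>: "\<nu> \<ge> 0"
  shows "finite (zeros_upto (bessel_J \<nu>) X)"
proof (rule ccontr)
  assume inf: "infinite (zeros_upto (bessel_J \<nu>) X)"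
  have ne: "bessel_series \<nu> 0 0 \<noteq> 0"
    using rGamma_nat_shift_bounds(1)[OF \<nu>, of 0] by (simp add: bessel_series_0 bessel_coeff_def)
  have "isCont (\<lambda>x. bessel_series \<nu> 0 (x\<^sup>2)) 0"
    using continuous_on_bessel_series_square[OF \<nu>, of UNIV 0] by (simp add: continuous_on_eq_continuous_at)
  then have "\<forall>\<^sub>F x in nhds 0. bessel_series \<nu> 0 (x\<^sup>2) \<noteq> 0"
    using ne by (intro tendsto_imp_eventually_ne[where c = "bessel_series \<nu> 0 (0\<^sup>2)"]) (auto simp: isCont_def tendsto_nhds_iff)
  then obtain d where d: "d > 0" "\<And>x. \<bar>x\<bar> < d \<Longrightarrow> bessel_series \<nu> 0 (x\<^sup>2) \<noteq> 0"
    by (auto simp: eventually_nhds_metric dist_real_def)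
  have sub: "zeros_upto (bessel_J \<nu>) X \<subseteq> {d..X}"
  proof
    fix x assume x: "x \<in> zeros_upto (bessel_J \<nu>) X"
    then have "bessel_series \<nu> 0 (x\<^sup>2) = 0" using bessel_J_eq[OF \<nu>, of x] by (auto simp: zeros_upto_def)
    then have "\<not> \<bar>x\<bar> < d" using d(2) by blast
    then show "x \<in> {d..X}" using x by (auto simp: zeros_upto_def)
  qed
  obtain p where p: "p \<in> {d..X}" "p islimpt zeros_upto (bessel_J \<nu>) X"
    using compact_eq_Bolzano_Weierstrass[of "{d..X}"] inf sub by auto
  have p0: "p > 0" using p d by auto
  have der: "(bessel_J \<nu> has_real_derivative bessel_J_deriv \<nu> 1 p) (at p)"
    using DERIV_bessel_J_deriv[OF \<nu> p0, of 0] by (simp add: bessel_J_deriv_0)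
  have "\<forall>\<^sub>F y in at p. bessel_J \<nu> y \<noteq> 0"
  proof (cases "bessel_J \<nu> p = 0")
    case True
    have "((\<lambda>y. (bessel_J \<nu> y - bessel_J \<nu> p) / (y - p)) \<longlongrightarrow> bessel_J_deriv \<nu> 1 p) (at p)"
      using der by (simp add: has_field_derivative_iff)
    then have "\<forall>\<^sub>F y in at p. (bessel_J \<nu> y - bessel_J \<nu> p) / (y - p) \<noteq> 0"
      using bessel_J_simple_zero[OF \<nu> p0 True] by (rule tendsto_imp_eventually_ne)
    then show ?thesis by eventually_elim (use True in auto)
  next
    case False
    have "isCont (bessel_J \<nu>) p" using der by (rule DERIV_isCont)
    then show ?thesis using False by (auto simp: isCont_def intro: tendsto_imp_eventually_ne)
  qed
  then have "\<forall>\<^sub>F y in at p. y \<notin> zeros_upto (bessel_J \<nu>) X"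
    by eventually_elim (auto simp: zeros_upto_def)
  then show False using p(2) by (simp add: islimpt_iff_eventually)
qed

text \<open>If the derivatives of orders N + 1 and N + 2 vanished together, the Laguerre inequality
  would read 0 > 0 unless the derivative of order N vanished as well, which the induction hypothesis
  excludes.\<close>

lemma bessel_J_deriv_simple_zero:
  assumes "real N \<le> \<nu>" "x > 0" "bessel_J_deriv \<nu> N x = 0"
  shows "bessel_J_deriv \<nu> (Suc N) x \<noteq> 0"
  using assms
proof (induction N)
  case 0
  then show ?case using bessel_J_simple_zero[of \<nu> x] by (simp add: bessel_J_deriv_0)
next
  case (Suc N)
  then have "bessel_J_deriv \<nu> N x \<noteq> 0" by auto
  then show ?case using bessel_J_deriv_laguerre_inequality[of N \<nu> x] Suc.prems by auto
qed

section \<open>Interlacing of the zeros of consecutive derivatives\<close>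

lemma rolle_bessel_J_deriv:
  assumes \<nu>: "\<nu> \<ge> 0" and "0 < a" "a < b" "bessel_J_deriv \<nu> N a = 0" "bessel_J_deriv \<nu> N b = 0"
  shows "\<exists>c>a. c < b \<and> bessel_J_deriv \<nu> (Suc N) c = 0"
  by (rule Rolle_zeros[where g = "bessel_J_deriv \<nu> N"])
     (use assms in \<open>auto intro!: DERIV_bessel_J_deriv continuous_on_bessel_J_deriv\<close>)

lemma continuous_on_powr_bessel_series:
  assumes "\<nu> \<ge> 0" "p > 0"
  shows "continuous_on {0..b} (\<lambda>x. x powr p * bessel_series \<nu> N (x\<^sup>2))"
proof (intro continuous_on_mult)
  show "continuous_on {0..b} (\<lambda>x. x powr p)" using assms by (intro continuous_on_powr' continuous_intros) auto
  show "continuous_on {0..b} (\<lambda>x. bessel_series \<nu> N (x\<^sup>2))"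
    by (rule continuous_on_bessel_series_square[OF assms(1)])
qed

text \<open>For N < \<nu> the factor x^(\<nu> - N) vanishes at 0, so 0 serves as the left zero in
  Rolle's theorem. The product with the series replaces \<open>bessel_J_deriv\<close> to have
  continuity at 0.\<close>

lemma bessel_J_deriv_zero_below:
  assumes "real N < \<nu>" "0 < b" "bessel_J_deriv \<nu> N b = 0"
  shows "\<exists>c>0. c < b \<and> bessel_J_deriv \<nu> (Suc N) c = 0"
proof -
  have \<nu>: "\<nu> \<ge> 0" using assms by linarith
  let ?g = "\<lambda>x. x powr (\<nu> - real N) * bessel_series \<nu> N (x\<^sup>2)"
  show ?thesis
  proof (rule Rolle_zeros[where g = ?g])
    show "continuous_on {0..b} ?g" using assms \<nu> by (intro continuous_on_powr_bessel_series) auto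
    show "(?g has_real_derivative bessel_J_deriv \<nu> (Suc N) x) (at x)" if "0 < x" for x
      unfolding bessel_J_deriv_eq[OF \<nu> that] by (rule DERIV_powr_bessel_series[OF \<nu> that])
    show "?g b = 0" using bessel_J_deriv_eq[OF \<nu> assms(2), of N] assms(3) by simp
  qed (use assms in auto)
qed

text \<open>Zeros of \<open>J\<^sup>(\<^sup>N\<^sup>+\<^sup>1\<^sup>)\<close> are separated by those of \<open>J\<^sup>(\<^sup>N\<^sup>)\<close>: otherwise the logarithmic derivative of
  \<open>J\<^sup>(\<^sup>N\<^sup>)\<close>, which is strictly decreasing by the Laguerre inequality, would vanish twice.\<close>

lemma bessel_J_deriv_separated:
  assumes "real N \<le> \<nu>" "0 < p" "p < q" "bessel_J_deriv \<nu> (Suc N) p = 0" "bessel_J_deriv \<nu> (Suc N) q = 0"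
  shows "\<exists>c>p. c < q \<and> bessel_J_deriv \<nu> N c = 0"
proof (rule ccontr)
  assume no: "\<not> ?thesis"
  have \<nu>: "\<nu> \<ge> 0" using assms by linarith
  have ne: "bessel_J_deriv \<nu> N x \<noteq> 0" if "p \<le> x" "x \<le> q" for x
    using no that assms bessel_J_deriv_simple_zero[OF assms(1), of p] bessel_J_deriv_simple_zero[OF assms(1), of q]
    by (cases "x = p"; cases "x = q") auto
  let ?t = "\<lambda>x. bessel_J_deriv \<nu> (Suc N) x / bessel_J_deriv \<nu> N x"
  let ?t' = "\<lambda>x. (bessel_J_deriv \<nu> (Suc (Suc N)) x * bessel_J_deriv \<nu> N x - bessel_J_deriv \<nu> (Suc N) x * bessel_J_deriv \<nu> (Suc N) x) / (bessel_J_deriv \<nu> N x * bessel_J_deriv \<nu> N x)"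
  have "\<exists>z>p. z < q \<and> ?t' z = 0"
  proof (rule Rolle_zeros[where g = ?t])
    show "continuous_on {p..q} ?t"
      using ne assms \<nu> by (intro continuous_intros continuous_on_bessel_J_deriv) auto
    show "(?t has_real_derivative ?t' x) (at x)" if "p < x" "x < q" for x
      using that assms ne[of x] by (intro DERIV_divide DERIV_bessel_J_deriv \<nu>) auto
  qed (use assms in auto)
  then obtain z where z: "p < z" "z < q" "?t' z = 0" by blast
  then have "bessel_J_deriv \<nu> N z \<noteq> 0" by (intro ne) auto
  then show False
    using bessel_J_deriv_laguerre_inequality[OF assms(1), of z] z assms by (auto simp: power2_eq_square mult.commute)
qed

text \<open>For N = \<nu> the derivative of order N extends to an even function that is nonzero at
  0, and the next derivative vanishes there. So 0 takes the place of the smaller zero in the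
  argument with the logarithmic derivative; \<open>?F\<close> and \<open>?G\<close> are the
  continuous extensions to 0.\<close>

lemma bessel_J_deriv_no_zero_before:
  assumes "real N = \<nu>" "0 < q" "bessel_J_deriv \<nu> (Suc N) q = 0"
  shows "\<exists>c>0. c < q \<and> bessel_J_deriv \<nu> N c = 0"
proof (rule ccontr)
  assume no: "\<not> ?thesis"
  have \<nu>: "\<nu> \<ge> 0" and N: "real N \<le> \<nu>" using assms by linarith+
  let ?F = "\<lambda>x. bessel_series \<nu> N (x\<^sup>2)" and ?G = "\<lambda>x. 2 * x * bessel_series' \<nu> N (x\<^sup>2)"
  have F: "bessel_J_deriv \<nu> N x = ?F x" if "x > 0" for x
    using bessel_J_deriv_eq[OF \<nu> that, of N] assms(1) that by simp
  have G: "bessel_J_deriv \<nu> (Suc N) x = ?G x" if "x > 0" for x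
  proof -
    have "x powr (-1) * (2 * x\<^sup>2) = 2 * x" using that by (simp add: powr_minus power2_eq_square)
    moreover have "\<nu> - real (Suc N) = -1" using assms(1) by simp
    ultimately show ?thesis
      using bessel_J_deriv_eq[OF \<nu> that, of "Suc N"] bessel_series_Suc[OF \<nu>, of N "x\<^sup>2"] assms(1) by (simp flip: mult.assoc)
  qed
  have F0: "?F 0 \<noteq> 0"
  proof -
    have "(\<Prod>j<N. \<nu> - real j) \<noteq> 0" using assms(1) by (auto simp: prod_zero_iff)
    then show ?thesis using rGamma_nat_shift_bounds(1)[OF \<nu>, of 0] by (simp add: bessel_series_0 bessel_coeff_def)
  qed
  have ne: "?F x \<noteq> 0" if "0 \<le> x" "x \<le> q" for x
    using that no F0 F[of x] assms(2,3) bessel_J_deriv_simple_zero[OF N, of q]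
    by (cases "x = 0"; cases "x = q") auto
  have contF: "continuous_on {0..q} ?F"
    by (rule continuous_on_bessel_series_square[OF \<nu>])
  have contG: "continuous_on {0..q} ?G"
  proof -
    have "isCont (bessel_series' \<nu> N) y" for y
      unfolding bessel_series'_def[abs_def]
      by (intro DERIV_isCont[OF termdiffs_strong_converges_everywhere] termdiff_converges_all summable_bessel_coeff \<nu>)
    then have "continuous_on UNIV (bessel_series' \<nu> N)" by (simp add: continuous_at_imp_continuous_on)
    then have "continuous_on {0..q} (\<lambda>x. bessel_series' \<nu> N (x\<^sup>2))"
      by (rule continuous_on_compose2) (auto intro!: continuous_intros)
    then show ?thesis by (intro continuous_intros)
  qed
  let ?t = "\<lambda>x. ?G x / ?F x"
  let ?t' = "\<lambda>x. (bessel_J_deriv \<nu> (Suc (Suc N)) x * bessel_J_deriv \<nu> N x - bessel_J_deriv \<nu> (Suc N) x * bessel_J_deriv \<nu> (Suc N) x) / (bessel_J_deriv \<nu> N x * bessel_J_deriv \<nu> N x)"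
  have "\<exists>z>0. z < q \<and> ?t' z = 0"
  proof (rule Rolle_zeros[where g = ?t])
    show "continuous_on {0..q} ?t" using ne by (intro continuous_on_divide contF contG) auto
    show "?t q = 0" using G[OF assms(2)] assms(3) by simp
    show "(?t has_real_derivative ?t' x) (at x)" if "0 < x" "x < q" for x
    proof (rule has_field_derivative_transform_within_open[of _ _ _ "{0<..}"])
      show "((\<lambda>x. bessel_J_deriv \<nu> (Suc N) x / bessel_J_deriv \<nu> N x) has_real_derivative ?t' x) (at x)"
        using that ne[of x] F[of x] by (intro DERIV_divide DERIV_bessel_J_deriv \<nu>) auto
      show "bessel_J_deriv \<nu> (Suc N) y / bessel_J_deriv \<nu> N y = ?t y" if "y \<in> {0<..}" for y
        using that F[of y] G[of y] by simp
    qed (use that in auto)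
  qed (use assms in auto)
  then obtain z where z: "0 < z" "z < q" "?t' z = 0" by blast
  then have "bessel_J_deriv \<nu> N z \<noteq> 0" using ne[of z] F[of z] by auto
  then show False
    using bessel_J_deriv_laguerre_inequality[OF N, of z] z by (auto simp: power2_eq_square mult.commute)
qed

lemma isCont_tendsto_at_right:
  fixes f :: "real \<Rightarrow> real"
  shows "isCont f a \<Longrightarrow> (f \<longlongrightarrow> f a) (at_right a)"
  unfolding isCont_def by (rule tendsto_mono[OF at_le]) auto

text \<open>Finiteness passes from N to N + 1 by separation, which rests on the Laguerre inequality
  for order N; hence the range reaches one order beyond \<nu>.\<close>

lemma finite_zeros_bessel_J_deriv:
  assumes "\<nu> \<ge> 0" "real N \<le> \<nu> + 1"
  shows "finite (zeros_upto (bessel_J_deriv \<nu> N) X)"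
  using assms(2)
proof (induction N)
  case 0
  then show ?case using finite_zeros_bessel_J[OF assms(1)] by (simp add: bessel_J_deriv_0)
next
  case (Suc N)
  then have N: "real N \<le> \<nu>" by simp
  have fin: "finite (zeros_upto (bessel_J_deriv \<nu> N) X)" using Suc by simp
  have sep: "\<exists>c>a. c \<le> b \<and> bessel_J_deriv \<nu> N c = 0"
    if "0 < a" "a < b" "bessel_J_deriv \<nu> (Suc N) a = 0" "bessel_J_deriv \<nu> (Suc N) b = 0" for a b
    using bessel_J_deriv_separated[OF N that] less_imp_le by blast
  show ?case by (rule conjunct1[OF card_zeros_upto_le(1)[OF fin sep]])
qed

text \<open>Separation in both directions makes the counts differ by at most one; which function
  leads is decided at 0. For N < \<nu> a zero of the derivative precedes every zero of the function,
  for N = \<nu> it is the other way round.\<close>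

lemma card_zeros_bessel_J_deriv_Suc:
  assumes "\<nu> \<ge> 0" "real N \<le> \<nu>"
  shows "card (zeros_upto (bessel_J_deriv \<nu> (Suc N)) X) \<le> card (zeros_upto (bessel_J_deriv \<nu> N) X) + 1"
    and "real N < \<nu> \<Longrightarrow> card (zeros_upto (bessel_J_deriv \<nu> N) X) \<le> card (zeros_upto (bessel_J_deriv \<nu> (Suc N)) X)"
    and "card (zeros_upto (bessel_J_deriv \<nu> N) X) \<le> card (zeros_upto (bessel_J_deriv \<nu> (Suc N)) X) + 1"
    and "real N = \<nu> \<Longrightarrow> card (zeros_upto (bessel_J_deriv \<nu> (Suc N)) X) \<le> card (zeros_upto (bessel_J_deriv \<nu> N) X)"
proof -
  have fin: "finite (zeros_upto (bessel_J_deriv \<nu> N) X)" "finite (zeros_upto (bessel_J_deriv \<nu> (Suc N)) X)"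
    using assms by (intro finite_zeros_bessel_J_deriv; simp)+
  have sep1: "\<exists>c>a. c \<le> b \<and> bessel_J_deriv \<nu> N c = 0"
    if "0 < a" "a < b" "bessel_J_deriv \<nu> (Suc N) a = 0" "bessel_J_deriv \<nu> (Suc N) b = 0" for a b
    using bessel_J_deriv_separated[OF assms(2) that] less_imp_le by blast
  have sep2: "\<exists>c>a. c \<le> b \<and> bessel_J_deriv \<nu> (Suc N) c = 0"
    if "0 < a" "a < b" "bessel_J_deriv \<nu> N a = 0" "bessel_J_deriv \<nu> N b = 0" for a b
    using rolle_bessel_J_deriv[OF assms(1) that] less_imp_le by blast
  show "card (zeros_upto (bessel_J_deriv \<nu> (Suc N)) X) \<le> card (zeros_upto (bessel_J_deriv \<nu> N) X) + 1"
    by (rule conjunct2[OF card_zeros_upto_le(1)[OF fin(1) sep1]])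
  show "card (zeros_upto (bessel_J_deriv \<nu> N) X) \<le> card (zeros_upto (bessel_J_deriv \<nu> (Suc N)) X) + 1"
    by (rule conjunct2[OF card_zeros_upto_le(1)[OF fin(2) sep2]])
  show "card (zeros_upto (bessel_J_deriv \<nu> N) X) \<le> card (zeros_upto (bessel_J_deriv \<nu> (Suc N)) X)" if "real N < \<nu>"
    by (rule conjunct2[OF card_zeros_upto_le(2)[OF fin(2) sep2]])
       (use bessel_J_deriv_zero_below[OF that] less_imp_le in blast)+
  show "card (zeros_upto (bessel_J_deriv \<nu> (Suc N)) X) \<le> card (zeros_upto (bessel_J_deriv \<nu> N) X)" if "real N = \<nu>"
    by (rule conjunct2[OF card_zeros_upto_le(2)[OF fin(1) sep1]])
       (use bessel_J_deriv_no_zero_before[OF that] less_imp_le in blast)+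
qed

section \<open>Comparison of Bessel functions of different orders\<close>

lemma rolle_bessel_order_up:
  assumes \<nu>: "\<nu> \<ge> 0" and "0 < a" "a < b" "bessel_J \<nu> a = 0" "bessel_J \<nu> b = 0"
  shows "\<exists>c>a. c < b \<and> bessel_J (\<nu> + 1) c = 0"
proof -
  \<comment> \<open>This is x^(-\<nu>) J_\<nu>, whose derivative is - x^(-\<nu>)
    J_(\<nu>+1).\<close>
  let ?g = "\<lambda>x. bessel_series \<nu> 0 (x\<^sup>2)"
  have "\<exists>z>a. z < b \<and> - (z * bessel_series (\<nu> + 1) 0 (z\<^sup>2)) = 0"
  proof (rule Rolle_zeros[where g = ?g])
    show "continuous_on {a..b} ?g" by (rule continuous_on_bessel_series_square[OF \<nu>])
    show "?g a = 0" "?g b = 0" using assms bessel_J_eq[OF \<nu>, of a] bessel_J_eq[OF \<nu>, of b] by auto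
    fix x :: real
    have "(?g has_real_derivative bessel_series' \<nu> 0 (x\<^sup>2) * (2 * x)) (at x)"
      by (rule DERIV_chain2[OF DERIV_bessel_series[OF \<nu>]]) (auto intro!: derivative_eq_intros)
    also have "bessel_series' \<nu> 0 (x\<^sup>2) * (2 * x) = x * (2 * bessel_series' \<nu> 0 (x\<^sup>2))" by simp
    finally show "(?g has_real_derivative - (x * bessel_series (\<nu> + 1) 0 (x\<^sup>2))) (at x)"
      unfolding bessel_series'_0_eq[OF \<nu>] by simp
  qed (use assms in auto)
  then obtain z where "z > a" "z < b" "bessel_series (\<nu> + 1) 0 (z\<^sup>2) = 0" using assms(2) by auto
  then show ?thesis using bessel_J_eq[of "\<nu> + 1" z] \<nu> assms(2) by (intro exI[of _ z]) auto
qed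

text \<open>Sturm comparison: \<open>W\<close> increases on \<open>(a, b)\<close>, but it is nonnegative at \<open>a\<close> and negative at \<open>b\<close>.\<close>

lemma sturm_comparison_core:
  fixes u u1 v v1 W :: "real \<Rightarrow> real"
  assumes ab: "0 \<le> a" "a < b"
    and du: "\<And>x. x > 0 \<Longrightarrow> (u has_real_derivative u1 x) (at x)"
    and dv: "\<And>x. x > 0 \<Longrightarrow> (v has_real_derivative v1 x) (at x)"
    and W: "\<And>x. W x = x * (u x * v1 x - u1 x * v x)"
    and dW: "\<And>x. x > 0 \<Longrightarrow> (W has_real_derivative q x * (u x * v x)) (at x)"
    and q: "\<And>x. x > 0 \<Longrightarrow> q x \<ge> 0"
    and u: "\<And>x. a < x \<Longrightarrow> x \<le> b \<Longrightarrow> u x > 0"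
    and v: "\<And>x. a < x \<Longrightarrow> x < b \<Longrightarrow> v x > 0"
    and vb: "v b = 0" "v1 b \<noteq> 0"
    and left: "(a = 0 \<and> (W \<longlongrightarrow> 0) (at_right 0)) \<or> (a > 0 \<and> v a = 0)"
  shows False
proof -
  have b: "b > 0" using ab by simp
  have v1b: "v1 b < 0"
  proof (rule ccontr)
    assume "\<not> v1 b < 0"
    then have "v1 b > 0" using vb by simp
    then obtain d where d: "d > 0" "\<And>h. h > 0 \<Longrightarrow> h < d \<Longrightarrow> v (b - h) < v b"
      using DERIV_pos_inc_left[OF dv[OF b]] by blast
    obtain h where h: "0 < h" "h < min d (b - a)" using dense[of 0 "min d (b - a)"] d(1) ab(2) by auto
    then have "h < d" "a < b - h" "b - h < b" by auto
    then show False using h(1) d(2)[of h] v[of "b - h"] vb by simp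
  qed
  have Wb: "W b < 0"
    unfolding W using v1b u[of b] ab b vb by (simp add: mult_pos_neg)
  have mono: "W x \<le> W b" if x: "a < x" "x < b" for x
  proof (rule DERIV_nonneg_imp_nondecreasing[where f = W])
    fix y assume y: "x \<le> y" "y \<le> b"
    have y0: "y > 0" using y x ab by simp
    have "u y * v y \<ge> 0" using u[of y] v[of y] vb y x by (cases "y = b") auto
    then show "\<exists>z. (W has_real_derivative z) (at y) \<and> z \<ge> 0"
      using dW[OF y0] q[OF y0] by (intro exI[of _ "q y * (u y * v y)"]) auto
  qed (use x in simp)
  show False
  proof (cases "a = 0")
    case True
    then have "(W \<longlongrightarrow> 0) (at_right 0)" using left by simp
    moreover have "\<forall>\<^sub>F x in at_right 0. W x \<le> W b"
      using mono True b by (auto simp: eventually_at_right_field intro!: exI[of _ b])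
    ultimately have "0 \<le> W b" by (intro tendsto_upperbound[OF _ _ trivial_limit_at_right_real])
    then show False using Wb by simp
  next
    case False
    then have a: "a > 0" "v a = 0" using left ab by auto
    have v1a: "v1 a \<ge> 0"
    proof (rule ccontr)
      assume "\<not> v1 a \<ge> 0"
      then have "v1 a < 0" by simp
      then obtain d where d: "d > 0" "\<And>h. h > 0 \<Longrightarrow> h < d \<Longrightarrow> v (a + h) < v a"
        using DERIV_neg_dec_right[OF dv[OF a(1)]] by blast
      obtain h where h: "0 < h" "h < min d (b - a)" using dense[of 0 "min d (b - a)"] d(1) ab(2) by auto
      then have "h < d" "a < a + h" "a + h < b" by auto
      then show False using h(1) d(2)[of h] v[of "a + h"] a by simp
    qed
    have ua: "u a \<ge> 0"
    proof -
      have "isCont u a" by (rule DERIV_isCont[OF du[OF a(1)]])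
      then have "(u \<longlongrightarrow> u a) (at_right a)" by (rule isCont_tendsto_at_right)
      moreover have "\<forall>\<^sub>F x in at_right a. 0 \<le> u x"
        using u ab by (auto simp: eventually_at_right_field intro!: exI[of _ b] less_imp_le)
      ultimately show ?thesis by (intro tendsto_lowerbound[OF _ _ trivial_limit_at_right_real])
    qed
    have Wa: "W a \<ge> 0" unfolding W using a ua v1a by simp
    have "isCont W a" by (rule DERIV_isCont[OF dW[OF a(1)]])
    then have "(W \<longlongrightarrow> W a) (at_right a)" by (rule isCont_tendsto_at_right)
    moreover have "\<forall>\<^sub>F x in at_right a. W x \<le> W b"
      using mono ab by (auto simp: eventually_at_right_field intro!: exI[of _ b])
    ultimately have "W a \<le> W b" by (intro tendsto_upperbound[OF _ _ trivial_limit_at_right_real])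
    then show False using Wa Wb by simp
  qed
qed

text \<open>As x J' is again x^\<nu> times a continuous series, the expression is x^(\<nu> + \<mu>)
  times a function continuous at 0.\<close>

lemma bessel_wronskian_small:
  assumes "\<nu> \<ge> 0" "\<mu> \<ge> 0" "\<nu> + \<mu> > 0"
  shows "((\<lambda>x. x * (bessel_J \<nu> x * bessel_J_deriv \<mu> 1 x - bessel_J_deriv \<nu> 1 x * bessel_J \<mu> x)) \<longlongrightarrow> 0) (at_right 0)"
proof -
  let ?D = "\<lambda>x. bessel_series \<nu> 0 (x\<^sup>2) * bessel_series \<mu> 1 (x\<^sup>2) - bessel_series \<nu> 1 (x\<^sup>2) * bessel_series \<mu> 0 (x\<^sup>2)"
  have c: "isCont (\<lambda>x. bessel_series \<rho> N (x\<^sup>2)) 0" if "\<rho> \<ge> 0" for \<rho> N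
    using continuous_on_bessel_series_square[OF that, of UNIV N] by (simp add: continuous_on_eq_continuous_at)
  have "isCont ?D 0" using assms by (intro continuous_intros c)
  then have "(?D \<longlongrightarrow> ?D 0) (at_right 0)" by (rule isCont_tendsto_at_right)
  moreover have "((\<lambda>x. x powr (\<nu> + \<mu>)) \<longlongrightarrow> 0) (at_right (0::real))"
    using assms by (intro tendsto_eq_intros) (auto simp: eventually_at_filter)
  ultimately have "((\<lambda>x. x powr (\<nu> + \<mu>) * ?D x) \<longlongrightarrow> 0 * ?D 0) (at_right 0)" by (intro tendsto_mult)
  moreover have "\<forall>\<^sub>F x in at_right 0. x powr (\<nu> + \<mu>) * ?D x
     = x * (bessel_J \<nu> x * bessel_J_deriv \<mu> 1 x - bessel_J_deriv \<nu> 1 x * bessel_J \<mu> x)"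
    using eventually_at_right_less[of "0::real"]
  proof eventually_elim
    case (elim x)
    have p: "x powr (\<rho> - real 1) = x powr \<rho> / x" for \<rho> using elim by (simp add: powr_diff)
    show ?case
      unfolding bessel_J_eq[OF assms(1) elim] bessel_J_eq[OF assms(2) elim] bessel_J_deriv_eq[OF assms(1) elim] bessel_J_deriv_eq[OF assms(2) elim] p powr_add
      using elim by (simp add: field_simps)
  qed
  ultimately show ?thesis by (simp add: filterlim_cong)
qed

text \<open>The case a = 0 is included because it makes the counts comparable without a loss of one.
  The Sturm argument wants positive functions on an interval ending at the next zero of J_\<mu>;
  passing to the least zero above a and multiplying by signs \<sigma> and \<tau> provides
  this.\<close>

lemma bessel_sturm:
  assumes \<nu>: "0 \<le> \<nu>" "\<nu> < \<mu>" and ab: "0 \<le> a" "a < b" "a = 0 \<or> bessel_J \<mu> a = 0" "bessel_J \<mu> b = 0"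
  shows "\<exists>c>a. c \<le> b \<and> bessel_J \<nu> c = 0"
proof -
  have \<mu>: "\<mu> \<ge> 0" using \<nu> by simp
  define Z where "Z = {y. a < y \<and> y \<le> b \<and> bessel_J \<mu> y = 0}"
  have "finite Z" by (rule finite_subset[OF _ finite_zeros_bessel_J[OF \<mu>, of b]]) (use ab in \<open>auto simp: Z_def zeros_upto_def\<close>)
  moreover have "b \<in> Z" using ab by (simp add: Z_def)
  ultimately have m: "Min Z \<in> Z" "\<And>y. y \<in> Z \<Longrightarrow> Min Z \<le> y" by (auto intro: Min_in)
  define b' where "b' = Min Z"
  have b': "a < b'" "b' \<le> b" "bessel_J \<mu> b' = 0" using m(1) by (auto simp: Z_def b'_def)
  have vne: "bessel_J \<mu> x \<noteq> 0" if "a < x" "x < b'" for x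
    using m(2)[of x] that b' by (force simp: Z_def b'_def)
  show ?thesis
  proof (rule ccontr)
    assume no: "\<not> ?thesis"
    then have une: "bessel_J \<nu> x \<noteq> 0" if "a < x" "x \<le> b'" for x using that b' by force
    have b0: "b' > 0" using b' ab by simp
    have dJ: "(bessel_J \<rho> has_real_derivative bessel_J_deriv \<rho> 1 x) (at x)" if "\<rho> \<ge> 0" "x > 0" for \<rho> x
      using DERIV_bessel_J_deriv[OF that, of 0] by (simp add: bessel_J_deriv_0)
    have const_sign: "\<exists>\<sigma>. (\<sigma> = 1 \<or> \<sigma> = -1) \<and> (\<forall>x. a < x \<longrightarrow> P x \<longrightarrow> \<sigma> * bessel_J \<rho> x > 0)"
      if \<rho>: "\<rho> \<ge> 0" and ne: "\<And>x. a < x \<Longrightarrow> P x \<Longrightarrow> bessel_J \<rho> x \<noteq> 0"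
        and P: "\<And>x y. P y \<Longrightarrow> x \<le> y \<Longrightarrow> P x" for \<rho> P
    proof -
      have same: "bessel_J \<rho> x * bessel_J \<rho> y > 0" if xy: "a < x" "x \<le> y" "P y" for x y
      proof (rule ccontr)
        assume "\<not> ?thesis"
        then have neg: "bessel_J \<rho> x * bessel_J \<rho> y < 0"
          using ne[of x] ne[of y] P[of y x] xy by (auto simp: not_less le_less)
        have cont: "continuous_on {x..y} (bessel_J \<rho>)"
          unfolding bessel_J_deriv_0[symmetric] using xy ab by (intro continuous_on_bessel_J_deriv \<rho>) auto
        have "\<exists>z\<ge>x. z \<le> y \<and> bessel_J \<rho> z = 0"
        proof (cases "bessel_J \<rho> x < 0")
          case True
          then show ?thesis using neg xy cont by (intro IVT') (auto simp: mult_less_0_iff)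
        next
          case False
          then show ?thesis using neg xy cont by (intro IVT2') (auto simp: mult_less_0_iff)
        qed
        then show False using ne P xy by (meson less_le_trans)
      qed
      show ?thesis
      proof (cases "\<exists>y>a. P y \<and> bessel_J \<rho> y < 0")
        case True
        then obtain y where y: "y > a" "P y" "bessel_J \<rho> y < 0" by blast
        have "-1 * bessel_J \<rho> x > 0" if "a < x" "P x" for x
          using same[of x y] same[of y x] y that by (cases "x \<le> y") (auto simp: zero_less_mult_iff)
        then show ?thesis by blast
      next
        case False
        then have "1 * bessel_J \<rho> x > 0" if "a < x" "P x" for x
          using ne[of x] that by (force simp: not_less le_less)
        then show ?thesis by blast
      qed
    qed
    obtain \<sigma> where \<sigma>: "\<sigma> = 1 \<or> \<sigma> = -1" "\<And>x. a < x \<Longrightarrow> x \<le> b' \<Longrightarrow> \<sigma> * bessel_J \<nu> x > 0"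
      using const_sign[OF \<nu>(1), of "\<lambda>x. x \<le> b'"] une by auto
    obtain \<tau> where \<tau>: "\<tau> = 1 \<or> \<tau> = -1" "\<And>x. a < x \<Longrightarrow> x < b' \<Longrightarrow> \<tau> * bessel_J \<mu> x > 0"
      using const_sign[OF \<mu>, of "\<lambda>x. x < b'"] vne by auto
    let ?V = "\<lambda>x. x * (bessel_J \<nu> x * bessel_J_deriv \<mu> 1 x - bessel_J_deriv \<nu> 1 x * bessel_J \<mu> x)"
    let ?W = "\<lambda>x. x * ((\<sigma> * bessel_J \<nu> x) * (\<tau> * bessel_J_deriv \<mu> 1 x) - (\<sigma> * bessel_J_deriv \<nu> 1 x) * (\<tau> * bessel_J \<mu> x))"
    have WW0: "?W = (\<lambda>x. \<sigma> * \<tau> * ?V x)" by (simp add: fun_eq_iff algebra_simps)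
    show False
    proof (rule sturm_comparison_core[where W = ?W and q = "\<lambda>x. (\<mu>\<^sup>2 - \<nu>\<^sup>2) / x" and a = a and b = b'
          and u = "\<lambda>x. \<sigma> * bessel_J \<nu> x" and v = "\<lambda>x. \<tau> * bessel_J \<mu> x"])
      show "((\<lambda>x. \<sigma> * bessel_J \<nu> x) has_real_derivative \<sigma> * bessel_J_deriv \<nu> 1 x) (at x)" if "x > 0" for x
        by (intro DERIV_cmult dJ \<nu> that)
      show "((\<lambda>x. \<tau> * bessel_J \<mu> x) has_real_derivative \<tau> * bessel_J_deriv \<mu> 1 x) (at x)" if "x > 0" for x
        by (intro DERIV_cmult dJ \<mu> that)
      show "(?W has_real_derivative (\<mu>\<^sup>2 - \<nu>\<^sup>2) / x * ((\<sigma> * bessel_J \<nu> x) * (\<tau> * bessel_J \<mu> x))) (at x)" if x: "x > 0" for x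
      proof -
        have "(?V has_real_derivative (\<mu>\<^sup>2 - \<nu>\<^sup>2) / x * (bessel_J \<nu> x * bessel_J \<mu> x)) (at x)"
          by (rule DERIV_cong[OF DERIV_mult[OF DERIV_ident DERIV_diff[OF DERIV_mult[OF dJ[OF \<nu>(1) x] bessel_ODE[OF \<mu> x]] DERIV_mult[OF bessel_ODE[OF \<nu>(1) x] dJ[OF \<mu> x]]]]])
             (use x in \<open>simp add: field_simps power2_eq_square\<close>)
        from DERIV_cmult[OF this, of "\<sigma> * \<tau>"] show ?thesis unfolding WW0 by (rule DERIV_cong) (simp add: mult_ac)
      qed
      show "(\<mu>\<^sup>2 - \<nu>\<^sup>2) / x \<ge> 0" if "x > 0" for x using \<nu> that by (simp add: power_mono)
      show "\<tau> * bessel_J_deriv \<mu> 1 b' \<noteq> 0" using \<tau>(1) bessel_J_simple_zero[OF \<mu> b0 b'(3)] by auto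
      show "(a = 0 \<and> (?W \<longlongrightarrow> 0) (at_right 0)) \<or> (a > 0 \<and> \<tau> * bessel_J \<mu> a = 0)"
      proof (cases "a = 0")
        case True
        have "(?W \<longlongrightarrow> \<sigma> * \<tau> * 0) (at_right 0)"
          unfolding WW0 using \<nu> by (intro tendsto_mult tendsto_const bessel_wronskian_small) auto
        then show ?thesis using True by simp
      qed (use ab in auto)
    qed (use ab b' \<sigma> \<tau> in auto)
  qed
qed

lemma card_zeros_bessel_J_antimono:
  assumes "0 \<le> \<nu>" "\<nu> \<le> \<mu>"
  shows "card (zeros_upto (bessel_J \<mu>) X) \<le> card (zeros_upto (bessel_J \<nu>) X)"
proof (cases "\<nu> = \<mu>")
  case False
  then have lt: "\<nu> < \<mu>" using assms by simp
  show ?thesis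
    by (rule conjunct2[OF card_zeros_upto_le(2)[OF finite_zeros_bessel_J[OF assms(1)]]])
       (use bessel_sturm[OF assms(1) lt] in auto)
qed simp

lemma card_zeros_bessel_J_Suc:
  assumes "0 \<le> \<nu>"
  shows "card (zeros_upto (bessel_J (\<nu> + 1)) X) \<le> card (zeros_upto (bessel_J \<nu>) X)"
    and "card (zeros_upto (bessel_J \<nu>) X) \<le> card (zeros_upto (bessel_J (\<nu> + 1)) X) + 1"
proof -
  show "card (zeros_upto (bessel_J (\<nu> + 1)) X) \<le> card (zeros_upto (bessel_J \<nu>) X)"
    using assms by (intro card_zeros_bessel_J_antimono) auto
  have sep: "\<exists>c>a. c \<le> b \<and> bessel_J (\<nu> + 1) c = 0" if "0 < a" "a < b" "bessel_J \<nu> a = 0" "bessel_J \<nu> b = 0" for a b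
    using rolle_bessel_order_up[OF assms that] less_imp_le by blast
  have "finite (zeros_upto (bessel_J (\<nu> + 1)) X)" using assms by (intro finite_zeros_bessel_J) auto
  from conjunct2[OF card_zeros_upto_le(1)[OF this sep]]
  show "card (zeros_upto (bessel_J \<nu>) X) \<le> card (zeros_upto (bessel_J (\<nu> + 1)) X) + 1" .
qed

section \<open>Determination of the offsets\<close>

lemma has_offset_bessel_J_exists:
  assumes "\<nu> \<ge> 0"
  shows "\<exists>e. has_offset (bessel_J \<nu>) (\<nu> * pi / 2 - pi / 4) e"
proof -
  obtain z where "\<forall>\<^sub>F k in sequentially. window_zero (bessel_J_deriv \<nu> 0) (bessel_beta \<nu> 0) k (z k)"
    using bessel_window_zeros[OF assms, of 0] by blast
  then have "\<forall>\<^sub>F k in sequentially. window_zero (bessel_J \<nu>) (\<nu> * pi / 2 - pi / 4) k (z k)"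
    by (simp add: bessel_J_deriv_0)
  from has_offset_exists[OF finite_zeros_bessel_J[OF assms] this] show ?thesis by blast
qed

text \<open>For \<nu> = 1/2 the exponent \<nu> - 1/2 is 0, the Hankel integral is 1 / x, and J is a
  multiple of sin x / sqrt x. Its zeros up to k pi + s are pi, 2 pi, ..., k pi.\<close>

lemma has_offset_bessel_J_half: "has_offset (bessel_J (1/2)) 0 0"
proof -
  have h: "hankel_integral (1/2) 0 x = of_real (1 / x)" if "x > 0" for x
  proof -
    have k: "hankel_kernel (1/2) 0 = (\<lambda>s. of_real (s powr 0))"
    proof
      fix s
      have "1 + \<i> * complex_of_real s / 2 \<noteq> 0" by (auto simp: complex_eq_iff)
      then show "hankel_kernel (1/2) 0 s = of_real (s powr 0)" by (simp add: hankel_kernel_def hankel_factor_def powr_def)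
    qed
    have "hankel_integral (1/2) 0 x = laplace (\<lambda>s. of_real (s powr 0)) x" by (simp only: hankel_integral_def k)
    also have "\<dots> = of_real (Gamma (0 + 1) / x powr (0 + 1))" using that by (intro laplace_powr(2)) auto
    finally show ?thesis using that by simp
  qed
  obtain \<kappa> where \<kappa>: "\<kappa> \<noteq> 0" "\<And>x. x > 0 \<Longrightarrow> bessel_J (1/2) x = \<kappa> * Re (hankel_fun (1/2) x)"
    using bessel_J_eq_hankel[of "1/2"] by auto
  have zero: "bessel_J (1/2) x = 0 \<longleftrightarrow> sin x = 0" if x: "x > 0" for x
  proof -
    have "- (1/2 * pi / 2 + pi / 4) = - (pi / 2)" by simp
    then have ph: "hankel_phase (1/2) = cis (- (pi / 2))" unfolding hankel_phase_def by (rule arg_cong)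
    have "hankel_fun (1/2) x = of_real (x powr (1/2) / x) * (cis (- (pi / 2)) * cis x)"
      unfolding hankel_fun_def h[OF x] ph by simp
    then have "Re (hankel_fun (1/2) x) = x powr (1/2) / x * cos (- (pi / 2) + x)"
      by (simp only: Re_of_real_mult cis_mult cis.sel)
    also have "cos (- (pi / 2) + x) = sin x" by (simp only: cos_add cos_minus sin_minus cos_pi_half sin_pi_half)
    finally show ?thesis using \<kappa> x by simp
  qed
  have card: "card (zeros_upto (bessel_J (1/2)) (real k * pi + s)) = k" if s: "pi / 4 \<le> s" "s \<le> 3 * pi / 4" for k s
  proof -
    have "zeros_upto (bessel_J (1/2)) (real k * pi + s) = (\<lambda>j. real j * pi) ` {1..k}"
    proof (intro set_eqI iffI)
      fix x assume "x \<in> zeros_upto (bessel_J (1/2)) (real k * pi + s)"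
      then have x: "x > 0" "x \<le> real k * pi + s" "sin x = 0" using zero by (auto simp: zeros_upto_def)
      then obtain i :: int where i: "x = of_int i * pi" by (auto simp: sin_zero_iff_int2)
      have "i > 0" using x(1) i by (simp add: zero_less_mult_iff)
      moreover have "of_int i * pi < (real k + 1) * pi"
      proof -
        have "of_int i * pi < real k * pi + pi" using x(2) i s pi_gt_zero by linarith
        then show ?thesis by (simp only: distrib_right mult_1)
      qed
      then have "of_int i < real k + 1" by simp
      then have "i \<le> int k" by linarith
      ultimately show "x \<in> (\<lambda>j. real j * pi) ` {1..k}" using i by (intro image_eqI[of _ _ "nat i"]) auto
    next
      fix x assume "x \<in> (\<lambda>j. real j * pi) ` {1..k}"
      then obtain j where j: "1 \<le> j" "j \<le> k" "x = real j * pi" by auto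
      then have "x > 0" "sin x = 0" by (auto simp: sin_npi)
      moreover have "real j * pi \<le> real k * pi" using j by simp
      then have "x \<le> real k * pi + s" using j(3) s pi_gt_zero by linarith
      ultimately show "x \<in> zeros_upto (bessel_J (1/2)) (real k * pi + s)" using zero by (simp add: zeros_upto_def)
    qed
    then show ?thesis by (simp add: card_image inj_on_def)
  qed
  show ?thesis unfolding has_offset_def using card by (intro always_eventually) simp
qed

text \<open>Raising the order by one moves the grid by pi/2, and the zeros of the lower order come
  first; this is the comparison \<open>has_offset_quarter_shift\<close> with c = 0.\<close>

lemma has_offset_bessel_J_Suc:
  assumes "\<nu> \<ge> 0"
  shows "has_offset (bessel_J (\<nu> + 1)) ((\<nu> + 1) * pi / 2 - pi / 4) e \<longleftrightarrow> has_offset (bessel_J \<nu>) (\<nu> * pi / 2 - pi / 4) e"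
proof -
  have eq: "d = e" if "has_offset (bessel_J (\<nu> + 1)) ((\<nu> + 1) * pi / 2 - pi / 4) e" "has_offset (bessel_J \<nu>) (\<nu> * pi / 2 - pi / 4) d" for d e
  proof -
    have beta: "\<nu> * pi / 2 - pi / 4 = ((\<nu> + 1) * pi / 2 - pi / 4) - pi / 2" by (simp add: field_simps)
    have "d = e - 0"
    proof (rule has_offset_quarter_shift[OF that(1) that(2)[unfolded beta]])
      fix X
      show "int (card (zeros_upto (bessel_J (\<nu> + 1)) X)) \<le> int (card (zeros_upto (bessel_J \<nu>) X)) + 0"
        "int (card (zeros_upto (bessel_J \<nu>) X)) \<le> int (card (zeros_upto (bessel_J (\<nu> + 1)) X)) + (1 - 0)"
        using card_zeros_bessel_J_Suc[OF assms, of X] by linarith+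
    qed
    then show ?thesis by simp
  qed
  obtain d where "has_offset (bessel_J \<nu>) (\<nu> * pi / 2 - pi / 4) d" using has_offset_bessel_J_exists[OF assms] by blast
  moreover obtain d' where "has_offset (bessel_J (\<nu> + 1)) ((\<nu> + 1) * pi / 2 - pi / 4) d'"
    using has_offset_bessel_J_exists[of "\<nu> + 1"] assms by auto
  ultimately show ?thesis using eq by metis
qed

text \<open>The half-integer orders inherit the offset 0 from order 1/2. Any other order above 1/2
  lies between two of them at distance 1, and monotonicity in the order squeezes its offset; smaller
  orders are reached from \<nu> + 1.\<close>

lemma has_offset_bessel_J:
  assumes "\<nu> \<ge> 0"
  shows "has_offset (bessel_J \<nu>) (\<nu> * pi / 2 - pi / 4) 0"
proof -
  have half: "has_offset (bessel_J (real n + 1/2)) ((real n + 1/2) * pi / 2 - pi / 4) 0" for n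
  proof (induction n)
    case 0
    then show ?case using has_offset_bessel_J_half by simp
  next
    case (Suc n)
    have "real (Suc n) + 1/2 = (real n + 1/2) + 1" by simp
    then show ?case using Suc has_offset_bessel_J_Suc[of "real n + 1/2" 0] by (simp only:)
  qed
  have mono: "e \<le> d" if "has_offset (bessel_J \<mu>) (\<mu> * pi / 2 - pi / 4) e" "has_offset (bessel_J \<rho>) (\<rho> * pi / 2 - pi / 4) d"
    "0 \<le> \<rho>" "\<rho> \<le> \<mu>" "\<mu> \<le> \<rho> + 1" for \<mu> \<rho> e d
  proof (rule has_offset_mono[OF that(1,2)])
    have "\<rho> * pi \<le> \<mu> * pi" "\<mu> * pi \<le> (\<rho> + 1) * pi" using that by (auto intro!: mult_right_mono)
    then show "\<rho> * pi / 2 - pi / 4 \<le> \<mu> * pi / 2 - pi / 4" "\<mu> * pi / 2 - pi / 4 \<le> \<rho> * pi / 2 - pi / 4 + pi / 2"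
      by (simp_all add: algebra_simps)
  qed (rule card_zeros_bessel_J_antimono[OF that(3,4)])
  have ge: "has_offset (bessel_J \<rho>) (\<rho> * pi / 2 - pi / 4) 0" if \<rho>: "\<rho> \<ge> 1/2" for \<rho>
  proof -
    define n where "n = nat \<lfloor>\<rho> - 1/2\<rfloor>"
    have n: "real n + 1/2 \<le> \<rho>" "\<rho> \<le> real (Suc n) + 1/2" using \<rho> unfolding n_def by linarith+
    obtain e where e: "has_offset (bessel_J \<rho>) (\<rho> * pi / 2 - pi / 4) e" using has_offset_bessel_J_exists[of \<rho>] \<rho> by auto
    have "e \<le> 0" by (rule mono[OF e half[of n]]) (use n in auto)
    moreover have "0 \<le> e" by (rule mono[OF half[of "Suc n"] e]) (use n \<rho> in auto)
    ultimately show ?thesis using e by simp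
  qed
  show ?thesis using ge[of "\<nu> + 1"] has_offset_bessel_J_Suc[OF assms, of 0] assms by simp
qed

lemma has_offset_bessel_J_deriv_exists:
  assumes "\<nu> \<ge> 0" "real N \<le> \<nu> + 1"
  shows "\<exists>e. has_offset (bessel_J_deriv \<nu> N) (bessel_beta \<nu> N) e"
proof -
  obtain z where "\<forall>\<^sub>F k in sequentially. window_zero (bessel_J_deriv \<nu> N) (bessel_beta \<nu> N) k (z k)"
    using bessel_window_zeros[OF assms(1), of N] by blast
  from has_offset_exists[OF finite_zeros_bessel_J_deriv[OF assms] this] show ?thesis by blast
qed

text \<open>For N = \<nu> one zero of the next derivative sits at x = 0 and is not counted, hence
  the drop by one.\<close>

lemma has_offset_bessel_J_deriv_Suc:
  assumes "\<nu> \<ge> 0" "real N \<le> \<nu>" "has_offset (bessel_J_deriv \<nu> N) (bessel_beta \<nu> N) e"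
  shows "has_offset (bessel_J_deriv \<nu> (Suc N)) (bessel_beta \<nu> (Suc N)) (if real N = \<nu> then e - 1 else e)"
proof -
  have beta: "bessel_beta \<nu> (Suc N) = bessel_beta \<nu> N - pi / 2" by (simp add: field_simps)
  obtain d where d: "has_offset (bessel_J_deriv \<nu> (Suc N)) (bessel_beta \<nu> (Suc N)) d"
    using has_offset_bessel_J_deriv_exists[OF assms(1), of "Suc N"] assms(2) by auto
  have "d = e - (if real N = \<nu> then 1 else 0)"
  proof (rule has_offset_quarter_shift[OF assms(3) d[unfolded beta]])
    fix X
    note le = card_zeros_bessel_J_deriv_Suc[OF assms(1,2), of X]
    show "int (card (zeros_upto (bessel_J_deriv \<nu> N) X)) \<le> int (card (zeros_upto (bessel_J_deriv \<nu> (Suc N)) X)) + (if real N = \<nu> then 1 else 0)"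
      using le(2,3) assms(2) by (cases "real N = \<nu>") (simp_all, linarith?)
    show "int (card (zeros_upto (bessel_J_deriv \<nu> (Suc N)) X)) \<le> int (card (zeros_upto (bessel_J_deriv \<nu> N) X)) + (1 - (if real N = \<nu> then 1 else 0))"
      using le(1,4) by (cases "real N = \<nu>") (simp_all, linarith?)
  qed
  then show ?thesis using d by (cases "real N = \<nu>") auto
qed

lemma has_offset_bessel_J_deriv:
  assumes "real N \<le> \<nu>"
  shows "has_offset (bessel_J_deriv \<nu> N) (bessel_beta \<nu> N) 0"
  using assms
proof (induction N)
  case 0
  then show ?case using has_offset_bessel_J[of \<nu>] by (simp add: bessel_J_deriv_0)
next
  case (Suc N)
  then show ?case using has_offset_bessel_J_deriv_Suc[of \<nu> N 0] by simp
qed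

section \<open>Expansions in powers of a null sequence\<close>

text \<open>The polynomial may depend on M and carry surplus high terms. Leaving its coefficients
  anonymous makes closure under sums, products and composition immediate; they are recovered at the
  end by uniqueness.\<close>

definition poly_expansion :: "(nat \<Rightarrow> real) \<Rightarrow> nat \<Rightarrow> (nat \<Rightarrow> real) \<Rightarrow> bool" where
  "poly_expansion w M f \<longleftrightarrow> (\<exists>p. (\<lambda>k. f k - poly p (w k)) \<in> O(\<lambda>k. w k ^ M))"

lemma poly_bigo_1:
  assumes "w \<longlonglongrightarrow> (0::real)"
  shows "(\<lambda>k. poly p (w k)) \<in> O(\<lambda>_. 1)"
proof -
  have "(\<lambda>k. poly p (w k)) \<longlonglongrightarrow> poly p 0" by (intro tendsto_poly assms)
  then show ?thesis by (intro bigoI_tendsto[where c = "poly p 0"]) auto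
qed

lemma power_bigo_mono:
  assumes "w \<longlonglongrightarrow> (0::real)" "M \<le> N"
  shows "(\<lambda>k. w k ^ N) \<in> O(\<lambda>k. w k ^ M)"
proof -
  have "(\<lambda>k. w k ^ M * w k ^ (N - M)) \<in> O(\<lambda>k. w k ^ M * 1)"
    using poly_bigo_1[OF assms(1), of "monom 1 (N - M)"] by (intro landau_o.big.mult) (auto simp: poly_monom)
  then show ?thesis using assms(2) by (simp flip: power_add)
qed

lemma poly_expansion_bounded:
  assumes "poly_expansion w M f" "w \<longlonglongrightarrow> 0"
  shows "f \<in> O(\<lambda>_. 1)"
proof -
  obtain p where p: "(\<lambda>k. f k - poly p (w k)) \<in> O(\<lambda>k. w k ^ M)" using assms by (auto simp: poly_expansion_def)
  have "(\<lambda>k. f k - poly p (w k)) \<in> O(\<lambda>_. 1)"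
    using landau_o.big_trans[OF p power_bigo_mono[OF assms(2), of 0 M]] by simp
  from sum_in_bigo(1)[OF this poly_bigo_1[OF assms(2), of p]] show ?thesis by simp
qed

lemma poly_expansion_poly: "poly_expansion w M (\<lambda>k. poly p (w k))"
  unfolding poly_expansion_def by (intro exI[of _ p]) simp

lemma poly_expansion_const: "poly_expansion w M (\<lambda>k. c)"
  using poly_expansion_poly[of w M "[:c:]"] by simp

lemma poly_expansion_ident: "poly_expansion w M w"
  using poly_expansion_poly[of w M "[:0, 1:]"] by simp

lemma poly_expansion_add:
  assumes "poly_expansion w M f" "poly_expansion w M g"
  shows "poly_expansion w M (\<lambda>k. f k + g k)"
proof -
  obtain p q where "(\<lambda>k. f k - poly p (w k)) \<in> O(\<lambda>k. w k ^ M)" "(\<lambda>k. g k - poly q (w k)) \<in> O(\<lambda>k. w k ^ M)"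
    using assms by (auto simp: poly_expansion_def)
  from sum_in_bigo(1)[OF this]
  have "(\<lambda>k. (f k - poly p (w k)) + (g k - poly q (w k))) \<in> O(\<lambda>k. w k ^ M)" .
  moreover have "(\<lambda>k. (f k - poly p (w k)) + (g k - poly q (w k))) = (\<lambda>k. f k + g k - poly (p + q) (w k))"
    by (simp add: fun_eq_iff)
  ultimately show ?thesis unfolding poly_expansion_def by (intro exI[of _ "p + q"]) (simp only:)
qed

lemma poly_expansion_mult:
  assumes "poly_expansion w M f" "poly_expansion w M g" "w \<longlonglongrightarrow> 0"
  shows "poly_expansion w M (\<lambda>k. f k * g k)"
proof -
  obtain p q where pq: "(\<lambda>k. f k - poly p (w k)) \<in> O(\<lambda>k. w k ^ M)" "(\<lambda>k. g k - poly q (w k)) \<in> O(\<lambda>k. w k ^ M)"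
    using assms by (auto simp: poly_expansion_def)
  have "(\<lambda>k. (f k - poly p (w k)) * g k) \<in> O(\<lambda>k. w k ^ M * 1)"
    by (intro landau_o.big.mult pq poly_expansion_bounded[OF assms(2,3)])
  moreover have "(\<lambda>k. (g k - poly q (w k)) * poly p (w k)) \<in> O(\<lambda>k. w k ^ M * 1)"
    by (intro landau_o.big.mult pq poly_bigo_1 assms(3))
  ultimately have "(\<lambda>k. (f k - poly p (w k)) * g k + (g k - poly q (w k)) * poly p (w k)) \<in> O(\<lambda>k. w k ^ M)"
    unfolding mult_1_right by (rule sum_in_bigo(1))
  moreover have "(\<lambda>k. (f k - poly p (w k)) * g k + (g k - poly q (w k)) * poly p (w k)) = (\<lambda>k. f k * g k - poly (p * q) (w k))"
    by (simp add: fun_eq_iff algebra_simps)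
  ultimately show ?thesis unfolding poly_expansion_def by (intro exI[of _ "p * q"]) (simp only:)
qed

lemma poly_expansion_cmult:
  assumes "poly_expansion w M f" "w \<longlonglongrightarrow> 0"
  shows "poly_expansion w M (\<lambda>k. c * f k)"
  by (rule poly_expansion_mult[OF poly_expansion_const assms])

lemma poly_expansion_diff:
  assumes "poly_expansion w M f" "poly_expansion w M g" "w \<longlonglongrightarrow> 0"
  shows "poly_expansion w M (\<lambda>k. f k - g k)"
proof -
  have "poly_expansion w M (\<lambda>k. f k + -1 * g k)"
    by (rule poly_expansion_add[OF assms(1) poly_expansion_cmult[OF assms(2,3)]])
  moreover have "(\<lambda>k. f k + -1 * g k) = (\<lambda>k. f k - g k)" by (simp add: fun_eq_iff)
  ultimately show ?thesis by (simp only:)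
qed

lemma poly_expansion_power:
  assumes "poly_expansion w M f" "w \<longlonglongrightarrow> 0"
  shows "poly_expansion w M (\<lambda>k. f k ^ n)"
proof (induction n)
  case 0
  show ?case using poly_expansion_const[of w M 1] by simp
next
  case (Suc n)
  show ?case unfolding power_Suc by (rule poly_expansion_mult[OF assms(1) Suc assms(2)])
qed

lemma poly_expansion_sum:
  assumes "finite I" "\<And>i. i \<in> I \<Longrightarrow> poly_expansion w M (f i)"
  shows "poly_expansion w M (\<lambda>k. \<Sum>i\<in>I. f i k)"
  using assms
proof (induction I rule: finite_induct)
  case empty
  show ?case using poly_expansion_const[of w M 0] by simp
next
  case (insert i I)
  then have "poly_expansion w M (\<lambda>k. f i k + (\<Sum>i\<in>I. f i k))" by (intro poly_expansion_add) auto
  then show ?case using insert by simp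
qed

lemma poly_expansion_compose:
  assumes "poly_expansion w M f" "w \<longlonglongrightarrow> 0"
  shows "poly_expansion w M (\<lambda>k. poly q (f k))"
proof (induction q)
  case (pCons a q)
  show ?case
    unfolding poly_pCons
    by (rule poly_expansion_add[OF poly_expansion_const poly_expansion_mult[OF assms(1) pCons(2) assms(2)]])
next
  case 0
  show ?case unfolding poly_0 by (rule poly_expansion_const)
qed

lemma poly_expansion_bigo:
  assumes "poly_expansion w M f" "(\<lambda>k. g k - f k) \<in> O(\<lambda>k. w k ^ M)"
  shows "poly_expansion w M g"
proof -
  obtain p where "(\<lambda>k. f k - poly p (w k)) \<in> O(\<lambda>k. w k ^ M)" using assms by (auto simp: poly_expansion_def)
  from sum_in_bigo(1)[OF assms(2) this]
  have "(\<lambda>k. (g k - f k) + (f k - poly p (w k))) \<in> O(\<lambda>k. w k ^ M)" .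
  moreover have "(\<lambda>k. (g k - f k) + (f k - poly p (w k))) = (\<lambda>k. g k - poly p (w k))" by (simp add: fun_eq_iff)
  ultimately show ?thesis unfolding poly_expansion_def by (intro exI[of _ p]) (simp only:)
qed

text \<open>Multiplication by w gains an order; this drives the bootstrap that re-expands 1 / z^2 in
  powers of 1 / \<phi>^2.\<close>

lemma poly_expansion_shift:
  assumes "poly_expansion w M f"
  shows "poly_expansion w (Suc M) (\<lambda>k. w k * f k)"
proof -
  obtain p where "(\<lambda>k. f k - poly p (w k)) \<in> O(\<lambda>k. w k ^ M)" using assms by (auto simp: poly_expansion_def)
  then have "(\<lambda>k. w k * (f k - poly p (w k))) \<in> O(\<lambda>k. w k * w k ^ M)"
    by (rule landau_o.big.mult[OF landau_o.big_refl])
  moreover have "(\<lambda>k. w k * (f k - poly p (w k))) = (\<lambda>k. w k * f k - poly ([:0, 1:] * p) (w k))"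
    by (simp add: fun_eq_iff algebra_simps)
  ultimately show ?thesis
    unfolding poly_expansion_def by (intro exI[of _ "[:0, 1:] * p"]) (simp only: power_Suc)
qed

lemma bigo_tendsto_0:
  fixes f g :: "nat \<Rightarrow> real"
  assumes "f \<in> O(g)" "g \<longlonglongrightarrow> 0"
  shows "f \<longlonglongrightarrow> 0"
proof -
  obtain c where c: "\<forall>\<^sub>F k in sequentially. norm (f k) \<le> c * norm (g k)"
    using assms(1) by (elim landau_o.bigE)
  have "(\<lambda>k. c * norm (g k)) \<longlonglongrightarrow> c * norm (0::real)" by (intro tendsto_intros assms(2))
  then show ?thesis by (intro Lim_null_comparison[OF c]) simp
qed

text \<open>Geometric series in 1 - f: the remainder after M terms is (1 - f)^M / f.\<close>

lemma poly_expansion_inverse: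
  assumes "poly_expansion w M f" "w \<longlonglongrightarrow> 0" "(\<lambda>k. f k - 1) \<in> O(w)"
  shows "poly_expansion w M (\<lambda>k. inverse (f k))"
proof (rule poly_expansion_bigo)
  show "poly_expansion w M (\<lambda>k. \<Sum>j<M. (1 - f k) ^ j)"
    by (intro poly_expansion_sum finite_lessThan poly_expansion_power poly_expansion_diff poly_expansion_const assms)
  have "(\<lambda>k. f k - 1) \<longlonglongrightarrow> 0" by (rule bigo_tendsto_0[OF assms(3,2)])
  from tendsto_add[OF this tendsto_const[of 1]] have f1: "f \<longlonglongrightarrow> 1" by simp
  then have ne: "\<forall>\<^sub>F k in sequentially. f k \<noteq> 0" by (rule tendsto_imp_eventually_ne) simp
  have inv: "(\<lambda>k. inverse (f k)) \<in> O(\<lambda>_. 1)"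
    using tendsto_inverse[OF f1] by (intro bigoI_tendsto[where c = "inverse 1"]) auto
  have "(\<lambda>k. 1 - f k) \<in> O(w)" using assms(3) by (subst landau_o.big.uminus_in_iff[symmetric]) simp
  then have "(\<lambda>k. (1 - f k) ^ M * inverse (f k)) \<in> O(\<lambda>k. w k ^ M * 1)"
    by (intro landau_o.big.mult landau_o.big_power inv)
  moreover have "\<forall>\<^sub>F k in sequentially. (1 - f k) ^ M * inverse (f k) = inverse (f k) - (\<Sum>j<M. (1 - f k) ^ j)"
    using ne
  proof eventually_elim
    case (elim k)
    have "(1 - f k) ^ M - 1 = - f k * (\<Sum>j<M. (1 - f k) ^ j)" using power_diff_1_eq[of "1 - f k" M] by simp
    then show ?case using elim by (simp add: field_simps)
  qed
  ultimately show "(\<lambda>k. inverse (f k) - (\<Sum>j<M. (1 - f k) ^ j)) \<in> O(\<lambda>k. w k ^ M)"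
    unfolding mult_1_right by (rule landau_o.big.in_cong[THEN iffD1, rotated])
qed

section \<open>Arithmetic of the first two coefficients, and uniqueness of coefficients\<close>

definition linear_expansion :: "(nat \<Rightarrow> real) \<Rightarrow> (nat \<Rightarrow> real) \<Rightarrow> real \<Rightarrow> real \<Rightarrow> bool" where
  "linear_expansion w f a b \<longleftrightarrow> (\<lambda>k. f k - (a + b * w k)) \<in> O(\<lambda>k. w k ^ 2)"

lemma linear_expansion_bounded:
  assumes "linear_expansion w f a b" "w \<longlonglongrightarrow> 0"
  shows "f \<in> O(\<lambda>_. 1)"
proof (rule poly_expansion_bounded[OF _ assms(2)])
  show "poly_expansion w 2 f"
    using assms(1) unfolding linear_expansion_def poly_expansion_def
    by (intro exI[of _ "[:a, b:]"]) (simp add: mult.commute)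
qed

lemma linear_expansion_bigo_w:
  assumes "linear_expansion w f a b" "w \<longlonglongrightarrow> 0"
  shows "(\<lambda>k. f k - a) \<in> O(w)"
proof -
  have "(\<lambda>k. f k - (a + b * w k)) \<in> O(\<lambda>k. w k ^ 1)"
    using landau_o.big_trans[OF _ power_bigo_mono[OF assms(2), of 1 2]] assms(1) by (simp add: linear_expansion_def)
  from sum_in_bigo(1)[OF this, of "\<lambda>k. b * w k"] show ?thesis by simp
qed

lemma linear_expansion_add:
  assumes "linear_expansion w f a b" "linear_expansion w g c d"
  shows "linear_expansion w (\<lambda>k. f k + g k) (a + c) (b + d)"
proof -
  have "(\<lambda>k. (f k - (a + b * w k)) + (g k - (c + d * w k))) = (\<lambda>k. f k + g k - (a + c + (b + d) * w k))"
    by (simp add: fun_eq_iff algebra_simps)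
  then show ?thesis
    using sum_in_bigo(1)[OF assms[unfolded linear_expansion_def]] by (simp only: linear_expansion_def)
qed

lemma linear_expansion_const: "linear_expansion w (\<lambda>_. c) c 0"
  unfolding linear_expansion_def by (simp only: mult_zero_left add_0_right diff_self zero_in_bigo)

lemma linear_expansion_mult:
  assumes f: "linear_expansion w f a b" and g: "linear_expansion w g c d" and w: "w \<longlonglongrightarrow> 0"
  shows "linear_expansion w (\<lambda>k. f k * g k) (a * c) (a * d + b * c)"
proof -
  have "(\<lambda>k. (f k - (a + b * w k)) * g k) \<in> O(\<lambda>k. w k ^ 2 * 1)"
    using f unfolding linear_expansion_def by (intro landau_o.big.mult linear_expansion_bounded[OF g w])
  moreover have "(\<lambda>k. a * (g k - (c + d * w k))) \<in> O(\<lambda>k. w k ^ 2)"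
    using g unfolding linear_expansion_def by simp
  moreover have "(\<lambda>k. (b * w k) * (g k - c)) \<in> O(\<lambda>k. w k * w k)"
    by (intro landau_o.big.mult linear_expansion_bigo_w[OF g w]) simp
  ultimately have "(\<lambda>k. (f k - (a + b * w k)) * g k + (a * (g k - (c + d * w k)) + (b * w k) * (g k - c))) \<in> O(\<lambda>k. w k ^ 2)"
    unfolding mult_1_right power2_eq_square by (intro sum_in_bigo(1))
  moreover have "(\<lambda>k. (f k - (a + b * w k)) * g k + (a * (g k - (c + d * w k)) + (b * w k) * (g k - c)))
      = (\<lambda>k. f k * g k - (a * c + (a * d + b * c) * w k))"
    by (simp add: fun_eq_iff algebra_simps)
  ultimately show ?thesis unfolding linear_expansion_def by (simp only:)
qed

lemma linear_expansion_cmult: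
  assumes "linear_expansion w f a b" "w \<longlonglongrightarrow> 0"
  shows "linear_expansion w (\<lambda>k. c * f k) (c * a) (c * b)"
proof -
  have "linear_expansion w (\<lambda>k. c * f k) (c * a) (c * b + 0 * a)"
    by (rule linear_expansion_mult[OF linear_expansion_const assms])
  then show ?thesis by (simp only: mult_zero_left add_0_right)
qed

lemma linear_expansion_bigo:
  assumes "linear_expansion w f a b" "(\<lambda>k. g k - f k) \<in> O(\<lambda>k. w k ^ 2)"
  shows "linear_expansion w g a b"
proof -
  have "(\<lambda>k. (g k - f k) + (f k - (a + b * w k))) = (\<lambda>k. g k - (a + b * w k))" by (simp add: fun_eq_iff)
  then show ?thesis
    using sum_in_bigo(1)[OF assms(2) assms(1)[unfolded linear_expansion_def]] by (simp only: linear_expansion_def)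
qed

lemma linear_expansion_inverse:
  assumes f: "linear_expansion w f 1 b" and w: "w \<longlonglongrightarrow> 0"
  shows "linear_expansion w (\<lambda>k. inverse (f k)) 1 (- b)"
proof -
  have "poly_expansion w 2 f"
    using f unfolding linear_expansion_def poly_expansion_def by (intro exI[of _ "[:1, b:]"]) (simp add: mult.commute)
  then have "poly_expansion w 2 (\<lambda>k. inverse (f k))"
    by (rule poly_expansion_inverse[OF _ w linear_expansion_bigo_w[OF f w]])
  then have inv: "(\<lambda>k. inverse (f k)) \<in> O(\<lambda>_. 1)" by (rule poly_expansion_bounded[OF _ w])
  have f1: "f \<longlonglongrightarrow> 1"
    using tendsto_add[OF bigo_tendsto_0[OF linear_expansion_bigo_w[OF f w] w] tendsto_const[of 1]] by simp
  then have ne: "\<forall>\<^sub>F k in sequentially. f k \<noteq> 0" by (rule tendsto_imp_eventually_ne) simp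
  have "linear_expansion w (\<lambda>k. f k * (1 + - b * w k)) (1 * 1) (1 * - b + b * 1)"
    by (rule linear_expansion_mult[OF f _ w]) (simp only: linear_expansion_def diff_self zero_in_bigo)
  moreover have "(\<lambda>k. f k * (1 + - b * w k) - (1 * 1 + (1 * - b + b * 1) * w k)) = (\<lambda>k. f k * (1 + - b * w k) - 1)"
    by (simp add: fun_eq_iff)
  ultimately have "(\<lambda>k. f k * (1 + - b * w k) - 1) \<in> O(\<lambda>k. w k ^ 2)" by (simp only: linear_expansion_def)
  moreover have "(\<lambda>k. - inverse (f k)) \<in> O(\<lambda>_. 1)" using inv by simp
  ultimately have "(\<lambda>k. - inverse (f k) * (f k * (1 + - b * w k) - 1)) \<in> O(\<lambda>k. 1 * w k ^ 2)"
    by (intro landau_o.big.mult)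
  moreover have "\<forall>\<^sub>F k in sequentially. - inverse (f k) * (f k * (1 + - b * w k) - 1) = inverse (f k) - (1 + - b * w k)"
    using ne by eventually_elim (simp add: field_simps)
  ultimately show ?thesis
    unfolding linear_expansion_def mult_1_left by (rule landau_o.big.in_cong[THEN iffD1, rotated])
qed

text \<open>Passing to the limit shows that the constant term is 0; division by w lowers the order
  by one, and the argument repeats.\<close>

lemma poly_bigo_power_imp_coeff_zero:
  assumes "w \<longlonglongrightarrow> (0::real)" "\<forall>\<^sub>F k in sequentially. w k \<noteq> 0"
    and "(\<lambda>k. poly p (w k)) \<in> O(\<lambda>k. w k ^ M)" "s < M"
  shows "coeff p s = 0"
  using assms(3,4)
proof (induction M arbitrary: p s)
  case step: (Suc M)
  obtain a q where p: "p = pCons a q" by (cases p)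
  have "(\<lambda>k. w k ^ Suc M) \<longlonglongrightarrow> 0 ^ Suc M" by (intro tendsto_intros assms(1))
  then have "(\<lambda>k. w k ^ Suc M) \<longlonglongrightarrow> 0" by (simp only: power_0_Suc)
  then have "(\<lambda>k. poly p (w k)) \<longlonglongrightarrow> 0" by (rule bigo_tendsto_0[OF step.prems(1)])
  moreover have "(\<lambda>k. poly p (w k)) \<longlonglongrightarrow> poly p 0" by (intro tendsto_poly assms(1))
  ultimately have "poly p 0 = 0" by (metis LIMSEQ_unique)
  then have a: "a = 0" by (simp add: p)
  have "(\<lambda>k. w k * poly q (w k)) \<in> O(\<lambda>k. w k * w k ^ M)"
    using step.prems(1) by (simp only: p a poly_pCons add_0_left power_Suc)
  then have q: "(\<lambda>k. poly q (w k)) \<in> O(\<lambda>k. w k ^ M)"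
    by (rule landau_o.big.mult_cancel_left[OF bigtheta_refl assms(2), THEN iffD1])
  show ?case
  proof (cases s)
    case (Suc s')
    have "coeff q s' = 0" by (rule step.IH[OF q]) (use step.prems(2) Suc in simp)
    then show ?thesis by (simp only: p Suc coeff_pCons_Suc)
  qed (simp only: p a coeff_pCons_0)
next
  case 0
  from 0(2) show ?case by (rule notE[OF not_less_zero])
qed

text \<open>Polynomials for different orders agree in all coefficients that both determine, so
  \<open>c s\<close> may be read from the one of order s + 1. The given linear part is one more such
  approximation and fixes the first two values.\<close>

lemma expansion_coefficients_exist:
  assumes w: "w \<longlonglongrightarrow> (0::real)" "\<forall>\<^sub>F k in sequentially. w k \<noteq> 0"
    and pe: "\<And>M. poly_expansion w M f" and lin: "linear_expansion w f a b"
  shows "\<exists>c. c 0 = a \<and> c (Suc 0) = b \<and> (\<forall>M. (\<lambda>k. f k - (\<Sum>s<M. c s * w k ^ s)) \<in> O(\<lambda>k. w k ^ M))"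
proof -
  have "\<exists>p. (\<lambda>k. f k - poly p (w k)) \<in> O(\<lambda>k. w k ^ M)" for M using pe by (simp add: poly_expansion_def)
  then obtain p where p: "\<And>M. (\<lambda>k. f k - poly (p M) (w k)) \<in> O(\<lambda>k. w k ^ M)" by metis
  define c where "c s = coeff (p (Suc s)) s" for s
  have same: "coeff q s = coeff (p M) s"
    if "(\<lambda>k. f k - poly q (w k)) \<in> O(\<lambda>k. w k ^ L)" "s < M" "s < L" for q s M L
  proof -
    have "(\<lambda>k. f k - poly q (w k)) \<in> O(\<lambda>k. w k ^ Suc s)"
      using landau_o.big_trans[OF that(1) power_bigo_mono[OF w(1), of "Suc s" L]] that(3) by (simp del: power_Suc)
    moreover have "(\<lambda>k. f k - poly (p M) (w k)) \<in> O(\<lambda>k. w k ^ Suc s)"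
      using landau_o.big_trans[OF p[of M] power_bigo_mono[OF w(1), of "Suc s" M]] that(2) by (simp del: power_Suc)
    ultimately have "(\<lambda>k. (f k - poly q (w k)) - (f k - poly (p M) (w k))) \<in> O(\<lambda>k. w k ^ Suc s)"
      by (rule sum_in_bigo(2))
    moreover have "(\<lambda>k. (f k - poly q (w k)) - (f k - poly (p M) (w k))) = (\<lambda>k. poly (p M - q) (w k))"
      by (simp add: fun_eq_iff)
    ultimately have "(\<lambda>k. poly (p M - q) (w k)) \<in> O(\<lambda>k. w k ^ Suc s)" by (simp only:)
    from poly_bigo_power_imp_coeff_zero[OF w this, of s] show ?thesis by simp
  qed
  have cp: "coeff (p M) s = c s" if "s < M" for s M
    unfolding c_def by (rule same[OF p]) (use that in auto)
  have "(\<lambda>k. f k - (\<Sum>s<M. c s * w k ^ s)) \<in> O(\<lambda>k. w k ^ M)" for M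
  proof -
    \<comment> \<open>Removing the terms below degree M leaves surplus terms divisible by w^M, which
      go into the error.\<close>
    define q where "q = p M - (\<Sum>s<M. monom (c s) s)"
    have cq: "coeff q s = 0" if "s < M" for s
      using that cp[of s M] by (simp add: q_def coeff_sum)
    then have "monom 1 M dvd q" by (simp add: monom_1_dvd_iff')
    then obtain r where r: "q = monom 1 M * r" by (elim dvdE)
    have "(\<lambda>k. w k ^ M * poly r (w k)) \<in> O(\<lambda>k. w k ^ M * 1)" by (intro landau_o.big.mult poly_bigo_1 w) simp
    moreover have "(\<lambda>k. w k ^ M * poly r (w k)) = (\<lambda>k. poly q (w k))" by (simp add: fun_eq_iff r poly_monom)
    ultimately have "(\<lambda>k. poly q (w k)) \<in> O(\<lambda>k. w k ^ M)" by (simp only: mult_1_right)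
    from sum_in_bigo(1)[OF p[of M] this]
    have "(\<lambda>k. (f k - poly (p M) (w k)) + poly q (w k)) \<in> O(\<lambda>k. w k ^ M)" .
    moreover have "(\<lambda>k. (f k - poly (p M) (w k)) + poly q (w k)) = (\<lambda>k. f k - (\<Sum>s<M. c s * w k ^ s))"
      by (simp add: fun_eq_iff q_def poly_sum poly_monom)
    ultimately show ?thesis by (simp only:)
  qed
  moreover have lp: "(\<lambda>k. f k - poly [:a, b:] (w k)) \<in> O(\<lambda>k. w k ^ 2)"
  proof -
    have "(\<lambda>k. f k - poly [:a, b:] (w k)) = (\<lambda>k. f k - (a + b * w k))" by (simp add: fun_eq_iff)
    then show ?thesis using lin by (simp only: linear_expansion_def)
  qed
  have "c 0 = a" "c (Suc 0) = b"
    using same[OF lp, of 0 1] same[OF lp, of 1 2] by (simp_all add: c_def numeral_2_eq_2)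
  ultimately show ?thesis by blast
qed

text \<open>By the geometric sum the error has derivative (- x^2)^M / (1 + x^2), at most |x|^(2 M)
  in modulus; the mean value bound then works for every real t.\<close>

lemma arctan_taylor_bound: "\<bar>arctan t - (\<Sum>j<M. (-1) ^ j * t ^ (2 * j + 1) / real (2 * j + 1))\<bar> \<le> \<bar>t\<bar> ^ (2 * M + 1)"
proof -
  define g where "g t = arctan t - (\<Sum>j<M. (-1) ^ j * t ^ (2 * j + 1) / real (2 * j + 1))" for t :: real
  define g' where "g' t = (- (t\<^sup>2)) ^ M / (1 + t\<^sup>2)" for t :: real
  have d: "(g has_real_derivative g' x) (at x)" for x
  proof -
    have dterm: "((\<lambda>t. (-1) ^ j * t ^ (2 * j + 1) / real (2 * j + 1)) has_real_derivative (- (x\<^sup>2)) ^ j) (at x)" for j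
    proof -
      have "((\<lambda>t. (-1) ^ j * t ^ (2 * j + 1) / real (2 * j + 1)) has_real_derivative (-1) ^ j * (real (2 * j + 1) * x ^ (2 * j + 1 - 1)) / real (2 * j + 1)) (at x)"
        by (rule DERIV_cong[OF DERIV_cdivide[OF DERIV_cmult[OF DERIV_pow]]]) simp
      also have "(-1) ^ j * (real (2 * j + 1) * x ^ (2 * j + 1 - 1)) / real (2 * j + 1) = (- (x\<^sup>2)) ^ j"
      proof -
        have "real (2 * j + 1) \<noteq> 0" by linarith
        then have "(-1) ^ j * (real (2 * j + 1) * x ^ (2 * j + 1 - 1)) / real (2 * j + 1) = (-1) ^ j * x ^ (2 * j)" by simp
        then show ?thesis by (simp add: power_mult power_minus[of "x\<^sup>2"])
      qed
      finally show ?thesis .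
    qed
    have "(g has_real_derivative (inverse (1 + x\<^sup>2) - (\<Sum>j<M. (- (x\<^sup>2)) ^ j))) (at x)"
      unfolding g_def by (intro DERIV_diff DERIV_arctan DERIV_sum dterm)
    also have "inverse (1 + x\<^sup>2) - (\<Sum>j<M. (- (x\<^sup>2)) ^ j) = g' x"
    proof -
      have "1 + x\<^sup>2 \<noteq> 0" by (metis add_pos_nonneg less_irrefl zero_le_power2 zero_less_one)
      moreover have "(- (x\<^sup>2)) ^ M - 1 = (- (x\<^sup>2) - 1) * (\<Sum>j<M. (- (x\<^sup>2)) ^ j)" by (rule power_diff_1_eq)
      ultimately show ?thesis by (simp add: g'_def field_simps)
    qed
    finally show ?thesis .
  qed
  have g0: "g 0 = 0" by (simp add: g_def)
  have "norm (g t - g 0) \<le> \<bar>t\<bar> ^ (2 * M) * norm (t - 0)"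
  proof (rule field_differentiable_bound[of "closed_segment 0 t"])
    fix x assume x: "x \<in> closed_segment 0 t"
    show "(g has_field_derivative g' x) (at x within closed_segment 0 t)"
      using d by (rule has_field_derivative_at_within)
    have "\<bar>x\<bar> \<le> \<bar>t\<bar>" using x by (auto simp: closed_segment_eq_real_ivl split: if_splits)
    then have "\<bar>x\<bar> ^ (2 * M) \<le> \<bar>t\<bar> ^ (2 * M)" by (intro power_mono) auto
    moreover have "norm (g' x) \<le> \<bar>x\<bar> ^ (2 * M)"
    proof -
      have "norm (g' x) = \<bar>x\<bar> ^ (2 * M) / (1 + x\<^sup>2)"
        by (simp add: g'_def power_abs power_mult abs_divide)
      also have "\<dots> \<le> \<bar>x\<bar> ^ (2 * M) / 1" by (intro divide_left_mono) (auto simp: add_pos_nonneg)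
      finally show ?thesis by simp
    qed
    ultimately show "norm (g' x) \<le> \<bar>t\<bar> ^ (2 * M)" by linarith
  qed simp_all
  then show ?thesis by (simp add: g0 g_def mult.commute)
qed

section \<open>McMahon expansions\<close>

lemma eventually_eq_imp_diff_bigo:
  fixes f g h :: "nat \<Rightarrow> real"
  assumes "\<forall>\<^sub>F k in sequentially. f k = g k"
  shows "(\<lambda>k. f k - g k) \<in> O(h)"
  by (rule bigoI[of _ 0]) (use assms in \<open>auto elim: eventually_mono\<close>)

text \<open>Even powers of i are real and odd ones imaginary, so the real part is a series in 1 /
  x^2 and the imaginary part 1 / x times such a series. This is why the final expansion has odd
  powers only.\<close>

lemma sum_alternating_complex:
  assumes "x \<noteq> 0"
  shows "(\<Sum>k<2 * M. \<i> ^ k * of_real (b k) / of_real x ^ k) =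
    Complex (\<Sum>p<M. (-1) ^ p * b (2 * p) * (1 / x\<^sup>2) ^ p) ((\<Sum>p<M. (-1) ^ p * b (2 * p + 1) * (1 / x\<^sup>2) ^ p) / x)"
proof (induction M)
  case (Suc M)
  have i: "\<i> ^ (2 * M) = of_real ((-1) ^ M)" by (simp add: power_mult)
  have x: "(1 / x\<^sup>2) ^ M = 1 / x ^ (2 * M)" by (simp add: power_mult power_one_over)
  have 1: "\<i> ^ (2 * M) * of_real (b (2 * M)) / of_real x ^ (2 * M) = Complex ((-1) ^ M * b (2 * M) * (1 / x\<^sup>2) ^ M) 0"
    unfolding i x by (simp add: complex_eq_iff flip: of_real_power of_real_mult of_real_divide)
  have "\<i> ^ Suc (2 * M) * of_real (b (Suc (2 * M))) / of_real x ^ Suc (2 * M)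
      = \<i> * of_real ((-1) ^ M * b (2 * M + 1) / x ^ Suc (2 * M))"
    unfolding power_Suc i by simp
  also have "\<dots> = Complex 0 ((-1) ^ M * b (2 * M + 1) * (1 / x\<^sup>2) ^ M / x)"
    unfolding x by (simp add: complex_eq_iff)
  finally have 2: "\<i> ^ Suc (2 * M) * of_real (b (Suc (2 * M))) / of_real x ^ Suc (2 * M)
      = Complex 0 ((-1) ^ M * b (2 * M + 1) * (1 / x\<^sup>2) ^ M / x)" .
  have e: "2 * Suc M = Suc (Suc (2 * M))" by simp
  show ?case unfolding e sum.lessThan_Suc Suc 1 2 by (simp add: complex_eq_iff add_divide_distrib)
qed (simp add: complex_eq_iff)

lemma has_expansion_Re_Im:
  assumes B: "has_expansion B (\<lambda>k. \<i> ^ k * of_real (b k))" and z: "filterlim z at_top sequentially"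
  shows "(\<lambda>k. Re (B (z k)) - (\<Sum>p<M. (-1) ^ p * b (2 * p) * (1 / (z k)\<^sup>2) ^ p)) \<in> O(\<lambda>k. (1 / (z k)\<^sup>2) ^ M)"
    and "(\<lambda>k. z k * Im (B (z k)) - (\<Sum>p<M. (-1) ^ p * b (2 * p + 1) * (1 / (z k)\<^sup>2) ^ p)) \<in> O(\<lambda>k. (1 / (z k)\<^sup>2) ^ M)"
proof -
  have pos: "\<forall>\<^sub>F k in sequentially. 0 < z k" using z by (simp add: filterlim_at_top_dense)
  have pw: "(1 / x\<^sup>2) ^ M = 1 / x ^ (2 * M)" for x :: real by (simp add: power_mult power_one_over)
  obtain C where "\<forall>\<^sub>F x in at_top. norm (B x - (\<Sum>k<2 * M. \<i> ^ k * of_real (b k) / of_real x ^ k)) \<le> C / x ^ (2 * M)"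
    using B unfolding has_expansion_def by blast
  from eventually_compose_filterlim[OF this z]
  have C: "\<forall>\<^sub>F k in sequentially. norm (B (z k) - (\<Sum>j<2 * M. \<i> ^ j * of_real (b j) / of_real (z k) ^ j)) \<le> C / z k ^ (2 * M)" .
  \<comment> \<open>The imaginary part is multiplied by z below, which costs one order. One more
    term is therefore taken; being real, it does not change the imaginary part of the sum.\<close>
  obtain D where "\<forall>\<^sub>F x in at_top. norm (B x - (\<Sum>k<Suc (2 * M). \<i> ^ k * of_real (b k) / of_real x ^ k)) \<le> D / x ^ Suc (2 * M)"
    using B unfolding has_expansion_def by blast
  from eventually_compose_filterlim[OF this z]
  have D: "\<forall>\<^sub>F k in sequentially. norm (B (z k) - (\<Sum>j<Suc (2 * M). \<i> ^ j * of_real (b j) / of_real (z k) ^ j)) \<le> D / z k ^ Suc (2 * M)" .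
  show "(\<lambda>k. Re (B (z k)) - (\<Sum>p<M. (-1) ^ p * b (2 * p) * (1 / (z k)\<^sup>2) ^ p)) \<in> O(\<lambda>k. (1 / (z k)\<^sup>2) ^ M)"
  proof (rule bigoI[of _ C])
    show "\<forall>\<^sub>F k in sequentially. norm (Re (B (z k)) - (\<Sum>p<M. (-1) ^ p * b (2 * p) * (1 / (z k)\<^sup>2) ^ p)) \<le> C * norm ((1 / (z k)\<^sup>2) ^ M)"
      using pos C
    proof eventually_elim
      case (elim k)
      have "\<bar>Re (B (z k) - (\<Sum>j<2 * M. \<i> ^ j * of_real (b j) / of_real (z k) ^ j))\<bar> \<le> C / z k ^ (2 * M)"
        using elim(2) abs_Re_le_cmod order_trans by blast
      moreover have "norm ((1 / (z k)\<^sup>2) ^ M) = 1 / z k ^ (2 * M)" using elim(1) by (simp add: pw)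
      moreover have "Re (\<Sum>j<2 * M. \<i> ^ j * of_real (b j) / of_real (z k) ^ j) = (\<Sum>p<M. (-1) ^ p * b (2 * p) * (1 / (z k)\<^sup>2) ^ p)"
        using sum_alternating_complex[of "z k" b M] elim(1) by simp
      ultimately show ?case by (simp del: Re_sum)
    qed
  qed
  show "(\<lambda>k. z k * Im (B (z k)) - (\<Sum>p<M. (-1) ^ p * b (2 * p + 1) * (1 / (z k)\<^sup>2) ^ p)) \<in> O(\<lambda>k. (1 / (z k)\<^sup>2) ^ M)"
  proof (rule bigoI[of _ D])
    show "\<forall>\<^sub>F k in sequentially. norm (z k * Im (B (z k)) - (\<Sum>p<M. (-1) ^ p * b (2 * p + 1) * (1 / (z k)\<^sup>2) ^ p)) \<le> D * norm ((1 / (z k)\<^sup>2) ^ M)"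
      using pos D
    proof eventually_elim
      case (elim k)
      define S where "S = (\<Sum>p<M. (-1) ^ p * b (2 * p + 1) * (1 / (z k)\<^sup>2) ^ p)"
      have i: "\<i> ^ (2 * M) = of_real ((-1) ^ M)" by (simp add: power_mult)
      have "Im (\<i> ^ (2 * M) * of_real (b (2 * M)) / of_real (z k) ^ (2 * M)) = 0"
        unfolding i by (simp only: Im_complex_of_real flip: of_real_power of_real_mult of_real_divide)
      moreover have "Im (\<Sum>j<2 * M. \<i> ^ j * of_real (b j) / of_real (z k) ^ j) = S / z k"
        using sum_alternating_complex[of "z k" b M] elim(1) by (simp add: S_def)
      ultimately have im: "Im (\<Sum>j<Suc (2 * M). \<i> ^ j * of_real (b j) / of_real (z k) ^ j) = S / z k"
        unfolding sum.lessThan_Suc by (simp only: plus_complex.sel add_0_right)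
      have "\<bar>Im (B (z k) - (\<Sum>j<Suc (2 * M). \<i> ^ j * of_real (b j) / of_real (z k) ^ j))\<bar> \<le> D / z k ^ Suc (2 * M)"
        using elim(2) abs_Im_le_cmod order_trans by blast
      then have "\<bar>Im (B (z k)) - S / z k\<bar> \<le> D / z k ^ Suc (2 * M)" unfolding minus_complex.sel im .
      then have "z k * \<bar>Im (B (z k)) - S / z k\<bar> \<le> z k * (D / z k ^ Suc (2 * M))"
        using elim(1) by (intro mult_left_mono) auto
      moreover have "z k * (D / z k ^ Suc (2 * M)) = D * (1 / z k ^ (2 * M))" using elim(1) by simp
      moreover have "z k * \<bar>Im (B (z k)) - S / z k\<bar> = \<bar>z k * (Im (B (z k)) - S / z k)\<bar>"
        using elim(1) by (simp add: abs_mult)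
      moreover have "z k * (Im (B (z k)) - S / z k) = z k * Im (B (z k)) - S" using elim(1) by (simp add: field_simps)
      ultimately have "\<bar>z k * Im (B (z k)) - S\<bar> \<le> D * (1 / z k ^ (2 * M))" by simp
      moreover have "norm ((1 / (z k)\<^sup>2) ^ M) = 1 / z k ^ (2 * M)" using elim(1) by (simp add: pw)
      ultimately show ?case by (simp add: S_def)
    qed
  qed
qed

text \<open>The condition |\<delta>| < pi/2 selects the principal branch of arctan.\<close>

lemma Im_cis_mult_eq_0_imp_arctan:
  assumes "Im (cis \<delta> * b) = 0" "0 < Re b" "\<bar>\<delta>\<bar> < pi / 2"
  shows "\<delta> = - arctan (Im b / Re b)"
proof -
  have "- (pi / 2) < \<delta>" "\<delta> < pi / 2" using assms(3) by linarith+
  then have c: "cos \<delta> > 0" and at: "arctan (tan \<delta>) = \<delta>" by (auto intro: cos_gt_zero_pi arctan_tan)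
  have "cos \<delta> * Im b + sin \<delta> * Re b = 0" using assms(1) by simp
  then have "tan \<delta> = - (Im b / Re b)" using c assms(2) by (simp add: tan_def field_simps)
  then show ?thesis using at by (metis arctan_minus)
qed

text \<open>With \<open>v = z \<delta>\<close> for \<open>\<delta> = z - \<phi>\<close> and \<open>y = 1 / z\<^sup>2\<close>, the zero equation expands \<open>v\<close> in powers of \<open>y\<close>.\<close>

lemma arctan_offset_expansion:
  fixes z E V :: "nat \<Rightarrow> real" and b :: "nat \<Rightarrow> real"
  defines "y \<equiv> \<lambda>k. 1 / (z k)\<^sup>2"
  assumes z: "filterlim z at_top sequentially" and b0: "b 0 = 1"
    and E: "\<And>M. (\<lambda>k. E k - (\<Sum>p<M. (-1) ^ p * b (2 * p) * y k ^ p)) \<in> O(\<lambda>k. y k ^ M)"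
    and V: "\<And>M. (\<lambda>k. V k - (\<Sum>p<M. (-1) ^ p * b (2 * p + 1) * y k ^ p)) \<in> O(\<lambda>k. y k ^ M)"
  shows "poly_expansion y M (\<lambda>k. - (z k * arctan (V k * inverse (E k) / z k)))"
    and "linear_expansion y (\<lambda>k. - (z k * arctan (V k * inverse (E k) / z k))) (- b 1) (b 3 - b 1 * b 2 + b 1 ^ 3 / 3)"
proof -
  have pos: "\<forall>\<^sub>F k in sequentially. 0 < z k" using z by (simp add: filterlim_at_top_dense)
  have iz: "(\<lambda>k. inverse (z k)) \<longlonglongrightarrow> 0" by (rule tendsto_inverse_0_at_top[OF z])
  have "(\<lambda>k. inverse (z k) * inverse (z k)) \<longlonglongrightarrow> 0 * 0" by (rule tendsto_mult[OF iz iz])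
  then have y: "y \<longlonglongrightarrow> 0" by (simp add: y_def power2_eq_square divide_inverse)
  have poly: "poly_expansion y M F" if "\<And>M. (\<lambda>k. F k - (\<Sum>p<M. c p * y k ^ p)) \<in> O(\<lambda>k. y k ^ M)" for F c M
  proof (rule poly_expansion_bigo[OF _ that])
    show "poly_expansion y M (\<lambda>k. \<Sum>p<M. c p * y k ^ p)"
      by (rule poly_expansion_sum[OF finite_lessThan poly_expansion_cmult[OF poly_expansion_power[OF poly_expansion_ident y] y]])
  qed
  have lin: "linear_expansion y F (c 0) (c 1)" if "\<And>M. (\<lambda>k. F k - (\<Sum>p<M. c p * y k ^ p)) \<in> O(\<lambda>k. y k ^ M)" for F c
  proof -
    have "(\<lambda>k. F k - (\<Sum>p<2. c p * y k ^ p)) = (\<lambda>k. F k - (c 0 + c 1 * y k))" by (simp add: fun_eq_iff numeral_2_eq_2)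
    then show ?thesis using that[of 2] by (simp only: linear_expansion_def)
  qed
  have E1: "linear_expansion y E 1 (- b 2)" using lin[of E "\<lambda>p. (-1) ^ p * b (2 * p)"] E b0 by simp
  have V1: "linear_expansion y V (b 1) (- b 3)" using lin[of V "\<lambda>p. (-1) ^ p * b (2 * p + 1)"] V by (simp add: numeral_3_eq_3)
  define T where "T k = V k * inverse (E k)" for k
  have Tp: "poly_expansion y M T" for M
    unfolding T_def
    by (rule poly_expansion_mult[OF poly[OF V] poly_expansion_inverse[OF poly[OF E] y linear_expansion_bigo_w[OF E1 y]] y])
  define t where "t = b 1 * b 2 - b 3"
  have "linear_expansion y T (b 1 * 1) (b 1 * - (- b 2) + - b 3 * 1)"
    unfolding T_def by (rule linear_expansion_mult[OF V1 linear_expansion_inverse[OF E1 y] y])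
  moreover have "b 1 * - (- b 2) + - b 3 * 1 = t" by (simp add: t_def)
  ultimately have T1: "linear_expansion y T (b 1) t" by (simp only: mult_1_right)
  have Tb: "T \<in> O(\<lambda>_. 1)" by (rule poly_expansion_bounded[OF Tp y])
  define v where "v k = - (z k * arctan (T k / z k))" for k
  \<comment> \<open>Partial sum of the arctan series at T / z, multiplied by - z: the odd powers of
    1 / z become powers of y.\<close>
  define S where "S M k = (\<Sum>j<M. - ((-1) ^ j / real (2 * j + 1)) * (y k ^ j * T k ^ (2 * j + 1)))" for M k
  have vS: "(\<lambda>k. v k - S M k) \<in> O(\<lambda>k. y k ^ M)" for M
  proof -
    have "(\<lambda>k. v k - S M k) \<in> O(\<lambda>k. y k ^ M * T k ^ (2 * M + 1))"
    proof (rule bigoI[of _ 1])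
      show "\<forall>\<^sub>F k in sequentially. norm (v k - S M k) \<le> 1 * norm (y k ^ M * T k ^ (2 * M + 1))"
        using pos
      proof eventually_elim
        case (elim k)
        have r: "z k * (T k / z k) ^ (2 * j + 1) = y k ^ j * T k ^ (2 * j + 1)" for j
        proof -
          have "y k ^ j = 1 / z k ^ (2 * j)" by (simp add: y_def power_mult power_one_over)
          then show ?thesis using elim by (simp add: power_divide)
        qed
        have "S M k = - (z k * (\<Sum>j<M. (-1) ^ j * (T k / z k) ^ (2 * j + 1) / real (2 * j + 1)))"
          unfolding S_def sum_distrib_left sum_negf[symmetric]
        proof (rule sum.cong[OF refl])
          fix j
          show "- ((-1) ^ j / real (2 * j + 1)) * (y k ^ j * T k ^ (2 * j + 1)) = - (z k * ((-1) ^ j * (T k / z k) ^ (2 * j + 1) / real (2 * j + 1)))"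
            unfolding r[symmetric] by simp
        qed
        then have "v k - S M k = - (z k * (arctan (T k / z k) - (\<Sum>j<M. (-1) ^ j * (T k / z k) ^ (2 * j + 1) / real (2 * j + 1))))"
          by (simp add: v_def right_diff_distrib)
        then have "norm (v k - S M k) = z k * \<bar>arctan (T k / z k) - (\<Sum>j<M. (-1) ^ j * (T k / z k) ^ (2 * j + 1) / real (2 * j + 1))\<bar>"
          using elim by (simp add: abs_mult)
        also have "\<dots> \<le> z k * \<bar>T k / z k\<bar> ^ (2 * M + 1)" using elim by (intro mult_left_mono arctan_taylor_bound) auto
        also have "\<dots> = \<bar>z k * (T k / z k) ^ (2 * M + 1)\<bar>" using elim by (simp add: abs_mult power_abs del: power_Suc)
        finally show ?case unfolding r by simp
      qed
    qed
    also have "(\<lambda>k. y k ^ M * T k ^ (2 * M + 1)) \<in> O(\<lambda>k. y k ^ M * 1 ^ (2 * M + 1))"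
      by (rule landau_o.big.mult[OF landau_o.big_refl landau_o.big_power[OF Tb]])
    finally show ?thesis by (simp only: power_one mult_1_right)
  qed
  have "poly_expansion y M (S M)" for M
    unfolding S_def
    by (rule poly_expansion_sum[OF finite_lessThan poly_expansion_cmult[OF poly_expansion_mult[OF
          poly_expansion_power[OF poly_expansion_ident y] poly_expansion_power[OF Tp y] y] y]])
  from poly_expansion_bigo[OF this vS] have vp: "poly_expansion y M v" for M .
  have y1: "linear_expansion y y 0 1" by (simp only: linear_expansion_def add_0_left mult_1_left diff_self zero_in_bigo)
  note T2 = linear_expansion_mult[OF T1 T1 y]
  note T3 = linear_expansion_mult[OF T2 T1 y]
  note yT = linear_expansion_cmult[OF linear_expansion_mult[OF y1 T3 y] y, of "1/3"]
  note ST = linear_expansion_add[OF linear_expansion_cmult[OF T1 y, of "-1"] yT]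
  \<comment> \<open>Two arctan terms determine v to first order in y: - T from the linear term and y
    T^3 / 3 from the cubic one.\<close>
  have S2: "S 2 = (\<lambda>k. -1 * T k + 1 / 3 * (y k * (T k * T k * T k)))"
  proof
    fix k
    have two: "(\<Sum>j<2. g j) = g 0 + g 1" for g :: "nat \<Rightarrow> real" by (simp add: numeral_2_eq_2)
    have three: "(2::nat) * 1 + 1 = 3" by simp
    show "S 2 k = -1 * T k + 1 / 3 * (y k * (T k * T k * T k))"
      unfolding S_def two three power3_eq_cube by simp
  qed
  have "linear_expansion y v (- 1 * b 1 + 1 / 3 * (0 * (b 1 * b 1 * b 1)))
    (- 1 * t + 1 / 3 * (0 * (b 1 * b 1 * t + (b 1 * t + t * b 1) * b 1) + 1 * (b 1 * b 1 * b 1)))"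
    by (rule linear_expansion_bigo[OF ST]) (use vS[of 2] in \<open>simp only: S2\<close>)
  moreover have "- 1 * b 1 + 1 / 3 * (0 * (b 1 * b 1 * b 1)) = - b 1"
    "- 1 * t + 1 / 3 * (0 * (b 1 * b 1 * t + (b 1 * t + t * b 1) * b 1) + 1 * (b 1 * b 1 * b 1)) = b 3 - b 1 * b 2 + b 1 ^ 3 / 3"
    by (simp_all add: t_def power3_eq_cube)
  ultimately have v1: "linear_expansion y v (- b 1) (b 3 - b 1 * b 2 + b 1 ^ 3 / 3)" by (simp only:)
  show "poly_expansion y M (\<lambda>k. - (z k * arctan (V k * inverse (E k) / z k)))" for M
    using vp unfolding v_def T_def .
  show "linear_expansion y (\<lambda>k. - (z k * arctan (V k * inverse (E k) / z k))) (- b 1) (b 3 - b 1 * b 2 + b 1 ^ 3 / 3)"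
    using v1 unfolding v_def T_def .
qed

lemma linear_expansion_reparam:
  assumes f: "linear_expansion y f a b" and y: "linear_expansion w y 0 1" and w: "w \<longlonglongrightarrow> 0"
  shows "linear_expansion w f a b"
proof -
  have "(\<lambda>k. y k - 0) \<in> O(w)" by (rule linear_expansion_bigo_w[OF y w])
  then have "y \<in> O(w)" by (simp only: diff_zero)
  from landau_o.big_power[OF this, of 2]
  have "(\<lambda>k. f k - (a + b * y k)) \<in> O(\<lambda>k. w k ^ 2)"
    using f unfolding linear_expansion_def by (rule landau_o.big_trans[rotated])
  moreover have "linear_expansion w (\<lambda>k. a + b * y k) (a + b * 0) (0 + b * 1)"
    by (rule linear_expansion_add[OF linear_expansion_const linear_expansion_cmult[OF y w]])
  then have "linear_expansion w (\<lambda>k. a + b * y k) a b" by (simp only: mult_zero_right mult_1_right add_0_left add_0_right)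
  ultimately show ?thesis by (rule linear_expansion_bigo[rotated])
qed

text \<open>Change of variable from z to \<phi>. With r = 1 - v y one has \<phi> = z r, so y = w r^2
  for w = 1 / \<phi>^2, and z - \<phi> = v r / \<phi>. As r = 1 - a w + O(w^2), the product v r
  begins with a + (b - a^2) w; this is the origin of the extra square in the second
  coefficient.\<close>

lemma mcmahon_expansion_of_offset:
  fixes z \<phi> v :: "nat \<Rightarrow> real"
  defines "y \<equiv> \<lambda>k. 1 / (z k)\<^sup>2"
  assumes z: "filterlim z at_top sequentially" and \<phi>: "filterlim \<phi> at_top sequentially"
    and vp: "\<And>M. poly_expansion y M v" and v1: "linear_expansion y v a b"
    and zv: "\<forall>\<^sub>F k in sequentially. z k - \<phi> k = v k / z k"
  shows "mcmahon_expansion z \<phi> a (b - a\<^sup>2)"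
proof -
  have posz: "\<forall>\<^sub>F k in sequentially. 0 < z k" and posp: "\<forall>\<^sub>F k in sequentially. 0 < \<phi> k"
    using z \<phi> by (simp_all add: filterlim_at_top_dense)
  have sq0: "(\<lambda>k. 1 / (u k)\<^sup>2) \<longlonglongrightarrow> 0" if "filterlim u at_top sequentially" for u :: "nat \<Rightarrow> real"
  proof -
    have iu: "(\<lambda>k. inverse (u k)) \<longlonglongrightarrow> 0" by (rule tendsto_inverse_0_at_top[OF that])
    have "(\<lambda>k. inverse (u k) * inverse (u k)) \<longlonglongrightarrow> 0 * 0" by (rule tendsto_mult[OF iu iu])
    then show ?thesis by (simp add: power2_eq_square divide_inverse)
  qed
  define w where "w k = 1 / (\<phi> k)\<^sup>2" for k
  have y: "y \<longlonglongrightarrow> 0" unfolding y_def by (rule sq0[OF z])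
  have w: "w \<longlonglongrightarrow> 0" unfolding w_def by (rule sq0[OF \<phi>])
  have wne: "\<forall>\<^sub>F k in sequentially. w k \<noteq> 0" using posp by eventually_elim (simp add: w_def)
  define r where "r k = 1 - v k * y k" for k
  have vb: "v \<in> O(\<lambda>_. 1)" by (rule poly_expansion_bounded[OF vp y])
  have ratio: "\<forall>\<^sub>F k in sequentially. \<phi> k = z k * r k"
    using posz zv
  proof eventually_elim
    case (elim k)
    have "z k * r k = z k - v k / z k" using elim(1) by (simp add: r_def y_def power2_eq_square right_diff_distrib)
    then show ?case using elim(2) by simp
  qed
  have yw: "\<forall>\<^sub>F k in sequentially. y k = w k * (r k)\<^sup>2"
    using posz posp ratio
  proof eventually_elim
    case (elim k)
    then have "r k \<noteq> 0" by auto
    then show ?case using elim by (simp add: y_def w_def power_mult_distrib)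
  qed
  have "(\<lambda>k. v k * y k) \<in> O(\<lambda>k. 1 * y k)" by (rule landau_o.big.mult[OF vb landau_o.big_refl])
  then have vy: "(\<lambda>k. v k * y k) \<longlonglongrightarrow> 0" by (intro bigo_tendsto_0[OF _ y]) (simp only: mult_1_left)
  have "r \<longlonglongrightarrow> 1 - 0" unfolding r_def by (intro tendsto_diff tendsto_const vy)
  then have r1: "r \<longlonglongrightarrow> 1" by simp
  have "(\<lambda>k. (r k)\<^sup>2) \<longlonglongrightarrow> 1\<^sup>2" by (intro tendsto_power r1)
  then have "(\<lambda>k. (r k)\<^sup>2) \<in> O(\<lambda>_. 1)" by (intro bigoI_tendsto[where c = "1\<^sup>2"]) auto
  then have "(\<lambda>k. w k * (r k)\<^sup>2) \<in> O(\<lambda>k. w k * 1)" by (rule landau_o.big.mult[OF landau_o.big_refl])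
  then have yOw: "y \<in> O(w)"
    unfolding mult_1_right by (rule landau_o.big.in_cong[OF yw, THEN iffD2])
  have y1: "linear_expansion w y 0 1"
  proof -
    have "(\<lambda>k. v k * y k) \<in> O(\<lambda>k. 1 * w k)" by (rule landau_o.big.mult[OF vb yOw])
    moreover have "(\<lambda>k. 1 + r k) \<longlonglongrightarrow> 1 + 1" by (intro tendsto_add tendsto_const r1)
    then have "(\<lambda>k. 1 + r k) \<in> O(\<lambda>_. 1)" by (intro bigoI_tendsto[where c = "1 + 1"]) auto
    ultimately have "(\<lambda>k. (v k * y k) * (1 + r k)) \<in> O(\<lambda>k. 1 * w k * 1)" by (rule landau_o.big.mult)
    from landau_o.big.mult[OF landau_o.big_refl this, of w]
    have "(\<lambda>k. w k * ((v k * y k) * (1 + r k))) \<in> O(\<lambda>k. w k ^ 2)"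
      by (simp only: power2_eq_square mult_1_left mult_1_right)
    then have "(\<lambda>k. - (w k * ((v k * y k) * (1 + r k)))) \<in> O(\<lambda>k. w k ^ 2)" by (simp only: landau_o.big.uminus_in_iff)
    moreover have "\<forall>\<^sub>F k in sequentially. y k - (0 + 1 * w k) = - (w k * ((v k * y k) * (1 + r k)))"
      using yw
    proof eventually_elim
      case (elim k)
      have vy: "v k * y k = 1 - r k" by (simp add: r_def)
      have "- (w k * ((v k * y k) * (1 + r k))) = w k * (r k)\<^sup>2 - w k" unfolding vy by (simp add: power2_eq_square algebra_simps)
      then show ?case using elim by simp
    qed
    ultimately show ?thesis
      unfolding linear_expansion_def by (rule landau_o.big.in_cong[THEN iffD2, rotated])
  qed
  have vM: "poly_expansion w M v" if "poly_expansion w M y" for M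
  proof -
    obtain q where "(\<lambda>k. v k - poly q (y k)) \<in> O(\<lambda>k. y k ^ M)" using vp[of M] by (auto simp: poly_expansion_def)
    from landau_o.big_trans[OF this landau_o.big_power[OF yOw]]
    show ?thesis by (rule poly_expansion_bigo[OF poly_expansion_compose[OF that w]])
  qed
  have rM: "poly_expansion w M r" if "poly_expansion w M y" for M
    unfolding r_def by (rule poly_expansion_diff[OF poly_expansion_const poly_expansion_mult[OF vM[OF that] that w] w])
  \<comment> \<open>Bootstrap: an expansion of y to order M gives one of r to order M, and then y =
    w r^2 is expanded to order M + 1.\<close>
  have yM: "poly_expansion w M y" for M
  proof (induction M)
    case 0
    have "poly_expansion y 0 y" by (rule poly_expansion_ident)
    from poly_expansion_bounded[OF this y] have "y \<in> O(\<lambda>k. w k ^ 0)" by (simp only: power_0)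
    then have "(\<lambda>k. y k - 0) \<in> O(\<lambda>k. w k ^ 0)" by (simp only: diff_zero)
    then show ?case by (rule poly_expansion_bigo[OF poly_expansion_const])
  next
    case (Suc M)
    show ?case
      by (rule poly_expansion_bigo[OF poly_expansion_shift[OF poly_expansion_power[OF rM[OF Suc] w, of 2]]
            eventually_eq_imp_diff_bigo[OF yw]])
  qed
  define X where "X k = v k * r k" for k
  have Xp: "poly_expansion w M X" for M
    unfolding X_def by (rule poly_expansion_mult[OF vM[OF yM] rM[OF yM] w])
  have X1: "linear_expansion w X a (b - a\<^sup>2)"
  proof -
    have vw: "linear_expansion w v a b" by (rule linear_expansion_reparam[OF v1 y1 w])
    note vy = linear_expansion_cmult[OF linear_expansion_mult[OF vw y1 w] w, of "-1"]
    note rr = linear_expansion_add[OF linear_expansion_const[of w 1] vy]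
    have "r = (\<lambda>k. 1 + -1 * (v k * y k))" by (simp add: fun_eq_iff r_def)
    then have "linear_expansion w r (1 + - 1 * (a * 0)) (0 + - 1 * (a * 1 + b * 0))" using rr by (simp only:)
    then have r: "linear_expansion w r 1 (- a)"
      by (simp only: mult_zero_right mult_1_right add_0_left add_0_right mult_minus1)
    have "linear_expansion w X (a * 1) (a * - a + b * 1)" unfolding X_def by (rule linear_expansion_mult[OF vw r w])
    moreover have "a * - a + b * 1 = b - a\<^sup>2" by (simp add: power2_eq_square)
    ultimately show ?thesis by (simp only: mult_1_right)
  qed
  obtain c where c: "c 0 = a" "c (Suc 0) = b - a\<^sup>2"
    and cX: "\<And>M. (\<lambda>k. X k - (\<Sum>s<M. c s * w k ^ s)) \<in> O(\<lambda>k. w k ^ M)"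
    using expansion_coefficients_exist[OF w wne Xp X1] by blast
  have "(\<lambda>k. z k - (\<phi> k + (\<Sum>s<M. c s / \<phi> k ^ (2 * s + 1)))) \<in> O(\<lambda>k. 1 / \<phi> k ^ (2 * M + 1))" for M
  proof -
    have ws: "1 / \<phi> k * w k ^ s = 1 / \<phi> k ^ (2 * s + 1)" for k s
      by (simp add: w_def power_mult power_one_over)
    have "(\<lambda>k. 1 / \<phi> k * (X k - (\<Sum>s<M. c s * w k ^ s))) \<in> O(\<lambda>k. 1 / \<phi> k * w k ^ M)"
      by (rule landau_o.big.mult[OF landau_o.big_refl cX])
    then have "(\<lambda>k. 1 / \<phi> k * (X k - (\<Sum>s<M. c s * w k ^ s))) \<in> O(\<lambda>k. 1 / \<phi> k ^ (2 * M + 1))" unfolding ws .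
    moreover have "\<forall>\<^sub>F k in sequentially. z k - (\<phi> k + (\<Sum>s<M. c s / \<phi> k ^ (2 * s + 1))) = 1 / \<phi> k * (X k - (\<Sum>s<M. c s * w k ^ s))"
      using posz posp ratio zv
    proof eventually_elim
      case (elim k)
      have "(\<Sum>s<M. c s / \<phi> k ^ (2 * s + 1)) = (\<Sum>s<M. 1 / \<phi> k * (c s * w k ^ s))"
      proof (rule sum.cong[OF refl])
        fix s
        have "1 / \<phi> k * (c s * w k ^ s) = c s * (1 / \<phi> k * w k ^ s)" by simp
        then show "c s / \<phi> k ^ (2 * s + 1) = 1 / \<phi> k * (c s * w k ^ s)" unfolding ws by simp
      qed
      also have "\<dots> = 1 / \<phi> k * (\<Sum>s<M. c s * w k ^ s)" by (simp only: sum_distrib_left)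
      finally have s: "(\<Sum>s<M. c s / \<phi> k ^ (2 * s + 1)) = 1 / \<phi> k * (\<Sum>s<M. c s * w k ^ s)" .
      have "r k \<noteq> 0" using elim(2,3) by auto
      then have "1 / \<phi> k * X k = v k / z k" using elim(1,3) by (simp add: X_def)
      then show ?case unfolding s using elim(4) by (simp only: right_diff_distrib)
    qed
    ultimately show ?thesis by (rule landau_o.big.in_cong[THEN iffD2, rotated])
  qed
  then show ?thesis unfolding mcmahon_expansion_def using c by (intro exI[of _ c]) (simp only: One_nat_def, blast)
qed

text \<open>Stripping the signs from the alternating recurrences leaves the sign-free recurrence of
  \<open>bessel_deriv_exp_coeff\<close>. The sign depends on the parities of both indices, so even
  and odd orders of differentiation form two families, and each step of the recurrence leads from
  one to the other.\<close>

lemma mcmahon_coeff_conv_exp_coeff: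
  fixes n p :: nat
  shows "mcmahon_coeff \<nu> (2 * int p) (2 * n) = (-1) ^ (n + p) * bessel_deriv_exp_coeff \<nu> (2 * n) (2 * p)"
    and "mcmahon_coeff \<nu> (2 * int p + 1) (2 * n) = - ((-1) ^ (n + p)) * bessel_deriv_exp_coeff \<nu> (2 * n) (2 * p + 1)"
    and "mcmahon_coeff \<nu> (2 * int p) (2 * n + 1) = - ((-1) ^ (n + p)) * bessel_deriv_exp_coeff \<nu> (2 * n + 1) (2 * p)"
    and "mcmahon_coeff \<nu> (2 * int p + 1) (2 * n + 1) = - ((-1) ^ (n + p)) * bessel_deriv_exp_coeff \<nu> (2 * n + 1) (2 * p + 1)"
proof -
  define A where "A n \<longleftrightarrow> (\<forall>p. mcmahon_coeff \<nu> (2 * int p) (2 * n) = (-1) ^ (n + p) * bessel_deriv_exp_coeff \<nu> (2 * n) (2 * p) \<and>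
     mcmahon_coeff \<nu> (2 * int p + 1) (2 * n) = - ((-1) ^ (n + p)) * bessel_deriv_exp_coeff \<nu> (2 * n) (2 * p + 1))" for n
  define C where "C n \<longleftrightarrow> (\<forall>p. mcmahon_coeff \<nu> (2 * int p) (2 * n + 1) = - ((-1) ^ (n + p)) * bessel_deriv_exp_coeff \<nu> (2 * n + 1) (2 * p) \<and>
     mcmahon_coeff \<nu> (2 * int p + 1) (2 * n + 1) = - ((-1) ^ (n + p)) * bessel_deriv_exp_coeff \<nu> (2 * n + 1) (2 * p + 1))" for n
  have prev: "2 * int (Suc q) - 1 = 2 * int q + 1" for q by simp
  have AC: "C n" if A: "A n" for n
    unfolding C_def
  proof (intro allI conjI)
    fix p
    have ev: "mcmahon_coeff \<nu> (2 * int p) (2 * n) = (-1) ^ (n + p) * bessel_deriv_exp_coeff \<nu> (2 * n) (2 * p)"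
      and od: "mcmahon_coeff \<nu> (2 * int p + 1) (2 * n) = - ((-1) ^ (n + p)) * bessel_deriv_exp_coeff \<nu> (2 * n) (2 * p + 1)" for p
      using A by (simp_all add: A_def)
    show "mcmahon_coeff \<nu> (2 * int p) (2 * n + 1) = - ((-1) ^ (n + p)) * bessel_deriv_exp_coeff \<nu> (2 * n + 1) (2 * p)"
    proof (cases p)
      case 0
      then show ?thesis using ev[of 0] mcmahon_coeff_recurrences(3)[of \<nu> 0 n]
        by (simp add: mcmahon_coeff_minus_one del: mcmahon_coeff.simps)
    next
      case (Suc q)
      have be: "bessel_deriv_exp_coeff \<nu> (2 * n + 1) (2 * p) = bessel_deriv_exp_coeff \<nu> (2 * n) (2 * p)
          + (4 * real p - 1) / 2 * bessel_deriv_exp_coeff \<nu> (2 * n) (2 * q + 1)"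
        unfolding Suc_eq_plus1[symmetric] bessel_deriv_exp_coeff.simps(2)[of _ "2 * n"] by (simp add: Suc del: bessel_deriv_exp_coeff.simps)
      have mc: "mcmahon_coeff \<nu> (2 * int p - 1) (2 * n) = (-1) ^ (n + p) * bessel_deriv_exp_coeff \<nu> (2 * n) (2 * q + 1)"
        using od[of q] unfolding Suc prev by simp
      show ?thesis unfolding mcmahon_coeff_recurrences(3) ev be mc
        by (simp add: algebra_simps add_divide_distrib diff_divide_distrib del: mcmahon_coeff.simps bessel_deriv_exp_coeff.simps)
    qed
    show "mcmahon_coeff \<nu> (2 * int p + 1) (2 * n + 1) = - ((-1) ^ (n + p)) * bessel_deriv_exp_coeff \<nu> (2 * n + 1) (2 * p + 1)"
      unfolding mcmahon_coeff_recurrences(4) ev od by (simp add: algebra_simps add_divide_distrib)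
  qed
  have CA: "A (Suc n)" if C: "C n" for n
    unfolding A_def
  proof (intro allI conjI)
    fix p
    have ev: "mcmahon_coeff \<nu> (2 * int p) (2 * Suc n - 1) = - ((-1) ^ (n + p)) * bessel_deriv_exp_coeff \<nu> (2 * n + 1) (2 * p)"
      and od: "mcmahon_coeff \<nu> (2 * int p + 1) (2 * Suc n - 1) = - ((-1) ^ (n + p)) * bessel_deriv_exp_coeff \<nu> (2 * n + 1) (2 * p + 1)" for p
      using C by (simp_all add: C_def del: mcmahon_coeff.simps bessel_deriv_exp_coeff.simps)
    have N: "2 * Suc n = Suc (2 * n + 1)" by simp
    have n1: "Suc n \<ge> 1" by simp
    show "mcmahon_coeff \<nu> (2 * int p) (2 * Suc n) = (-1) ^ (Suc n + p) * bessel_deriv_exp_coeff \<nu> (2 * Suc n) (2 * p)"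
    proof (cases p)
      case 0
      then show ?thesis using ev[of 0] mcmahon_coeff_recurrences(5)[OF n1, of \<nu> 0]
        unfolding N by (simp add: mcmahon_coeff_minus_one del: mcmahon_coeff.simps)
    next
      case (Suc q)
      have be: "bessel_deriv_exp_coeff \<nu> (2 * Suc n) (2 * p) = bessel_deriv_exp_coeff \<nu> (2 * n + 1) (2 * p)
          + (4 * real p - 1) / 2 * bessel_deriv_exp_coeff \<nu> (2 * n + 1) (2 * q + 1)"
        unfolding N bessel_deriv_exp_coeff.simps(2)[of _ "2 * n + 1"] by (simp add: Suc del: bessel_deriv_exp_coeff.simps)
      have mc: "mcmahon_coeff \<nu> (2 * int p - 1) (2 * Suc n - 1) = (-1) ^ (n + p) * bessel_deriv_exp_coeff \<nu> (2 * n + 1) (2 * q + 1)"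
        using od[of q] unfolding Suc prev by simp
      show ?thesis unfolding mcmahon_coeff_recurrences(5)[OF n1] ev be mc
        by (simp add: algebra_simps add_divide_distrib diff_divide_distrib del: mcmahon_coeff.simps bessel_deriv_exp_coeff.simps)
    qed
    have be: "bessel_deriv_exp_coeff \<nu> (2 * Suc n) (2 * p + 1) = bessel_deriv_exp_coeff \<nu> (2 * n + 1) (2 * p + 1)
        + (4 * real p + 1) / 2 * bessel_deriv_exp_coeff \<nu> (2 * n + 1) (2 * p)"
      unfolding N bessel_deriv_exp_coeff.simps(2)[of _ "2 * n + 1"] by (simp add: algebra_simps del: bessel_deriv_exp_coeff.simps)
    show "mcmahon_coeff \<nu> (2 * int p + 1) (2 * Suc n) = - ((-1) ^ (Suc n + p)) * bessel_deriv_exp_coeff \<nu> (2 * Suc n) (2 * p + 1)"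
      unfolding mcmahon_coeff_recurrences(6)[OF n1] ev od be
      by (simp add: algebra_simps add_divide_distrib diff_divide_distrib del: mcmahon_coeff.simps bessel_deriv_exp_coeff.simps)
  qed
  have "A n \<and> C n"
  proof (induction n)
    case 0
    have "A 0"
      unfolding A_def mult_0_right mcmahon_coeff_recurrences(1,2) by simp
    then show ?case using AC by blast
  next
    case (Suc n)
    then show ?case using AC CA by blast
  qed
  then show "mcmahon_coeff \<nu> (2 * int p) (2 * n) = (-1) ^ (n + p) * bessel_deriv_exp_coeff \<nu> (2 * n) (2 * p)"
    and "mcmahon_coeff \<nu> (2 * int p + 1) (2 * n) = - ((-1) ^ (n + p)) * bessel_deriv_exp_coeff \<nu> (2 * n) (2 * p + 1)"
    and "mcmahon_coeff \<nu> (2 * int p) (2 * n + 1) = - ((-1) ^ (n + p)) * bessel_deriv_exp_coeff \<nu> (2 * n + 1) (2 * p)"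
    and "mcmahon_coeff \<nu> (2 * int p + 1) (2 * n + 1) = - ((-1) ^ (n + p)) * bessel_deriv_exp_coeff \<nu> (2 * n + 1) (2 * p + 1)"
    unfolding A_def C_def by blast+
qed

section \<open>The numbered zeros and their expansions\<close>

lemma bessel_deriv_exp_coeff_0: "bessel_deriv_exp_coeff \<nu> N 0 = 1"
  by (induction N) (simp_all add: hankel_A_def)

lemma has_offset_unique:
  assumes "has_offset f \<beta> d" "has_offset f \<beta> e"
  shows "d = e"
proof -
  have "\<forall>\<^sub>F k in sequentially. int k + d = int k + e"
    using assms[unfolded has_offset_def]
  proof eventually_elim
    case (elim k)
    have "pi / 4 \<le> pi / 2" "pi / 2 \<le> 3 * pi / 4" by simp_all
    then show ?case using elim by metis
  qed
  then show ?thesis by (auto simp: eventually_sequentially)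
qed

lemma mcmahon_expansion_cong:
  assumes "\<forall>\<^sub>F k in sequentially. z k = z' k"
  shows "mcmahon_expansion z \<phi> a b \<longleftrightarrow> mcmahon_expansion z' \<phi> a b"
proof -
  have "(\<lambda>k. z k - (\<phi> k + (\<Sum>s<M. c s / \<phi> k ^ (2 * s + 1)))) \<in> O(\<lambda>k. 1 / \<phi> k ^ (2 * M + 1)) \<longleftrightarrow>
    (\<lambda>k. z' k - (\<phi> k + (\<Sum>s<M. c s / \<phi> k ^ (2 * s + 1)))) \<in> O(\<lambda>k. 1 / \<phi> k ^ (2 * M + 1))" for c M
    by (rule landau_o.big.in_cong) (use assms in \<open>auto elim: eventually_mono\<close>)
  then show ?thesis by (simp only: mcmahon_expansion_def)
qed

text \<open>The shift m compensates the multiple of pi contained in the phase for order 2 m or 2 m +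
  1. The numbering i is tied to the offset for k \<ge> 1, since at k = m = 0 the truncated
  difference k + m - 1 would be off; a single index does not affect the asymptotics.\<close>

lemma mcmahon_expansion_bessel_zeros:
  fixes \<nu> :: real and N m :: nat and e :: int and i :: "nat \<Rightarrow> nat"
  defines "b \<equiv> bessel_deriv_exp_coeff \<nu> N"
  assumes \<nu>: "\<nu> \<ge> 0" "real N \<le> \<nu> + 1" and off: "has_offset (bessel_J_deriv \<nu> N) (bessel_beta \<nu> N) e"
    and i: "\<And>k. k \<ge> 1 \<Longrightarrow> int (i k) = int (k + m) + e"
    and \<phi>: "\<And>k. \<phi> k = real (k + m) * pi + bessel_beta \<nu> N"
  shows "mcmahon_expansion (\<lambda>k. bessel_J_deriv_zero \<nu> N (i k)) \<phi> (- b 1) (b 3 - b 1 * b 2 + b 1 ^ 3 / 3 - (b 1)\<^sup>2)"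
proof -
  obtain z B where B: "has_expansion B (\<lambda>k. \<i> ^ k * of_real (b k))"
    and win: "\<forall>\<^sub>F k in sequentially. window_zero (bessel_J_deriv \<nu> N) (bessel_beta \<nu> N) k (z k)"
    and lim: "(\<lambda>k. z k - (real k * pi + bessel_beta \<nu> N)) \<longlonglongrightarrow> 0"
    and im: "\<And>x. x > 0 \<Longrightarrow> bessel_J_deriv \<nu> N x = 0 \<Longrightarrow> Im (cis (x - bessel_beta \<nu> N) * B x) = 0"
    using bessel_window_zeros[OF \<nu>(1), of N] unfolding b_def by blast
  note fin = finite_zeros_bessel_J_deriv[OF \<nu>]
  obtain d where "has_offset (bessel_J_deriv \<nu> N) (bessel_beta \<nu> N) d"
    and "\<forall>\<^sub>F k in sequentially. int (card (zeros_upto (bessel_J_deriv \<nu> N) (z k))) = int k + d"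
    using has_offset_exists[OF fin win] by blast
  with has_offset_unique[OF off] have card: "\<forall>\<^sub>F k in sequentially. int (card (zeros_upto (bessel_J_deriv \<nu> N) (z k))) = int k + e"
    by metis
  define y where "y k = z (k + m)" for k
  have ev_shift: "\<forall>\<^sub>F k in sequentially. P (k + m)" if "\<forall>\<^sub>F k in sequentially. P k" for P
    using that by (rule eventually_all_ge_at_top[THEN eventually_mono]) (auto)
  have zero: "\<forall>\<^sub>F k in sequentially. bessel_J_deriv_zero \<nu> N (i k) = y k"
    using ev_shift[OF card] ev_shift[OF win] eventually_ge_at_top[of 1]
  proof eventually_elim
    case (elim k)
    have "card (zeros_upto (bessel_J_deriv \<nu> N) (y k)) = i k"
      using elim(1) i[OF elim(3)] unfolding y_def by linarith
    with kth_positive_zero_eq[OF fin window_zeroD(2)[OF elim(2)] window_zeroD(1)[OF elim(2)]]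
    show ?case by (simp add: bessel_J_deriv_zero_def y_def)
  qed
  have lim\<phi>: "(\<lambda>k. y k - \<phi> k) \<longlonglongrightarrow> 0"
    using LIMSEQ_ignore_initial_segment[OF lim, of m] by (simp only: y_def \<phi>)
  have \<phi>inf: "filterlim \<phi> at_top sequentially"
    unfolding \<phi> by real_asymp
  have "filterlim (\<lambda>k. (y k - \<phi> k) + \<phi> k) at_top sequentially"
    by (rule filterlim_tendsto_add_at_top[OF lim\<phi> \<phi>inf])
  then have yinf: "filterlim y at_top sequentially" by simp
  define E where "E k = Re (B (y k))" for k
  define V where "V k = y k * Im (B (y k))" for k
  note expand = has_expansion_Re_Im[OF B yinf, folded E_def V_def]
  have b0: "b 0 = 1" by (simp add: b_def bessel_deriv_exp_coeff_0)
  note offset = arctan_offset_expansion[where b = b, OF yinf b0 expand]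
  have "(\<lambda>k. E k - (\<Sum>p<1. (-1) ^ p * b (2 * p) * (1 / (y k)\<^sup>2) ^ p)) \<longlonglongrightarrow> 0"
  proof (rule bigo_tendsto_0[OF expand(1)])
    have iy: "(\<lambda>k. inverse (y k)) \<longlonglongrightarrow> 0" by (rule tendsto_inverse_0_at_top[OF yinf])
    have "(\<lambda>k. inverse (y k) * inverse (y k)) \<longlonglongrightarrow> 0 * 0" by (rule tendsto_mult[OF iy iy])
    then show "(\<lambda>k. (1 / (y k)\<^sup>2) ^ 1) \<longlonglongrightarrow> 0" by (simp add: power2_eq_square divide_inverse)
  qed
  then have "(\<lambda>k. E k - 1) \<longlonglongrightarrow> 0" by (simp add: b0)
  from tendsto_add[OF this tendsto_const[of 1]] have "E \<longlonglongrightarrow> 1" by simp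
  then have Epos: "\<forall>\<^sub>F k in sequentially. 0 < E k" by (rule order_tendstoD) simp
  have small: "\<forall>\<^sub>F k in sequentially. \<bar>y k - \<phi> k\<bar> < pi / 2"
    using tendstoD[OF lim\<phi>, of "pi / 2"] by (simp add: dist_real_def)
  have "\<forall>\<^sub>F k in sequentially. y k - \<phi> k = - (y k * arctan (V k * inverse (E k) / y k)) / y k"
    using Epos small ev_shift[OF win]
  proof eventually_elim
    case (elim k)
    note yk = window_zeroD(2)[OF elim(3), folded y_def] and y0 = window_zeroD(1)[OF elim(3), folded y_def]
    have e: "y k - bessel_beta \<nu> N = (y k - \<phi> k) + real (k + m) * pi" by (simp add: \<phi>)
    \<comment> \<open>At a multiple of pi the phase is a sign, which does not affect the vanishing
      of the imaginary part.\<close>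
    have "cis (real (k + m) * pi) = of_real ((-1) ^ (k + m))" by (simp add: complex_eq_iff del: of_nat_add)
    then have "cis (y k - bessel_beta \<nu> N) = cis (y k - \<phi> k) * of_real ((-1) ^ (k + m))"
      unfolding e by (simp only: cis_mult[symmetric])
    with im[OF yk y0] have "Im (of_real ((-1) ^ (k + m)) * (cis (y k - \<phi> k) * B (y k))) = 0" by (simp only: mult_ac)
    moreover have "Im (of_real r * w) = r * Im w" for r w by simp
    ultimately have "(-1) ^ (k + m) * Im (cis (y k - \<phi> k) * B (y k)) = 0" by (simp only:)
    then have "Im (cis (y k - \<phi> k) * B (y k)) = 0" by (simp only: mult_eq_0_iff power_eq_0_iff neg_equal_0_iff_equal one_neq_zero) simp
    from Im_cis_mult_eq_0_imp_arctan[OF this elim(1)[unfolded E_def] elim(2)]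
    moreover have "V k * inverse (E k) / y k = Im (B (y k)) / Re (B (y k))"
      using yk by (simp add: V_def E_def divide_inverse)
    ultimately show ?case using yk by simp
  qed
  then have "mcmahon_expansion y \<phi> (- b 1) (b 3 - b 1 * b 2 + b 1 ^ 3 / 3 - (- b 1)\<^sup>2)"
    by (rule mcmahon_expansion_of_offset[OF yinf \<phi>inf offset])
  then have "mcmahon_expansion y \<phi> (- b 1) (b 3 - b 1 * b 2 + b 1 ^ 3 / 3 - (b 1)\<^sup>2)" by (simp only: power2_minus)
  then show ?thesis by (simp only: mcmahon_expansion_cong[OF zero])
qed

theorem mainTheorem3:
  fixes m :: nat and \<nu> :: real
  assumes "\<nu> \<ge> 2 * real m"
  shows
    "(let a = (\<lambda>s. mcmahon_coeff \<nu> s (2 * m)) in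
       mcmahon_expansion
         (\<lambda>k. bessel_J_deriv_zero \<nu> (2 * m) (k + m))
         (\<lambda>k. real k * pi + \<nu> * pi / 2 - pi / 4)
         (a 1 / a 0)
         (a 3 / a 0 - a 1 * a 2 / (a 0)\<^sup>2 - 1 / 3 * ((a 1) ^ 3 / (a 0) ^ 3) - (a 1 / a 0)\<^sup>2)) \<and>
     (let a = (\<lambda>s. mcmahon_coeff \<nu> s (2 * m + 1)) in
       mcmahon_expansion
         (\<lambda>k. bessel_J_deriv_zero \<nu> (2 * m + 1) (if \<nu> = 2 * real m then k + m - 1 else k + m))
         (\<lambda>k. real k * pi + \<nu> * pi / 2 - 3 * pi / 4)
         (- (a 1 / a 0))
         (- ((a 1 / a 0)\<^sup>2 + a 3 / a 0 - a 1 * a 2 / (a 0)\<^sup>2 - 1 / 3 * ((a 1) ^ 3 / (a 0) ^ 3))))"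
proof (unfold Let_def, intro conjI)
  have \<nu>: "\<nu> \<ge> 0" "real (2 * m) \<le> \<nu>" using assms by (simp_all add: order_trans[OF _ assms])
  have i0: "2 * int 0 = 0" "2 * int 0 + 1 = 1" "2 * int 1 = 2" "2 * int 1 + 1 = 3" "2 * 0 = (0::nat)" "2 * 0 + 1 = (1::nat)" "2 * 1 = (2::nat)" "2 * 1 + 1 = (3::nat)"
    by simp_all
  note coeff = mcmahon_coeff_conv_exp_coeff[of \<nu> 0 m, unfolded i0] mcmahon_coeff_conv_exp_coeff[of \<nu> 1 m, unfolded i0]
  \<comment> \<open>Common sign of the coefficients. It cancels from every quotient in the
    statement, since numerator and denominator have the same degree in the coefficients.\<close>
  define s where "s = (-1 :: real) ^ m"
  have s: "s * s = 1" by (simp add: s_def flip: power_mult_distrib)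
  then have s0: "s \<noteq> 0" by auto
  have sg: "(-1 :: real) ^ (m + 0) = s" "(-1 :: real) ^ (m + 1) = - s" by (simp_all add: s_def)
  {
    define b where "b = bessel_deriv_exp_coeff \<nu> (2 * m)"
    have c: "mcmahon_coeff \<nu> 0 (2 * m) = s" "mcmahon_coeff \<nu> 1 (2 * m) = - s * b 1"
      "mcmahon_coeff \<nu> 2 (2 * m) = - s * b 2" "mcmahon_coeff \<nu> 3 (2 * m) = s * b 3"
      using coeff(1,2,5,6) unfolding sg b_def[symmetric]
      by (simp_all add: b_def bessel_deriv_exp_coeff_0 del: bessel_deriv_exp_coeff.simps)
    have "mcmahon_expansion (\<lambda>k. bessel_J_deriv_zero \<nu> (2 * m) (k + m)) (\<lambda>k. real k * pi + \<nu> * pi / 2 - pi / 4)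
       (- b 1) (b 3 - b 1 * b 2 + b 1 ^ 3 / 3 - (b 1)\<^sup>2)"
      unfolding b_def
    proof (rule mcmahon_expansion_bessel_zeros[OF \<nu>(1) _ has_offset_bessel_J_deriv[OF \<nu>(2)]])
      show "real (2 * m) \<le> \<nu> + 1" using \<nu>(2) by linarith
      show "real k * pi + \<nu> * pi / 2 - pi / 4 = real (k + m) * pi + bessel_beta \<nu> (2 * m)" for k
        by (simp add: field_simps)
    qed simp
    moreover have "mcmahon_coeff \<nu> 1 (2 * m) / mcmahon_coeff \<nu> 0 (2 * m) = - b 1" using s0 by (simp add: c)
    moreover have "mcmahon_coeff \<nu> 3 (2 * m) / mcmahon_coeff \<nu> 0 (2 * m)
        - mcmahon_coeff \<nu> 1 (2 * m) * mcmahon_coeff \<nu> 2 (2 * m) / (mcmahon_coeff \<nu> 0 (2 * m))\<^sup>2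
        - 1 / 3 * ((mcmahon_coeff \<nu> 1 (2 * m)) ^ 3 / (mcmahon_coeff \<nu> 0 (2 * m)) ^ 3)
        - (mcmahon_coeff \<nu> 1 (2 * m) / mcmahon_coeff \<nu> 0 (2 * m))\<^sup>2 = b 3 - b 1 * b 2 + b 1 ^ 3 / 3 - (b 1)\<^sup>2"
      unfolding c using s0 by (simp add: power2_eq_square power3_eq_cube field_simps)
    ultimately show "mcmahon_expansion (\<lambda>k. bessel_J_deriv_zero \<nu> (2 * m) (k + m)) (\<lambda>k. real k * pi + \<nu> * pi / 2 - pi / 4)
        (mcmahon_coeff \<nu> 1 (2 * m) / mcmahon_coeff \<nu> 0 (2 * m))
        (mcmahon_coeff \<nu> 3 (2 * m) / mcmahon_coeff \<nu> 0 (2 * m)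
        - mcmahon_coeff \<nu> 1 (2 * m) * mcmahon_coeff \<nu> 2 (2 * m) / (mcmahon_coeff \<nu> 0 (2 * m))\<^sup>2
        - 1 / 3 * ((mcmahon_coeff \<nu> 1 (2 * m)) ^ 3 / (mcmahon_coeff \<nu> 0 (2 * m)) ^ 3)
        - (mcmahon_coeff \<nu> 1 (2 * m) / mcmahon_coeff \<nu> 0 (2 * m))\<^sup>2)"
      by (simp only:)
  }
  {
    let ?c = "\<lambda>s. mcmahon_coeff \<nu> s (2 * m + 1)"
    let ?i = "\<lambda>k. if \<nu> = 2 * real m then k + m - 1 else k + m"
    define b where "b = bessel_deriv_exp_coeff \<nu> (2 * m + 1)"
    have c: "?c 0 = - s" "?c 1 = - s * b 1" "?c 2 = s * b 2" "?c 3 = s * b 3"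
      using coeff(3,4,7,8) unfolding sg b_def[symmetric]
      by (simp_all add: b_def bessel_deriv_exp_coeff_0 del: bessel_deriv_exp_coeff.simps mcmahon_coeff.simps)
    \<comment> \<open>The exceptional order \<nu> = 2 m has offset -1, which matches the index k + m
      - 1.\<close>
    have off: "has_offset (bessel_J_deriv \<nu> (2 * m + 1)) (bessel_beta \<nu> (2 * m + 1)) (if real (2 * m) = \<nu> then 0 - 1 else 0)"
      using has_offset_bessel_J_deriv_Suc[OF \<nu> has_offset_bessel_J_deriv[OF \<nu>(2)]] by (simp only: Suc_eq_plus1)
    have "mcmahon_expansion (\<lambda>k. bessel_J_deriv_zero \<nu> (2 * m + 1) (?i k)) (\<lambda>k. real k * pi + \<nu> * pi / 2 - 3 * pi / 4)
       (- b 1) (b 3 - b 1 * b 2 + b 1 ^ 3 / 3 - (b 1)\<^sup>2)"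
      unfolding b_def
    proof (rule mcmahon_expansion_bessel_zeros[OF \<nu>(1) _ off])
      show "real (2 * m + 1) \<le> \<nu> + 1" using \<nu>(2) by simp
      show "real k * pi + \<nu> * pi / 2 - 3 * pi / 4 = real (k + m) * pi + bessel_beta \<nu> (2 * m + 1)" for k
        by (simp add: field_simps)
      show "int (?i k) = int (k + m) + (if real (2 * m) = \<nu> then 0 - 1 else 0)" if "k \<ge> 1" for k
        using that by auto
    qed
    moreover have "- (?c 1 / ?c 0) = - b 1" unfolding c using s0 by simp
    moreover have "- ((?c 1 / ?c 0)\<^sup>2 + ?c 3 / ?c 0 - ?c 1 * ?c 2 / (?c 0)\<^sup>2 - 1 / 3 * ((?c 1) ^ 3 / (?c 0) ^ 3))
       = b 3 - b 1 * b 2 + b 1 ^ 3 / 3 - (b 1)\<^sup>2"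
      unfolding c using s0 by (simp add: power2_eq_square power3_eq_cube field_simps)
    ultimately show "mcmahon_expansion (\<lambda>k. bessel_J_deriv_zero \<nu> (2 * m + 1) (?i k)) (\<lambda>k. real k * pi + \<nu> * pi / 2 - 3 * pi / 4)
        (- (?c 1 / ?c 0)) (- ((?c 1 / ?c 0)\<^sup>2 + ?c 3 / ?c 0 - ?c 1 * ?c 2 / (?c 0)\<^sup>2 - 1 / 3 * ((?c 1) ^ 3 / (?c 0) ^ 3)))"
      by (simp only:)
  }
qed

end
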